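(* Let $n$ be a positive integer, $0<p<\infty$, and $w_k\in L^{q_k}(D)$, $0\le k\le n-1$, where for every $k$ either $q_k>2$, or $1<q_k\le 2$ and $p<\frac{q_k}{2-q_k}$ (with $\frac{q_k}{2-q_k}=\infty$ if $q_k=2$). Let $f\in P^{n,p}(D,\mathbb{B})$ have the representation $$f=\sum_{k=0}^{n-1}\widehat{z^*}^{\,k}\,\varphi_k,\qquad \varphi_k\in Hol(D,\mathbb{B}),$$ with $\varphi_k^+\in H^p_{w_k}(D)$ for each $k$. Then $f$ has a nontangential limit $f_{nt}\in L^p(\partial D,\mathbb{B})$, and $$\lim_{r\nearrow1}\int_0^{2\pi}\|f_{nt}(e^{i\theta})-f(re^{i\theta})\|_{\mathbb{B}}^p\,d\theta=0.$$
   Context: $D$ is the open unit disk in $\mathbb{C}$, $\partial D$ the unit circle. For $u=x+iy\in\mathbb{C}$, $u^*=x-iy$; $\frac{\partial}{\partial z^*}=\frac12(\partial_x+i\partial_y)$. $\mathbb{B}$ denotes the bicomplex numbers: the commutative $\mathbb{C}$-algebra of elements $z_1+jz_2$ with $z_1,z_2\in\mathbb{C}$, $j^2=-1$, $ij=ji$. Put $p^\pm=\frac12(1\pm ij)$. Each $w=z_1+jz_2\in\mathbb{B}$ is uniquely $w=p^+w^++p^-w^-$ with $w^\pm=z_1\mp iz_2\in\mathbb{C}$ (for functions, pointwise), and $\|w\|_{\mathbb{B}}=\sqrt{(|w^+|^2+|w^-|^2)/2}$. $L^p(\partial D,\mathbb{B})$ is the set of $\mathbb{B}$-valued functions on $\partial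 D$ with $\|\cdot\|_{\mathbb{B}}^p$ integrable; $L^{q}(D)$ is the usual complex-valued Lebesgue space. The bicomplexification of $u=x+iy$ is $\widehat u=x+jy$; thus $\widehat{z^*}=x-jy$. $\bar\partial=\frac12(\partial_x+j\partial_y)$. $Hol(D,\mathbb{B})$ is the set of $f:D\to\mathbb{B}$ with $\bar\partial f=0$, equivalently with $(f^+)^*$ and $f^-$ ordinary holomorphic functions. For $0<p<\infty$, $\|f\|_{H^p_{\mathbb{B}}}=\sup_{0<r<1}\left(\int_0^{2\pi}\|f(re^{i\theta})\|_{\mathbb{B}}^p\,d\theta\right)^{1/p}$. $P^{n,p}(D,\mathbb{B})$ is the set of $f:D\to\mathbb{B}$ with $\bar\partial^{\,n}f=0$ and $\sum_{k=0}^{n-1}\|\bar\partial^{\,k}f\|_{H^p_{\mathbb{B}}}<\infty$. For $w:D\to\mathbb{C}$, $H^p_w(D)$ is the set of $u:D\to\mathbb{C}$ with $\frac{\partial u}{\partial z^*}=w$ and $\sup_{0<r<1}\int_0^{2\pi}|u(re^{i\theta})|^p\,d\theta<\infty$. A function $f$ on $D$ has nontangential limit $f_{nt}$ if for almost every $\theta$, $f(z)\to f_{nt}(e^{i\theta})$ as $z\to e^{i\theta}$ within every nontangential approach region (Stolz angle) at $e^{i\theta}$. *)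

theory Defs
  imports "HOL-Analysis.Analysis"
begin

section \<open>Bicomplex numbers\<close>

text \<open>\<open>Bicomplex z1 z2\<close> stands for \<open>z1 + j z2\<close>.\<close>

codatatype bicomplex = Bicomplex (bc1: complex) (bc2: complex)

lemma bicomplex_eq_iff: "x = y \<longleftrightarrow> bc1 x = bc1 y \<and> bc2 x = bc2 y"
  by (auto intro: bicomplex.expand)

instantiation bicomplex :: comm_ring_1
begin

primcorec zero_bicomplex where
  "bc1 0 = 0"
| "bc2 0 = 0"

primcorec one_bicomplex where
  "bc1 1 = 1"
| "bc2 1 = 0"

primcorec plus_bicomplex where
  "bc1 (x + y) = bc1 x + bc1 y"
| "bc2 (x + y) = bc2 x + bc2 y"

primcorec uminus_bicomplex where
  "bc1 (- x) = - bc1 x"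
| "bc2 (- x) = - bc2 x"

primcorec minus_bicomplex where
  "bc1 (x - y) = bc1 x - bc1 y"
| "bc2 (x - y) = bc2 x - bc2 y"

primcorec times_bicomplex where
  "bc1 (x * y) = bc1 x * bc1 y - bc2 x * bc2 y"
| "bc2 (x * y) = bc1 x * bc2 y + bc2 x * bc1 y"

instance
  by standard (simp_all add: bicomplex_eq_iff algebra_simps)

end

instantiation bicomplex :: real_algebra_1
begin

primcorec scaleR_bicomplex where
  "bc1 (scaleR r x) = scaleR r (bc1 x)"
| "bc2 (scaleR r x) = scaleR r (bc2 x)"

instance
  by standard (simp_all add: bicomplex_eq_iff algebra_simps)

end

definition jB :: bicomplex where
  "jB = Bicomplex 0 1"

definition of_complex :: "complex \<Rightarrow> bicomplex" where
  "of_complex z = Bicomplex z 0"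

definition p_plus :: bicomplex where
  "p_plus = (1/2) *\<^sub>R (1 + of_complex \<i> * jB)"

definition p_minus :: bicomplex where
  "p_minus = (1/2) *\<^sub>R (1 - of_complex \<i> * jB)"

definition plus_part :: "bicomplex \<Rightarrow> complex" where
  "plus_part w = bc1 w - \<i> * bc2 w"

definition minus_part :: "bicomplex \<Rightarrow> complex" where
  "minus_part w = bc1 w + \<i> * bc2 w"

lemma jB_squared: "jB * jB = -1"
  by (simp add: jB_def bicomplex_eq_iff)

lemma Bicomplex_eq: "Bicomplex z1 z2 = of_complex z1 + jB * of_complex z2"
  by (simp add: jB_def of_complex_def bicomplex_eq_iff)

lemma idempotent_representation:
  "w = p_plus * of_complex a + p_minus * of_complex b
     \<longleftrightarrow> a = plus_part w \<and> b = minus_part w"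
  by (auto simp: p_plus_def p_minus_def plus_part_def minus_part_def jB_def of_complex_def
      bicomplex_eq_iff complex_eq_iff field_simps)

instantiation bicomplex :: real_normed_vector
begin

definition norm_bicomplex :: "bicomplex \<Rightarrow> real" where
  "norm w = sqrt (((cmod (plus_part w))\<^sup>2 + (cmod (minus_part w))\<^sup>2) / 2)"

definition sgn_bicomplex :: "bicomplex \<Rightarrow> bicomplex" where
  "sgn (w :: bicomplex) = w /\<^sub>R norm w"

definition dist_bicomplex :: "bicomplex \<Rightarrow> bicomplex \<Rightarrow> real" where
  "dist v w = norm (v - w :: bicomplex)"

definition uniformity_bicomplex :: "(bicomplex \<times> bicomplex) filter" where
  "uniformity = (INF e\<in>{0 <..}. principal {(x :: bicomplex, y). dist x y < e})"

definition open_bicomplex :: "bicomplex set \<Rightarrow> bool" where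
  "open U \<longleftrightarrow> (\<forall>x\<in>(U :: bicomplex set). eventually (\<lambda>(x', y). x' = x \<longrightarrow> y \<in> U) uniformity)"

instance
proof
  have norm_eq: "norm w = norm (bc1 w, bc2 w)" for w :: bicomplex
    unfolding norm_bicomplex_def norm_Pair plus_part_def minus_part_def cmod_power2
    by (rule arg_cong[of _ _ sqrt]) (simp add: power2_eq_square algebra_simps)
  fix r :: real and x y :: bicomplex
  show "norm x = 0 \<longleftrightarrow> x = 0"
    by (simp add: norm_eq bicomplex_eq_iff zero_prod_def)
  show "norm (x + y) \<le> norm x + norm y"
    using norm_triangle_ineq[of "(bc1 x, bc2 x)" "(bc1 y, bc2 y)"] by (simp add: norm_eq)
  show "norm (r *\<^sub>R x) = \<bar>r\<bar> * norm x"
    using norm_scaleR[of r "(bc1 x, bc2 x)"] by (simp add: norm_eq)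
qed (rule sgn_bicomplex_def dist_bicomplex_def uniformity_bicomplex_def open_bicomplex_def)+

end

text \<open>The bicomplexification \<open>x + jy\<close> of \<open>x + iy\<close>.\<close>

definition bihat :: "complex \<Rightarrow> bicomplex" where
  "bihat u = Bicomplex (of_real (Re u)) (of_real (Im u))"


section \<open>Differential operators and function spaces on the unit disc\<close>

text \<open>Functions on \<open>D\<close> are total functions of which only the values on \<open>unit_disc\<close> matter.\<close>

abbreviation unit_disc :: "complex set" where
  "unit_disc \<equiv> ball 0 1"

text \<open>
  Differentiability on \<open>D\<close> is in the real (Frechet) sense; then the partial derivatives
  \<open>\<partial>\<^sub>x\<close>, \<open>\<partial>\<^sub>y\<close> at \<open>z\<close> are the values of the derivative at the vectors \<open>1\<close> and \<open>\<i>\<close>.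
  Mere existence of the partial derivatives would not do: there are discontinuous solutions
  of the Cauchy-Riemann equations.
\<close>

definition real_diff_on_disc :: "(complex \<Rightarrow> 'b::real_normed_vector) \<Rightarrow> bool" where
  "real_diff_on_disc f \<longleftrightarrow> (\<forall>z\<in>unit_disc. f differentiable (at z))"

definition dzbar :: "(complex \<Rightarrow> complex) \<Rightarrow> complex \<Rightarrow> complex" where
  "dzbar u z = (frechet_derivative u (at z) 1 + \<i> * frechet_derivative u (at z) \<i>) / 2"

definition dbar :: "(complex \<Rightarrow> bicomplex) \<Rightarrow> complex \<Rightarrow> bicomplex" where
  "dbar f z = (1/2) *\<^sub>R (frechet_derivative f (at z) 1 + jB * frechet_derivative f (at z) \<i>)"

definition Hol :: "(complex \<Rightarrow> bicomplex) set" where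
  "Hol = {f. real_diff_on_disc f \<and> (\<forall>z\<in>unit_disc. dbar f z = 0)}"

text \<open>Integrals over circles are taken in \<open>[0,\<infinity>]\<close>, so that divergence is visible.\<close>

definition circle_mean :: "real \<Rightarrow> (complex \<Rightarrow> 'b::real_normed_vector) \<Rightarrow> real \<Rightarrow> ennreal" where
  "circle_mean p f r =
     (\<integral>\<^sup>+ \<theta>. ennreal (norm (f (of_real r * cis \<theta>)) powr p) \<partial>lebesgue_on {0..2*pi})"

definition ennroot :: "real \<Rightarrow> ennreal \<Rightarrow> ennreal" where
  "ennroot p x = (if x = \<infinity> then \<infinity> else ennreal (enn2real x powr (1 / p)))"

definition Hp_norm :: "real \<Rightarrow> (complex \<Rightarrow> bicomplex) \<Rightarrow> ennreal" where
  "Hp_norm p f = (SUP r\<in>{0<..<1}. ennroot p (circle_mean p f r))"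

definition poly_Hardy :: "nat \<Rightarrow> real \<Rightarrow> (complex \<Rightarrow> bicomplex) set" where
  "poly_Hardy n p = {f. (\<forall>k<n. real_diff_on_disc ((dbar ^^ k) f)) \<and>
                        (\<forall>z\<in>unit_disc. (dbar ^^ n) f z = 0) \<and>
                        (\<Sum>k<n. Hp_norm p ((dbar ^^ k) f)) < \<infinity>}"

text \<open>
  As \<open>w\<close> is only given up to null sets in the applications, the equation
  \<open>\<partial>u/\<partial>z* = w\<close> is required almost everywhere.
\<close>

definition Hp_inhom :: "real \<Rightarrow> (complex \<Rightarrow> complex) \<Rightarrow> (complex \<Rightarrow> complex) set" where
  "Hp_inhom p w = {u. real_diff_on_disc u \<and>
                      (AE z in lebesgue_on unit_disc. dzbar u z = w z) \<and>
                      (SUP r\<in>{0<..<1}. circle_mean p u r) < \<infinity>}"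

definition Lp :: "real \<Rightarrow> 'a measure \<Rightarrow> ('a \<Rightarrow> 'b::real_normed_vector) set" where
  "Lp p M = {g. g \<in> borel_measurable M \<and> integrable M (\<lambda>x. norm (g x) powr p)}"

definition Lp_circle :: "real \<Rightarrow> (complex \<Rightarrow> bicomplex) set" where
  "Lp_circle p = {g. (\<lambda>\<theta>. g (cis \<theta>)) \<in> Lp p (lebesgue_on {0..2*pi})}"


section \<open>Nontangential limits\<close>

definition stolz :: "real \<Rightarrow> complex \<Rightarrow> complex set" where
  "stolz \<alpha> \<zeta> = {z \<in> unit_disc. cmod (z - \<zeta>) < \<alpha> * (1 - cmod z)}"

definition nontangential_limit ::
    "(complex \<Rightarrow> 'b::real_normed_vector) \<Rightarrow> (complex \<Rightarrow> 'b) \<Rightarrow> bool" where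
  "nontangential_limit f g \<longleftrightarrow>
     (AE \<theta> in lebesgue_on {0..2*pi}.
        \<forall>\<alpha>>1. (f \<longlongrightarrow> g (cis \<theta>)) (at (cis \<theta>) within stolz \<alpha> (cis \<theta>)))"

end

theory Submission
  imports Defs "HOL-Complex_Analysis.Complex_Analysis"
begin

text \<open>
  Write \<open>f\<^sup>+\<close> and \<open>f\<^sup>-\<close> for the two idempotent components. The maps \<open>w \<mapsto> w\<^sup>-\<close> and
  \<open>w \<mapsto> cnj (w\<^sup>+)\<close> are both real algebra homomorphisms \<open>A\<close> into \<open>\<complex>\<close> that send \<open>j\<close> to \<open>\<i>\<close>. Such
  an \<open>A\<close> turns the bicomplex \<open>\<partial>\<close>-bar operator into \<open>\<partial>/\<partial>z\<^sup>*\<close>, elements of \<open>Hol\<close> into holomorphic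
  functions, and \<open>f\<close> into the polyanalytic function \<open>\<Sum>k<n. cnj z ^ k * A (\<phi> k z)\<close>. Its derivatives
  \<open>(\<partial>/\<partial>z\<^sup>*)\<^sup>m\<close> have bounded means of order \<open>p\<close> on circles. They form a triangular system for the
  coefficients \<open>A \<circ> \<phi> k\<close>, which can be solved from the top coefficient downwards, so that every
  coefficient lies in the classical Hardy space \<open>H\<^sup>p\<close>
  (\<open>poly_Hardy_coefficients_bounded_means\<close>). As \<open>cnj z ^ k\<close> is continuous on the closed disc, it
  remains to prove the classical theorem for a holomorphic \<open>u\<close> in \<open>H\<^sup>p\<close>, \<open>0 < p < \<infinity>\<close>: nontangential
  limits exist almost everywhere, and \<open>\<bar>u\<bar>\<^sup>p\<close> is dominated on all circles at once by an integrable
  function of the angle (\<open>Hardy_boundary_behaviour\<close>). Convergence in the mean is then dominated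
  convergence.

  For \<open>p = 2\<close> the Poisson formula and a comparison of Poisson kernels bound \<open>u\<close> in every Stolz angle
  by the maximal function \<open>sup\<^sub>i P\<^sub>i * g\<close> over dyadic radii. That maximal function is bounded on
  \<open>L\<^sup>2\<close>: choosing the best radius at every angle linearises it to one positive integral operator \<open>T\<close>,
  and the kernel of \<open>T T\<^sup>*\<close> is at most a constant times the kernel of \<open>T + T\<^sup>*\<close>, which forces
  \<open>\<parallel>T\<parallel>\<^sup>2 \<le> 2C \<parallel>T\<parallel>\<close> (\<open>TT_star_bound\<close>, \<open>poisson_maximal_inequality\<close>, \<open>H2_maximal\<close>). Applied to the tails
  of the Taylor series, whose \<open>H\<^sup>2\<close> norms tend to \<open>0\<close> by Parseval, the maximal inequality shows that
  the oscillation of \<open>u\<close> in Stolz angles vanishes at almost every boundary point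
  (\<open>H2_nontangential_limit\<close>).

  For general \<open>p\<close>, a function that is holomorphic across the unit circle and has no zeros on it is a
  finite Blaschke product times \<open>exp L\<close>. Powers of \<open>exp L\<close> with small exponents are in \<open>H\<^sup>2\<close>, and so
  is the power with exponent \<open>p/2\<close>. Dilating \<open>u\<close>, factorising, and passing to the limit with Montel's
  theorem gives \<open>u = B h\<^sup>m\<close> with \<open>\<bar>B\<bar> \<le> 1\<close> and \<open>h \<in> H\<^sup>2\<close>, and \<open>\<bar>u\<bar>\<^sup>p \<le> \<bar>k\<bar>\<^sup>2\<close> with \<open>k \<in> H\<^sup>2\<close>
  (\<open>Hardy_factorization\<close>). The first factorisation gives the limits, the second one the domination.
\<close>

section \<open>Positive kernels and the TT* argument\<close>

lemma ennreal_le_of_power2_le: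
  fixes x y :: ennreal
  assumes "x\<^sup>2 \<le> y\<^sup>2"
  shows "x \<le> y"
proof (cases y)
  case (real b)
  show ?thesis
  proof (cases x)
    case (real a)
    with \<open>y = ennreal b\<close> \<open>0 \<le> b\<close> assms have "a\<^sup>2 \<le> b\<^sup>2"
      by (simp add: ennreal_power)
    hence "a \<le> b" using \<open>0 \<le> b\<close> by (rule power2_le_imp_le)
    thus ?thesis using real \<open>y = ennreal b\<close> by (simp add: ennreal_leI)
  next
    case top
    thus ?thesis using assms real by (simp add: ennreal_power power2_eq_square ennreal_mult_eq_top_iff top_unique)
  qed
qed simp

text \<open>
  Two applications of the Cauchy-Schwarz inequality. With \<open>m = T g\<close>, first
  \<open>\<parallel>m\<parallel>\<^sup>2 = \<langle>g, T\<^sup>* m\<rangle> \<le> \<parallel>g\<parallel> \<parallel>T\<^sup>* m\<parallel>\<close>; and by the hypothesis on the kernel of \<open>T T\<^sup>*\<close>,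
  \<open>\<parallel>T\<^sup>* m\<parallel>\<^sup>2 = \<langle>m, T T\<^sup>* m\<rangle> \<le> 2C \<langle>m, T m\<rangle> \<le> 2C (sqrt A) \<parallel>m\<parallel>\<^sup>2\<close>. So any constant \<open>A\<close> that is admissible
  in the inequality can be replaced by \<open>2C (sqrt A)\<close>.
\<close>

lemma TT_star_step:
  fixes k :: "'a \<Rightarrow> 'a \<Rightarrow> ennreal" and C A :: real
  assumes "finite_measure M"
    and [measurable]: "case_prod k \<in> borel_measurable (M \<Otimes>\<^sub>M M)"
    and comp: "\<And>x y. x \<in> space M \<Longrightarrow> y \<in> space M \<Longrightarrow>
                 (\<integral>\<^sup>+t. k x t * k y t \<partial>M) \<le> ennreal C * (k x y + k y x)"
    and "C > 0" "A > 0"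
    and bound: "\<And>g. g \<in> borel_measurable M \<Longrightarrow>
                 (\<integral>\<^sup>+x. (\<integral>\<^sup>+t. k x t * g t \<partial>M)\<^sup>2 \<partial>M) \<le> ennreal A * (\<integral>\<^sup>+t. (g t)\<^sup>2 \<partial>M)"
    and [measurable]: "g \<in> borel_measurable M"
  shows "(\<integral>\<^sup>+x. (\<integral>\<^sup>+t. k x t * g t \<partial>M)\<^sup>2 \<partial>M) \<le> ennreal (2 * C * sqrt A) * (\<integral>\<^sup>+t. (g t)\<^sup>2 \<partial>M)"
proof (cases "(\<integral>\<^sup>+t. (g t)\<^sup>2 \<partial>M) = \<infinity>")
  case True
  thus ?thesis using \<open>C > 0\<close> \<open>A > 0\<close> by (simp add: ennreal_mult_top)
next
  case False
  interpret finite_measure M by fact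
  interpret pair_sigma_finite M M ..
  define T where "T g x = (\<integral>\<^sup>+t. k x t * g t \<partial>M)" for g x
  define S where "S g t = (\<integral>\<^sup>+x. k x t * g x \<partial>M)" for g t
  have T_meas [measurable]: "T g \<in> borel_measurable M" if [measurable]: "g \<in> borel_measurable M" for g
    unfolding T_def by measurable
  have S_meas [measurable]: "S g \<in> borel_measurable M" if [measurable]: "g \<in> borel_measurable M" for g
    unfolding S_def by measurable
  define m where "m = T g"
  have [measurable]: "m \<in> borel_measurable M" unfolding m_def by measurable
  define G where "G = (\<integral>\<^sup>+t. (g t)\<^sup>2 \<partial>M)"
  define I where "I = (\<integral>\<^sup>+x. (m x)\<^sup>2 \<partial>M)"
  define J where "J = (\<integral>\<^sup>+t. (S m t)\<^sup>2 \<partial>M)"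
  define X where "X = (\<integral>\<^sup>+x. m x * T m x \<partial>M)"
  have "I \<le> ennreal A * G"
    unfolding I_def G_def m_def T_def by (rule bound) measurable
  moreover have "G < \<infinity>" using False unfolding G_def by (simp add: top.not_eq_extremum)
  ultimately have "I < \<infinity>" by (metis ennreal_mult_less_top ennreal_less_top infinity_ennreal_def le_less_trans)
  have "I = (\<integral>\<^sup>+x. (\<integral>\<^sup>+t. m x * (k x t * g t) \<partial>M) \<partial>M)"
    unfolding I_def
  proof (intro nn_integral_cong)
    fix x assume [measurable]: "x \<in> space M"
    show "(m x)\<^sup>2 = (\<integral>\<^sup>+t. m x * (k x t * g t) \<partial>M)"
      by (subst nn_integral_cmult) (auto simp: power2_eq_square m_def T_def)
  qed
  also have "\<dots> = (\<integral>\<^sup>+t. (\<integral>\<^sup>+x. m x * (k x t * g t) \<partial>M) \<partial>M)"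
    by (rule Fubini'[symmetric]) measurable
  also have "\<dots> = (\<integral>\<^sup>+t. g t * S m t \<partial>M)"
  proof (intro nn_integral_cong)
    fix t assume [measurable]: "t \<in> space M"
    show "(\<integral>\<^sup>+x. m x * (k x t * g t) \<partial>M) = g t * S m t"
      unfolding S_def by (subst nn_integral_cmult[symmetric]) (auto intro!: nn_integral_cong simp: mult_ac)
  qed
  finally have "I\<^sup>2 \<le> G * J"
    unfolding G_def J_def by (metis Cauchy_Schwarz_nn_integral S_meas \<open>g \<in> borel_measurable M\<close> \<open>m \<in> borel_measurable M\<close>)
  have "J = (\<integral>\<^sup>+t. (\<integral>\<^sup>+x. (\<integral>\<^sup>+y. (m x * m y) * (k x t * k y t) \<partial>M) \<partial>M) \<partial>M)"
    unfolding J_def power2_eq_square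
  proof (intro nn_integral_cong)
    fix t assume [measurable]: "t \<in> space M"
    have "S m t * S m t = (\<integral>\<^sup>+x. k x t * m x * S m t \<partial>M)"
      by (subst nn_integral_multc) (auto simp: S_def)
    also have "\<dots> = (\<integral>\<^sup>+x. (\<integral>\<^sup>+y. (k x t * m x) * (k y t * m y) \<partial>M) \<partial>M)"
      by (subst nn_integral_cmult) (auto simp: S_def)
    finally show "S m t * S m t = (\<integral>\<^sup>+x. (\<integral>\<^sup>+y. (m x * m y) * (k x t * k y t) \<partial>M) \<partial>M)"
      by (simp add: mult_ac)
  qed
  also have "\<dots> = (\<integral>\<^sup>+x. (\<integral>\<^sup>+t. (\<integral>\<^sup>+y. (m x * m y) * (k x t * k y t) \<partial>M) \<partial>M) \<partial>M)"
    by (rule Fubini') measurable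
  also have "\<dots> = (\<integral>\<^sup>+x. (\<integral>\<^sup>+y. (\<integral>\<^sup>+t. (m x * m y) * (k x t * k y t) \<partial>M) \<partial>M) \<partial>M)"
  proof (rule nn_integral_cong)
    fix x assume [measurable]: "x \<in> space M"
    show "(\<integral>\<^sup>+t. (\<integral>\<^sup>+y. (m x * m y) * (k x t * k y t) \<partial>M) \<partial>M) =
          (\<integral>\<^sup>+y. (\<integral>\<^sup>+t. (m x * m y) * (k x t * k y t) \<partial>M) \<partial>M)"
      by (rule Fubini') measurable
  qed
  also have "\<dots> \<le> (\<integral>\<^sup>+x. (\<integral>\<^sup>+y. ennreal C * (m x * (k x y * m y)) +
                                ennreal C * (m y * (k y x * m x)) \<partial>M) \<partial>M)"
  proof (intro nn_integral_mono)
    fix x y assume xy [measurable]: "x \<in> space M" "y \<in> space M"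
    have "(\<integral>\<^sup>+t. (m x * m y) * (k x t * k y t) \<partial>M) = (m x * m y) * (\<integral>\<^sup>+t. k x t * k y t \<partial>M)"
      by (rule nn_integral_cmult) measurable
    also have "\<dots> \<le> (m x * m y) * (ennreal C * (k x y + k y x))"
      by (intro mult_left_mono comp xy) auto
    also have "\<dots> = ennreal C * (m x * (k x y * m y)) + ennreal C * (m y * (k y x * m x))"
      by (simp add: distrib_left mult_ac)
    finally show "(\<integral>\<^sup>+t. (m x * m y) * (k x t * k y t) \<partial>M) \<le>
      ennreal C * (m x * (k x y * m y)) + ennreal C * (m y * (k y x * m x))" .
  qed
  also have "\<dots> = (\<integral>\<^sup>+x. (\<integral>\<^sup>+y. ennreal C * (m x * (k x y * m y)) \<partial>M) +
                       (\<integral>\<^sup>+y. ennreal C * (m y * (k y x * m x)) \<partial>M) \<partial>M)"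
    by (rule nn_integral_cong, rule nn_integral_add) measurable
  also have "\<dots> = (\<integral>\<^sup>+x. (\<integral>\<^sup>+y. ennreal C * (m x * (k x y * m y)) \<partial>M) \<partial>M) +
                  (\<integral>\<^sup>+x. (\<integral>\<^sup>+y. ennreal C * (m y * (k y x * m x)) \<partial>M) \<partial>M)"
    by (rule nn_integral_add) measurable
  also have "(\<integral>\<^sup>+x. (\<integral>\<^sup>+y. ennreal C * (m y * (k y x * m x)) \<partial>M) \<partial>M) =
             (\<integral>\<^sup>+y. (\<integral>\<^sup>+x. ennreal C * (m y * (k y x * m x)) \<partial>M) \<partial>M)"
    by (rule Fubini') measurable
  also have "(\<integral>\<^sup>+x. (\<integral>\<^sup>+y. ennreal C * (m x * (k x y * m y)) \<partial>M) \<partial>M) = ennreal C * X"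
  proof -
    have "(\<integral>\<^sup>+y. ennreal C * (m x * (k x y * m y)) \<partial>M) = ennreal C * (m x * T m x)"
      if [measurable]: "x \<in> space M" for x
    proof -
      have "(\<integral>\<^sup>+y. ennreal C * (m x * (k x y * m y)) \<partial>M) = ennreal C * (\<integral>\<^sup>+y. m x * (k x y * m y) \<partial>M)"
        by (rule nn_integral_cmult) measurable
      also have "(\<integral>\<^sup>+y. m x * (k x y * m y) \<partial>M) = m x * T m x"
        unfolding T_def by (rule nn_integral_cmult) measurable
      finally show ?thesis .
    qed
    hence "(\<integral>\<^sup>+x. (\<integral>\<^sup>+y. ennreal C * (m x * (k x y * m y)) \<partial>M) \<partial>M) =
           (\<integral>\<^sup>+x. ennreal C * (m x * T m x) \<partial>M)"
      by (rule nn_integral_cong)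
    also have "\<dots> = ennreal C * X"
      unfolding X_def by (rule nn_integral_cmult) measurable
    finally show ?thesis .
  qed
  finally have J: "J \<le> ennreal C * X + ennreal C * X" .
  have "X\<^sup>2 \<le> I * (\<integral>\<^sup>+x. (T m x)\<^sup>2 \<partial>M)"
    unfolding X_def I_def by (rule Cauchy_Schwarz_nn_integral) measurable
  also have "\<dots> \<le> I * (ennreal A * I)"
    unfolding I_def T_def by (intro mult_left_mono bound) auto
  also have "\<dots> = (ennreal (sqrt A) * I)\<^sup>2"
  proof -
    have "(ennreal (sqrt A))\<^sup>2 = ennreal A"
      using \<open>A > 0\<close> by (simp add: ennreal_power)
    thus ?thesis by (simp add: power_mult_distrib power2_eq_square[of I] mult_ac)
  qed
  finally have X: "X \<le> ennreal (sqrt A) * I" by (rule ennreal_le_of_power2_le)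
  obtain i where i: "I = ennreal i" "i \<ge> 0" using \<open>I < \<infinity>\<close> by (cases I) auto
  obtain gg where gg: "G = ennreal gg" "gg \<ge> 0" using \<open>G < \<infinity>\<close> by (cases G) auto
  have "J \<le> ennreal C * (ennreal (sqrt A) * I) + ennreal C * (ennreal (sqrt A) * I)"
    by (rule order_trans[OF J]) (intro add_mono mult_left_mono X, auto)
  also have "\<dots> = ennreal (2 * C * sqrt A * i)"
    using i \<open>C > 0\<close> \<open>A > 0\<close> by (simp add: ennreal_mult[symmetric] ennreal_plus[symmetric] del: ennreal_plus)
  finally have "I\<^sup>2 \<le> G * ennreal (2 * C * sqrt A * i)"
    using \<open>I\<^sup>2 \<le> G * J\<close> by (meson mult_left_mono order_trans zero_le)
  hence "i\<^sup>2 \<le> gg * (2 * C * sqrt A * i)"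
    using i gg \<open>C > 0\<close> \<open>A > 0\<close> by (simp add: ennreal_mult[symmetric] ennreal_power)
  hence "i \<le> 2 * C * sqrt A * gg"
    using i gg \<open>C > 0\<close> \<open>A > 0\<close> by (cases "i = 0") (auto simp: power2_eq_square mult_ac)
  hence "I \<le> ennreal (2 * C * sqrt A) * G"
    using i gg \<open>C > 0\<close> \<open>A > 0\<close> by (simp add: ennreal_mult[symmetric] ennreal_leI)
  thus ?thesis unfolding I_def G_def m_def T_def .
qed

text \<open>
  The improvement \<open>A \<mapsto> 2C (sqrt A)\<close>, iterated from any positive start, converges to its fixed
  point \<open>4C\<^sup>2\<close>. Boundedness of the kernel and finiteness of the measure only provide a start. The final
  constant depends on \<open>C\<close> alone, which makes the lemma usable for kernels that involve an arbitrary
  measurable selection.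
\<close>

lemma TT_star_bound:
  fixes k :: "'a \<Rightarrow> 'a \<Rightarrow> ennreal" and b C :: real
  assumes "finite_measure M"
    and [measurable]: "case_prod k \<in> borel_measurable (M \<Otimes>\<^sub>M M)"
    and bounded: "\<And>x t. x \<in> space M \<Longrightarrow> t \<in> space M \<Longrightarrow> k x t \<le> ennreal b"
    and comp: "\<And>x y. x \<in> space M \<Longrightarrow> y \<in> space M \<Longrightarrow>
                 (\<integral>\<^sup>+t. k x t * k y t \<partial>M) \<le> ennreal C * (k x y + k y x)"
    and "C > 0"
    and [measurable]: "g \<in> borel_measurable M"
  shows "(\<integral>\<^sup>+x. (\<integral>\<^sup>+t. k x t * g t \<partial>M)\<^sup>2 \<partial>M) \<le> ennreal (4 * C\<^sup>2) * (\<integral>\<^sup>+t. (g t)\<^sup>2 \<partial>M)"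
proof (cases "(\<integral>\<^sup>+t. (g t)\<^sup>2 \<partial>M) = \<infinity>")
  case True
  thus ?thesis using \<open>C > 0\<close> by (simp add: ennreal_mult_top)
next
  case False
  interpret finite_measure M by fact
  define \<mu> where "\<mu> = measure M (space M)"
  have \<mu>: "emeasure M (space M) = ennreal \<mu>" "\<mu> \<ge> 0"
    unfolding \<mu>_def by (simp_all add: emeasure_eq_measure)
  \<comment> \<open>In the variable \<open>x = A / (4 C\<^sup>2)\<close> one improvement step is \<open>x \<mapsto> sqrt x\<close>.\<close>
  define x0 where "x0 = (b\<^sup>2 * \<mu>\<^sup>2 + 1) / (4 * C\<^sup>2)"
  have "x0 > 0" unfolding x0_def using \<open>C > 0\<close> by (intro divide_pos_pos add_nonneg_pos) auto
  define x where "x j = x0 powr ((1/2) ^ j)" for j :: nat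
  have "x j > 0" for j unfolding x_def using \<open>x0 > 0\<close> by simp
  have sqrt_x: "sqrt (x j) = x (Suc j)" for j
    unfolding x_def using \<open>x0 > 0\<close> by (simp add: powr_half_sqrt[symmetric] powr_powr mult_ac)
  have *: "(\<integral>\<^sup>+x. (\<integral>\<^sup>+t. k x t * g t \<partial>M)\<^sup>2 \<partial>M) \<le> ennreal (4 * C\<^sup>2 * x j) * (\<integral>\<^sup>+t. (g t)\<^sup>2 \<partial>M)"
    if "g \<in> borel_measurable M" for g j
    using that
  proof (induction j arbitrary: g)
    case 0
    note [measurable] = 0
    have "(\<integral>\<^sup>+x. (\<integral>\<^sup>+t. k x t * g t \<partial>M)\<^sup>2 \<partial>M) \<le> (\<integral>\<^sup>+x. ennreal (b\<^sup>2 * \<mu>) * (\<integral>\<^sup>+t. (g t)\<^sup>2 \<partial>M) \<partial>M)"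
    proof (intro nn_integral_mono)
      fix x assume x[measurable]: "x \<in> space M"
      have "(\<integral>\<^sup>+t. k x t * g t \<partial>M)\<^sup>2 \<le> (\<integral>\<^sup>+t. (k x t)\<^sup>2 \<partial>M) * (\<integral>\<^sup>+t. (g t)\<^sup>2 \<partial>M)"
        by (rule Cauchy_Schwarz_nn_integral) measurable
      also have "(\<integral>\<^sup>+t. (k x t)\<^sup>2 \<partial>M) \<le> (\<integral>\<^sup>+t. (ennreal b)\<^sup>2 \<partial>M)"
        using bounded[OF x] by (intro nn_integral_mono power_mono) auto
      also have "\<dots> = (ennreal b)\<^sup>2 * ennreal \<mu>" by (simp add: \<mu>)
      also have "\<dots> \<le> ennreal (b\<^sup>2 * \<mu>)"
        using \<mu> by (cases "b \<ge> 0") (auto simp: ennreal_power ennreal_mult ennreal_neg)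
      finally show "(\<integral>\<^sup>+t. k x t * g t \<partial>M)\<^sup>2 \<le> ennreal (b\<^sup>2 * \<mu>) * (\<integral>\<^sup>+t. (g t)\<^sup>2 \<partial>M)"
        by (simp add: mult_right_mono)
    qed
    also have "\<dots> = ennreal (b\<^sup>2 * \<mu>\<^sup>2) * (\<integral>\<^sup>+t. (g t)\<^sup>2 \<partial>M)"
      using \<mu> by (simp add: power2_eq_square ennreal_mult mult_ac)
    also have "\<dots> \<le> ennreal (4 * C\<^sup>2 * x 0) * (\<integral>\<^sup>+t. (g t)\<^sup>2 \<partial>M)"
      unfolding x_def x0_def using \<open>C > 0\<close>
      by (intro mult_right_mono ennreal_leI) (auto simp: add_nonneg_pos)
    finally show ?case .
  next
    case (Suc j)
    have "2 * C * sqrt (4 * C\<^sup>2 * x j) = 4 * C\<^sup>2 * x (Suc j)"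
      using \<open>C > 0\<close> by (simp add: real_sqrt_mult sqrt_x power2_eq_square)
    moreover have "4 * C\<^sup>2 * x j > 0" using \<open>C > 0\<close> \<open>x j > 0\<close> by simp
    ultimately show ?case
      using TT_star_step[OF assms(1,2) comp \<open>C > 0\<close> _ Suc.IH Suc.prems] by metis
  qed
  obtain G where G: "(\<integral>\<^sup>+t. (g t)\<^sup>2 \<partial>M) = ennreal G" "G \<ge> 0"
    using False by (cases "(\<integral>\<^sup>+t. (g t)\<^sup>2 \<partial>M)") auto
  have "(\<lambda>j. ennreal (4 * C\<^sup>2 * x j * G)) \<longlonglongrightarrow> ennreal (4 * C\<^sup>2 * x0 powr 0 * G)"
    unfolding x_def using \<open>x0 > 0\<close> by (intro tendsto_intros tendsto_ennrealI LIMSEQ_power_zero) auto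
  moreover have "(\<integral>\<^sup>+x. (\<integral>\<^sup>+t. k x t * g t \<partial>M)\<^sup>2 \<partial>M) \<le> ennreal (4 * C\<^sup>2 * x j * G)" for j
    using *[OF assms(6), of j] G \<open>x j > 0\<close> by (simp add: ennreal_mult)
  ultimately have "(\<integral>\<^sup>+x. (\<integral>\<^sup>+t. k x t * g t \<partial>M)\<^sup>2 \<partial>M) \<le> ennreal (4 * C\<^sup>2 * x0 powr 0 * G)"
    by (intro LIMSEQ_le_const) auto
  thus ?thesis using G \<open>x0 > 0\<close> by (simp add: ennreal_mult)
qed

section \<open>Integrals over circles and Parseval's identity\<close>

text \<open>
  Borel sets rather than Lebesgue sets, because iterated integrals need measurability on the
  product; the integrals agree with those over \<open>lebesgue_on {0..2*pi}\<close>.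
\<close>

definition angle_measure :: "real measure" where
  "angle_measure = restrict_space lborel {0..2*pi}"

lemma space_angle_measure [simp]: "space angle_measure = {0..2*pi}"
  by (simp add: angle_measure_def space_restrict_space)

lemma emeasure_angle_measure: "emeasure angle_measure (space angle_measure) = ennreal (2 * pi)"
  by (simp add: angle_measure_def emeasure_restrict_space)

lemma finite_measure_angle_measure: "finite_measure angle_measure"
  by (rule finite_measureI) (subst emeasure_angle_measure, simp)

lemma borel_measurable_angle_measureI:
  fixes g :: "real \<Rightarrow> 'b::topological_space"
  assumes "continuous_on {0..2*pi} g"
  shows "g \<in> borel_measurable angle_measure"
proof -
  have "g \<in> borel_measurable (restrict_space borel {0..2*pi})"
    using assms by (rule borel_measurable_continuous_on_restrict)
  thus ?thesis by (simp add: angle_measure_def measurable_def sets_restrict_space space_restrict_space)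
qed

lemma integral_angle_measure:
  fixes g :: "real \<Rightarrow> 'b::euclidean_space"
  assumes "continuous_on {0..2*pi} g"
  shows "integrable angle_measure g" "integral\<^sup>L angle_measure g = integral {0..2*pi} g"
proof -
  have *: "set_integrable lborel {0..2*pi} g"
    using assms by (rule borel_integrable_atLeastAtMost')
  thus "integrable angle_measure g"
    by (simp add: angle_measure_def integrable_restrict_space set_integrable_def)
  show "integral\<^sup>L angle_measure g = integral {0..2*pi} g"
    using set_borel_integral_eq_integral(2)[OF *]
    by (simp add: angle_measure_def integral_restrict_space set_lebesgue_integral_def)
qed

abbreviation mean_square :: "(complex \<Rightarrow> complex) \<Rightarrow> real \<Rightarrow> ennreal" where
  "mean_square u r \<equiv> (\<integral>\<^sup>+\<theta>. ennreal ((cmod (u (of_real r * cis \<theta>)))\<^sup>2) \<partial>angle_measure)"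

abbreviation mean_power :: "real \<Rightarrow> (complex \<Rightarrow> complex) \<Rightarrow> real \<Rightarrow> ennreal" where
  "mean_power p u r \<equiv> (\<integral>\<^sup>+\<theta>. ennreal (cmod (u (of_real r * cis \<theta>)) powr p) \<partial>angle_measure)"

lemma integral_cis_int:
  fixes k :: int
  shows "integral\<^sup>L angle_measure (\<lambda>\<theta>. cis (of_int k * \<theta>)) = (if k = 0 then 2 * pi else 0)"
proof -
  have cont: "continuous_on {0..2*pi} (\<lambda>\<theta>. cis (of_int k * \<theta>))"
    by (intro continuous_intros)
  show ?thesis
  proof (cases "k = 0")
    case True
    moreover have "integral\<^sup>L angle_measure (\<lambda>\<theta>. 1::complex) = integral {0..2*pi} (\<lambda>\<theta>. 1)"
      by (intro integral_angle_measure(2) continuous_intros)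
    ultimately show ?thesis using True by (simp add: scaleR_conv_of_real)
  next
    case False
    have "((\<lambda>\<theta>. cis (of_int k * \<theta>)) has_integral
            (cis (of_int k * (2 * pi)) / (\<i> * of_int k) - cis (of_int k * 0) / (\<i> * of_int k))) {0..2*pi}"
    proof (rule fundamental_theorem_of_calculus)
      fix x :: real
      have "((\<lambda>\<theta>. cis (of_int k * \<theta>) / (\<i> * of_int k)) has_vector_derivative
              (\<i> * of_int k * cis (of_int k * x)) / (\<i> * of_int k)) (at x within {0..2*pi})"
        unfolding cis_conv_exp
        by (auto intro!: derivative_eq_intros has_vector_derivative_real_field simp: mult_ac)
      thus "((\<lambda>\<theta>. cis (of_int k * \<theta>) / (\<i> * of_int k)) has_vector_derivative
              cis (of_int k * x)) (at x within {0..2*pi})" using False by simp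
    qed simp
    moreover have "cis (of_int k * (2 * pi)) = 1"
      using cis_multiple_2pi[of "of_int k"] by (simp add: mult_ac)
    ultimately show ?thesis using False
      by (simp add: integral_angle_measure(2) cont integral_unique)
  qed
qed

lemma parseval_finite:
  fixes c :: "nat \<Rightarrow> complex"
  shows "(\<integral>\<^sup>+\<theta>. ennreal ((cmod (\<Sum>n<N. c n * cis (real n * \<theta>)))\<^sup>2) \<partial>angle_measure) =
         ennreal (2 * pi * (\<Sum>n<N. (cmod (c n))\<^sup>2))"
proof -
  let ?S = "\<lambda>\<theta>. \<Sum>n<N. c n * cis (real n * \<theta>)"
  have eq: "complex_of_real ((cmod (?S \<theta>))\<^sup>2) =
      (\<Sum>n<N. \<Sum>m<N. (c n * cnj (c m)) * cis (of_int (int n - int m) * \<theta>))" for \<theta>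
    unfolding complex_norm_square cnj_sum sum_product
    by (intro sum.cong refl) (simp add: cis_cnj cis_mult[symmetric] algebra_simps cis_divide[symmetric] divide_inverse)
  have int: "integrable angle_measure (\<lambda>\<theta>. (c n * cnj (c m)) * cis (of_int (int n - int m) * \<theta>))" for n m
    by (intro integral_angle_measure(1) continuous_intros)
  have "complex_of_real (integral\<^sup>L angle_measure (\<lambda>\<theta>. (cmod (?S \<theta>))\<^sup>2)) =
        integral\<^sup>L angle_measure (\<lambda>\<theta>. complex_of_real ((cmod (?S \<theta>))\<^sup>2))"
    by (rule integral_complex_of_real[symmetric])
  also have "\<dots> = (\<Sum>n<N. \<Sum>m<N. (c n * cnj (c m)) * (if int n - int m = 0 then 2 * pi else 0))"
    unfolding eq using int
    by (simp add: integral_sum' integral_cis_int Bochner_Integration.integral_mult_right_zero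
             del: of_int_diff)
  also have "\<dots> = (\<Sum>n<N. \<Sum>m<N. (if m = n then (c n * cnj (c n)) * (2 * pi) else 0))"
    by (intro sum.cong refl) auto
  also have "\<dots> = complex_of_real (2 * pi * (\<Sum>n<N. (cmod (c n))\<^sup>2))"
    by (simp add: complex_norm_square sum_distrib_left mult_ac del: of_real_power)
  finally have "integral\<^sup>L angle_measure (\<lambda>\<theta>. (cmod (?S \<theta>))\<^sup>2) = 2 * pi * (\<Sum>n<N. (cmod (c n))\<^sup>2)"
    by (simp only: of_real_eq_iff)
  moreover have "integrable angle_measure (\<lambda>\<theta>. (cmod (?S \<theta>))\<^sup>2)"
    by (intro integral_angle_measure(1) continuous_intros)
  ultimately show ?thesis by (subst nn_integral_eq_integral) auto
qed

text \<open>
  The partial sums, rather than their sum, are kept in the statement because the later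
  comparisons of two power series are termwise.
\<close>

lemma parseval:
  fixes c :: "nat \<Rightarrow> complex"
  assumes summ: "summable (\<lambda>n. cmod (c n))"
  shows "(\<lambda>N. ennreal (2 * pi * (\<Sum>n<N. (cmod (c n))\<^sup>2))) \<longlonglongrightarrow>
         (\<integral>\<^sup>+\<theta>. ennreal ((cmod (\<Sum>n. c n * cis (real n * \<theta>)))\<^sup>2) \<partial>angle_measure)"
proof -
  interpret finite_measure angle_measure by (rule finite_measure_angle_measure)
  let ?S = "\<lambda>N \<theta>. \<Sum>n<N. c n * cis (real n * \<theta>)"
  let ?T = "\<lambda>\<theta>. \<Sum>n. c n * cis (real n * \<theta>)"
  have lim: "(\<lambda>N. ?S N \<theta>) \<longlonglongrightarrow> ?T \<theta>" for \<theta>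
    using summ by (intro summable_LIMSEQ summable_norm_cancel[of "\<lambda>n. c n * cis (real n * \<theta>)"]) (simp add: norm_mult)
  have meas[measurable]: "?S N \<in> borel_measurable angle_measure" for N
    by (intro borel_measurable_angle_measureI continuous_intros)
  have [measurable]: "?T \<in> borel_measurable angle_measure"
    by (rule borel_measurable_LIMSEQ_metric[OF meas lim])
  have "(\<lambda>N. (\<integral>\<^sup>+\<theta>. ennreal ((cmod (?S N \<theta>))\<^sup>2) \<partial>angle_measure)) \<longlonglongrightarrow> (\<integral>\<^sup>+\<theta>. ennreal ((cmod (?T \<theta>))\<^sup>2) \<partial>angle_measure)"
  proof (rule nn_integral_dominated_convergence[where w = "\<lambda>_. ennreal ((\<Sum>n. cmod (c n))\<^sup>2)"])
    show "AE \<theta> in angle_measure. ennreal ((cmod (?S N \<theta>))\<^sup>2) \<le> ennreal ((\<Sum>n. cmod (c n))\<^sup>2)" for N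
    proof (intro AE_I2 ennreal_leI power_mono)
      fix \<theta>
      have "cmod (?S N \<theta>) \<le> (\<Sum>n<N. cmod (c n))"
        by (rule order_trans[OF norm_sum]) (simp add: norm_mult)
      also have "\<dots> \<le> (\<Sum>n. cmod (c n))" by (rule sum_le_suminf[OF summ]) auto
      finally show "cmod (?S N \<theta>) \<le> (\<Sum>n. cmod (c n))" .
    qed auto
    show "(\<integral>\<^sup>+x. ennreal ((\<Sum>n. cmod (c n))\<^sup>2) \<partial>angle_measure) < \<infinity>"
      by (subst nn_integral_const, subst emeasure_angle_measure) (simp add: ennreal_mult_less_top)
    show "AE \<theta> in angle_measure. (\<lambda>N. ennreal ((cmod (?S N \<theta>))\<^sup>2)) \<longlonglongrightarrow> ennreal ((cmod (?T \<theta>))\<^sup>2)"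
      by (intro AE_I2 tendsto_ennrealI tendsto_intros lim)
  qed measurable
  thus ?thesis unfolding parseval_finite .
qed

section \<open>The Poisson kernel\<close>

text \<open>
  Normalised so that it has integral \<open>1\<close> in \<open>t\<close>.
\<close>

definition poisson :: "complex \<Rightarrow> real \<Rightarrow> real" where
  "poisson z t = (1 - (cmod z)\<^sup>2) / (2 * pi * (cmod (cis t - z))\<^sup>2)"

lemma cis_minus_nonzero: "cmod z < 1 \<Longrightarrow> cis t - z \<noteq> 0"
  by (metis norm_cis less_irrefl right_minus_eq)

lemma poisson_nonneg: "cmod z < 1 \<Longrightarrow> poisson z t \<ge> 0"
  unfolding poisson_def by (simp add: power_le_one)

lemma continuous_on_poisson:
  assumes "cmod z < 1"
  shows "continuous_on A (poisson z)"
  unfolding poisson_def[abs_def] using cis_minus_nonzero[OF assms]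
  by (intro continuous_intros) auto

text \<open>
  Cauchy's formula at \<open>z\<close> for \<open>\<zeta> \<mapsto> u \<zeta> * (1 - cnj z * z) / (1 - cnj z * \<zeta>)\<close>, which agrees
  with \<open>u\<close> at \<open>\<zeta> = z\<close>. On the unit circle \<open>1 - cnj z * \<zeta> = \<zeta> * cnj (\<zeta> - z)\<close>, and the Cauchy kernel
  becomes the Poisson kernel.
\<close>

lemma poisson_formula:
  fixes u :: "complex \<Rightarrow> complex"
  assumes cont: "continuous_on (cball 0 1) u" and hol: "u holomorphic_on ball 0 1" and z: "cmod z < 1"
  shows "((\<lambda>t. of_real (poisson z t) * u (cis t)) has_integral u z) {0..2*pi}"
proof -
  define U where "U \<zeta> = u \<zeta> * (1 - cnj z * z) / (1 - cnj z * \<zeta>)" for \<zeta>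
  have nz: "1 - cnj z * \<zeta> \<noteq> 0" if "cmod \<zeta> \<le> 1" for \<zeta>
  proof
    assume "1 - cnj z * \<zeta> = 0"
    hence "cmod z * cmod \<zeta> = 1" by (metis complex_mod_cnj norm_mult norm_one right_minus_eq)
    moreover have "cmod z * cmod \<zeta> \<le> cmod z * 1" using that by (intro mult_left_mono) auto
    ultimately show False using z by simp
  qed
  have "continuous_on (cball 0 1) U" unfolding U_def
    by (intro continuous_intros cont ballI nz) auto
  moreover have "U holomorphic_on ball 0 1" unfolding U_def
    by (intro holomorphic_intros hol nz) auto
  ultimately have "((\<lambda>\<zeta>. U \<zeta> / (\<zeta> - z)) has_contour_integral (2 * of_real pi * \<i> * U z)) (circlepath 0 1)"
    using z by (intro Cauchy_integral_circlepath) auto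
  hence "((\<lambda>t. U (cis t) / (cis t - z) * \<i> * cis t) has_integral (2 * of_real pi * \<i> * U z)) {0..2*pi}"
    unfolding circlepath_def by (subst (asm) has_contour_integral_part_circlepath_iff) auto
  hence "((\<lambda>t. (1 / (2 * of_real pi * \<i>)) * (U (cis t) / (cis t - z) * \<i> * cis t)) has_integral
          (1 / (2 * of_real pi * \<i>)) * (2 * of_real pi * \<i> * U z)) {0..2*pi}"
    by (rule has_integral_mult_right)
  moreover have "(1 / (2 * of_real pi * \<i>)) * (2 * of_real pi * \<i> * U z) = u z"
    unfolding U_def using nz[of z] z by simp
  moreover have "(1 / (2 * of_real pi * \<i>)) * (U (cis t) / (cis t - z) * \<i> * cis t) =
                 of_real (poisson z t) * u (cis t)" for t
  proof -
    have "1 - cnj z * cis t = cis t * cnj (cis t - z)"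
      by (simp add: algebra_simps cis_cnj cis_mult)
    hence *: "U (cis t) = u (cis t) * (1 - cnj z * z) / (cis t * cnj (cis t - z))"
      unfolding U_def by simp
    have "complex_of_real ((cmod z)\<^sup>2) = cnj z * z" "complex_of_real ((cmod (cis t - z))\<^sup>2) = (cis t - z) * cnj (cis t - z)"
      by (simp_all add: complex_norm_square mult_ac del: of_real_power)
    moreover have "of_real (poisson z t) = (1 - complex_of_real ((cmod z)\<^sup>2)) / (2 * of_real pi * complex_of_real ((cmod (cis t - z))\<^sup>2))"
      unfolding poisson_def by simp
    ultimately show ?thesis using cis_minus_nonzero[OF z, of t] * by (simp add: mult_ac)
  qed
  ultimately show ?thesis by simp
qed

lemma nn_integral_poisson:
  assumes "cmod z < 1"
  shows "(\<integral>\<^sup>+t. ennreal (poisson z t) \<partial>angle_measure) = 1"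
proof -
  have "((\<lambda>t. of_real (poisson z t) * (1::complex)) has_integral 1) {0..2*pi}"
    using poisson_formula[of "\<lambda>_. 1" z] assms by simp
  hence "integral\<^sup>L angle_measure (\<lambda>t. complex_of_real (poisson z t)) = 1"
    by (subst integral_angle_measure(2)) (auto intro!: continuous_intros continuous_on_poisson assms simp: integral_unique)
  hence "integral\<^sup>L angle_measure (poisson z) = 1"
    by (simp add: integral_complex_of_real)
  thus ?thesis using integral_angle_measure(1)[OF continuous_on_poisson[OF assms]] poisson_nonneg[OF assms]
    by (subst nn_integral_eq_integral) auto
qed

lemma poisson_bound:
  fixes u :: "complex \<Rightarrow> complex"
  assumes cont: "continuous_on (cball 0 1) u" and hol: "u holomorphic_on ball 0 1" and z: "cmod z < 1"
  shows "ennreal (cmod (u z)) \<le> (\<integral>\<^sup>+t. ennreal (poisson z t) * ennreal (cmod (u (cis t))) \<partial>angle_measure)"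
proof -
  have c: "continuous_on {0..2*pi} (\<lambda>t. of_real (poisson z t) * u (cis t))"
    by (intro continuous_intros continuous_on_poisson[OF z] continuous_on_compose2[OF cont]) auto
  have "u z = integral\<^sup>L angle_measure (\<lambda>t. of_real (poisson z t) * u (cis t))"
    using poisson_formula[OF assms] by (simp add: integral_angle_measure(2)[OF c] integral_unique)
  hence "ennreal (cmod (u z)) \<le> (\<integral>\<^sup>+t. ennreal (cmod (of_real (poisson z t) * u (cis t))) \<partial>angle_measure)"
    using integral_norm_bound_ennreal[OF integral_angle_measure(1)[OF c]] by simp
  also have "\<dots> = (\<integral>\<^sup>+t. ennreal (poisson z t) * ennreal (cmod (u (cis t))) \<partial>angle_measure)"
    using poisson_nonneg[OF z] by (intro nn_integral_cong) (simp add: norm_mult ennreal_mult)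
  finally show ?thesis .
qed

text \<open>
  Poisson kernels at two points compare as soon as the heights of the points above the circle
  and their distances to the boundary points do.
\<close>

lemma poisson_le:
  assumes z: "cmod z < 1" and w: "cmod w < 1" and K: "K \<ge> 0"
    and height: "1 - (cmod z)\<^sup>2 \<le> K * (1 - (cmod w)\<^sup>2)"
    and distance: "cmod (cis s - w) \<le> L * cmod (cis t - z)"
  shows "poisson z t \<le> K * L\<^sup>2 * poisson w s"
proof -
  have pos: "cmod (cis t - z) > 0" "cmod (cis s - w) > 0"
    using cis_minus_nonzero z w by auto
  have "(cmod (cis s - w))\<^sup>2 \<le> (L * cmod (cis t - z))\<^sup>2"
    using distance pos by (intro power_mono) auto
  moreover have "0 \<le> 1 - (cmod z)\<^sup>2" "0 \<le> 1 - (cmod w)\<^sup>2"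
    using z w by (auto simp: power_le_one)
  ultimately have "(1 - (cmod z)\<^sup>2) * (cmod (cis s - w))\<^sup>2 \<le>
                   (K * (1 - (cmod w)\<^sup>2)) * (L * cmod (cis t - z))\<^sup>2"
    using height K by (intro mult_mono) auto
  thus ?thesis
    using pos unfolding poisson_def power_mult_distrib by (simp add: divide_simps) (simp add: mult_ac)
qed

section \<open>The Poisson maximal inequality\<close>

definition dyadic_radius :: "nat \<Rightarrow> real" where
  "dyadic_radius i = 1 - (1/2) ^ i"

lemma dyadic_radius_bounds: "0 \<le> dyadic_radius i" "dyadic_radius i < 1" "i > 0 \<Longrightarrow> 0 < dyadic_radius i"
  by (simp_all add: dyadic_radius_def power_le_one power_less_one_iff)

lemma dyadic_radius_mono: "i \<le> j \<Longrightarrow> dyadic_radius i \<le> dyadic_radius j"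
  by (simp add: dyadic_radius_def power_decreasing)

lemma dyadic_radius_tendsto: "dyadic_radius \<longlonglongrightarrow> 1"
proof -
  have "(\<lambda>i. 1 - (1/2::real) ^ i) \<longlonglongrightarrow> 1 - 0"
    by (intro tendsto_intros LIMSEQ_power_zero) auto
  thus ?thesis by (simp add: dyadic_radius_def[abs_def])
qed

definition radial_point :: "nat \<Rightarrow> real \<Rightarrow> complex" where
  "radial_point i \<theta> = of_real (dyadic_radius i) * cis \<theta>"

lemma norm_radial_point [simp]: "cmod (radial_point i \<theta>) = dyadic_radius i"
  using dyadic_radius_bounds[of i] by (simp add: radial_point_def norm_mult)

text \<open>
  By the triangle inequality, \<open>cis t\<close> has at least half the distance of \<open>cis \<theta>\<close> and \<open>cis \<phi>\<close>
  from one of these two points. If from \<open>cis \<theta>\<close>, then moving the argument from \<open>t\<close> to \<open>\<phi>\<close> decreases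
  the first kernel by a factor of at most \<open>25\<close>; otherwise the same holds for the second kernel.
\<close>

lemma poisson_compose_pointwise:
  "poisson (radial_point i \<theta>) t * poisson (radial_point j \<phi>) t \<le>
     25 * poisson (radial_point i \<theta>) \<phi> * poisson (radial_point j \<phi>) t +
     25 * poisson (radial_point j \<phi>) \<theta> * poisson (radial_point i \<theta>) t"
proof -
  have near: "cmod (radial_point i \<theta> - cis \<theta>) = 1 - dyadic_radius i" for i \<theta>
  proof -
    have "radial_point i \<theta> - cis \<theta> = of_real (dyadic_radius i - 1) * cis \<theta>"
      by (simp add: radial_point_def algebra_simps)
    thus ?thesis using dyadic_radius_bounds[of i] by (simp add: norm_mult flip: of_real_diff)
  qed
  have far: "1 - dyadic_radius i \<le> cmod (cis t - radial_point i \<theta>)" for i t \<theta>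
    using norm_triangle_ineq2[of "cis t" "radial_point i \<theta>"] by simp
  have *: "poisson (radial_point i \<theta>) t \<le> 25 * poisson (radial_point i \<theta>) \<phi>"
    if "cmod (cis \<theta> - cis \<phi>) \<le> 2 * cmod (cis t - cis \<theta>)" for i \<theta> \<phi>
  proof -
    have "cmod (cis t - cis \<theta>) \<le> cmod (cis t - radial_point i \<theta>) + cmod (radial_point i \<theta> - cis \<theta>)"
      using norm_triangle_ineq[of "cis t - radial_point i \<theta>" "radial_point i \<theta> - cis \<theta>"] by simp
    moreover have "cmod (cis \<phi> - radial_point i \<theta>) \<le> cmod (cis \<theta> - cis \<phi>) + cmod (radial_point i \<theta> - cis \<theta>)"
      using norm_triangle_ineq[of "cis \<phi> - cis \<theta>" "cis \<theta> - radial_point i \<theta>"]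
      by (simp add: norm_minus_commute)
    ultimately have "cmod (cis \<phi> - radial_point i \<theta>) \<le> 5 * cmod (cis t - radial_point i \<theta>)"
      using that near[of i \<theta>] far[of i t \<theta>] by simp
    from poisson_le[where K = 1, OF _ _ _ _ this] dyadic_radius_bounds[of i] show ?thesis by simp
  qed
  have "cmod (cis \<theta> - cis \<phi>) \<le> cmod (cis t - cis \<theta>) + cmod (cis t - cis \<phi>)"
    using norm_triangle_ineq[of "cis \<theta> - cis t" "cis t - cis \<phi>"] by (simp add: norm_minus_commute)
  then consider "cmod (cis \<theta> - cis \<phi>) \<le> 2 * cmod (cis t - cis \<theta>)"
    | "cmod (cis \<phi> - cis \<theta>) \<le> 2 * cmod (cis t - cis \<phi>)"
    by (auto simp: norm_minus_commute) linarith
  moreover note nonneg = poisson_nonneg[of "radial_point i \<theta>"] poisson_nonneg[of "radial_point j \<phi>"]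
  ultimately show ?thesis
  proof cases
    case 1
    have "poisson (radial_point i \<theta>) t * poisson (radial_point j \<phi>) t \<le>
          25 * poisson (radial_point i \<theta>) \<phi> * poisson (radial_point j \<phi>) t"
      using *[OF 1] nonneg dyadic_radius_bounds by (intro mult_right_mono) auto
    thus ?thesis using nonneg dyadic_radius_bounds by (simp add: add_increasing2)
  next
    case 2
    have "poisson (radial_point i \<theta>) t * poisson (radial_point j \<phi>) t \<le>
          poisson (radial_point i \<theta>) t * (25 * poisson (radial_point j \<phi>) \<theta>)"
      using *[OF 2] nonneg dyadic_radius_bounds by (intro mult_left_mono) auto
    thus ?thesis using nonneg dyadic_radius_bounds by (simp add: add_increasing mult_ac)
  qed
qed

text \<open>
  The kernel condition of \<open>TT_star_bound\<close>, uniformly in both radii.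
\<close>

lemma poisson_compose:
  "(\<integral>\<^sup>+t. ennreal (poisson (radial_point i \<theta>) t) * ennreal (poisson (radial_point j \<phi>) t) \<partial>angle_measure) \<le>
     ennreal 25 * (ennreal (poisson (radial_point i \<theta>) \<phi>) + ennreal (poisson (radial_point j \<phi>) \<theta>))"
proof -
  have lt: "cmod (radial_point i \<theta>) < 1" "cmod (radial_point j \<phi>) < 1"
    using dyadic_radius_bounds by auto
  note nonneg = poisson_nonneg[OF lt(1)] poisson_nonneg[OF lt(2)]
  have [measurable]: "poisson (radial_point i \<theta>) \<in> borel_measurable angle_measure"
    "poisson (radial_point j \<phi>) \<in> borel_measurable angle_measure"
    by (intro borel_measurable_angle_measureI continuous_on_poisson lt)+
  have "(\<integral>\<^sup>+t. ennreal (poisson (radial_point i \<theta>) t) * ennreal (poisson (radial_point j \<phi>) t) \<partial>angle_measure) \<le>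
     (\<integral>\<^sup>+t. ennreal (25 * poisson (radial_point i \<theta>) \<phi>) * ennreal (poisson (radial_point j \<phi>) t) +
       ennreal (25 * poisson (radial_point j \<phi>) \<theta>) * ennreal (poisson (radial_point i \<theta>) t) \<partial>angle_measure)"
  proof (intro nn_integral_mono)
    fix t
    show "ennreal (poisson (radial_point i \<theta>) t) * ennreal (poisson (radial_point j \<phi>) t) \<le>
       ennreal (25 * poisson (radial_point i \<theta>) \<phi>) * ennreal (poisson (radial_point j \<phi>) t) +
       ennreal (25 * poisson (radial_point j \<phi>) \<theta>) * ennreal (poisson (radial_point i \<theta>) t)"
      using nonneg[of t] nonneg(1)[of \<phi>] nonneg(2)[of \<theta>]
      by (subst (1 2 3) ennreal_mult[symmetric], simp_all)
         (subst ennreal_plus[symmetric], simp_all add: poisson_compose_pointwise ennreal_leI del: ennreal_plus)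
  qed
  also have "\<dots> = ennreal (25 * poisson (radial_point i \<theta>) \<phi>) + ennreal (25 * poisson (radial_point j \<phi>) \<theta>)"
    by (simp add: nn_integral_add nn_integral_cmult nn_integral_poisson[OF lt(1)] nn_integral_poisson[OF lt(2)])
  finally show ?thesis using nonneg by (simp add: ennreal_mult distrib_left)
qed

definition poisson_average :: "(real \<Rightarrow> ennreal) \<Rightarrow> nat \<Rightarrow> real \<Rightarrow> ennreal" where
  "poisson_average g i \<theta> = (\<integral>\<^sup>+t. ennreal (poisson (radial_point i \<theta>) t) * g t \<partial>angle_measure)"

lemma measurable_cis [measurable]: "cis \<in> borel_measurable borel"
  by (intro borel_measurable_continuous_onI continuous_intros)

lemma measurable_ident_angle_measure [measurable]: "(\<lambda>x. x) \<in> borel_measurable angle_measure"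
  by (intro borel_measurable_angle_measureI continuous_intros)

lemma measurable_poisson_kernel [measurable]:
  "(\<lambda>(\<theta>, t). ennreal (poisson (radial_point i \<theta>) t)) \<in> borel_measurable (angle_measure \<Otimes>\<^sub>M angle_measure)"
proof -
  have [measurable]: "fst \<in> borel_measurable (angle_measure \<Otimes>\<^sub>M angle_measure)" "snd \<in> borel_measurable (angle_measure \<Otimes>\<^sub>M angle_measure)"
    using measurable_compose[OF measurable_fst measurable_ident_angle_measure]
      measurable_compose[OF measurable_snd measurable_ident_angle_measure] by auto
  show ?thesis unfolding poisson_def radial_point_def case_prod_beta by measurable
qed

lemma measurable_poisson_average [measurable]:
  assumes [measurable]: "g \<in> borel_measurable angle_measure"
  shows "poisson_average g i \<in> borel_measurable angle_measure"
proof -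
  interpret finite_measure angle_measure by (rule finite_measure_angle_measure)
  show ?thesis unfolding poisson_average_def[abs_def] by measurable
qed

text \<open>
  A measurable choice of the radius that maximises the average among the first \<open>K + 1\<close> dyadic
  radii. It turns the maximal function into a single linear operator.
\<close>

primrec best_index :: "(real \<Rightarrow> ennreal) \<Rightarrow> nat \<Rightarrow> real \<Rightarrow> nat" where
  "best_index g 0 \<theta> = 0"
| "best_index g (Suc K) \<theta> =
     (if poisson_average g (best_index g K \<theta>) \<theta> < poisson_average g (Suc K) \<theta>
      then Suc K else best_index g K \<theta>)"

lemma best_index_le: "best_index g K \<theta> \<le> K"
  by (induction K) auto

lemma poisson_average_best_index:
  "i \<le> K \<Longrightarrow> poisson_average g i \<theta> \<le> poisson_average g (best_index g K \<theta>) \<theta>"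
proof (induction K)
  case (Suc K)
  thus ?case by (cases "i = Suc K") (auto simp: not_less le_Suc_eq less_imp_le intro: order_trans)
qed simp

lemma measurable_best_index [measurable]:
  assumes [measurable]: "g \<in> borel_measurable angle_measure"
  shows "best_index g K \<in> measurable angle_measure (count_space UNIV)"
proof (induction K)
  case 0
  show ?case by (simp add: best_index.simps(1)[abs_def])
next
  case (Suc K)
  note [measurable] = Suc
  have [measurable]: "(\<lambda>\<theta>. poisson_average g (best_index g K \<theta>) \<theta>) \<in> borel_measurable angle_measure"
    by (rule measurable_compose_countable[where g = "best_index g K"]) measurable
  show ?case unfolding best_index.simps(2)[abs_def] by measurable
qed

text \<open>
  For finitely many radii, \<open>best_index\<close> reduces the claim to \<open>TT_star_bound\<close> with \<open>C = 25\<close>, and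
  \<open>4 * 25\<^sup>2 = 2500\<close>; the number of radii does not enter, so monotone convergence finishes the proof.
  The function \<open>V\<close> is the square of the maximal function.
\<close>

lemma poisson_maximal_inequality:
  assumes [measurable]: "g \<in> borel_measurable angle_measure"
  obtains V where "V \<in> borel_measurable angle_measure"
    "(\<integral>\<^sup>+\<theta>. V \<theta> \<partial>angle_measure) \<le> 2500 * (\<integral>\<^sup>+t. (g t)\<^sup>2 \<partial>angle_measure)"
    "\<And>i \<theta>. (poisson_average g i \<theta>)\<^sup>2 \<le> V \<theta>"
proof
  define m where "m K \<theta> = poisson_average g (best_index g K \<theta>) \<theta>" for K \<theta>
  have [measurable]: "m K \<in> borel_measurable angle_measure" for K
    unfolding m_def[abs_def] by (rule measurable_compose_countable[where g = "best_index g K"]) measurable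
  define V where "V \<theta> = (SUP K. (m K \<theta>)\<^sup>2)" for \<theta>
  show "V \<in> borel_measurable angle_measure" unfolding V_def[abs_def] by measurable
  have m_mono: "m K \<theta> \<le> m L \<theta>" if "K \<le> L" for K L \<theta>
    unfolding m_def using best_index_le[of g K \<theta>] that by (intro poisson_average_best_index) auto
  have bound: "(\<integral>\<^sup>+\<theta>. (m K \<theta>)\<^sup>2 \<partial>angle_measure) \<le> 2500 * (\<integral>\<^sup>+t. (g t)\<^sup>2 \<partial>angle_measure)" for K
  proof -
    \<comment> \<open>The kernel of the linearised maximal operator; it is bounded because only radii up to the \<open>K\<close>-th occur.\<close>
    define k where "k \<theta> t = ennreal (poisson (radial_point (best_index g K \<theta>) \<theta>) t)" for \<theta> t
    have k_meas: "case_prod k \<in> borel_measurable (angle_measure \<Otimes>\<^sub>M angle_measure)"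
    proof -
      have "(\<lambda>x. ennreal (poisson (radial_point (best_index g K (fst x)) (fst x)) (snd x)))
              \<in> borel_measurable (angle_measure \<Otimes>\<^sub>M angle_measure)"
      proof (rule measurable_compose_countable[where g = "\<lambda>x. best_index g K (fst x)"])
        show "(\<lambda>x. ennreal (poisson (radial_point i (fst x)) (snd x))) \<in> borel_measurable (angle_measure \<Otimes>\<^sub>M angle_measure)" for i
          using measurable_poisson_kernel[of i] by (simp add: case_prod_beta')
      qed measurable
      thus ?thesis by (simp add: k_def case_prod_beta')
    qed
    have "(\<integral>\<^sup>+\<theta>. (\<integral>\<^sup>+t. k \<theta> t * g t \<partial>angle_measure)\<^sup>2 \<partial>angle_measure) \<le> ennreal (4 * 25\<^sup>2) * (\<integral>\<^sup>+t. (g t)\<^sup>2 \<partial>angle_measure)"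
    proof (rule TT_star_bound[OF finite_measure_angle_measure k_meas])
      show "k \<theta> t \<le> ennreal (1 / (2 * pi * (1 - dyadic_radius K)\<^sup>2))" for \<theta> t
        unfolding k_def poisson_def
      proof (intro ennreal_leI frac_le)
        let ?z = "radial_point (best_index g K \<theta>) \<theta>"
        have "1 - dyadic_radius K \<le> cmod (cis t - ?z)"
          using norm_triangle_ineq2[of "cis t" ?z] dyadic_radius_mono[OF best_index_le[of g K \<theta>]] by simp
        thus "2 * pi * (1 - dyadic_radius K)\<^sup>2 \<le> 2 * pi * (cmod (cis t - ?z))\<^sup>2"
          using dyadic_radius_bounds[of K] by (intro mult_left_mono power_mono) auto
      qed (use dyadic_radius_bounds[of K] in auto)
      show "(\<integral>\<^sup>+t. k x t * k y t \<partial>angle_measure) \<le> ennreal 25 * (k x y + k y x)" for x y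
        unfolding k_def by (rule poisson_compose)
    qed auto
    thus ?thesis by (simp add: k_def m_def poisson_average_def)
  qed
  have "(\<integral>\<^sup>+\<theta>. V \<theta> \<partial>angle_measure) = (SUP K. \<integral>\<^sup>+\<theta>. (m K \<theta>)\<^sup>2 \<partial>angle_measure)"
    unfolding V_def
    by (rule nn_integral_monotone_convergence_SUP) (auto intro!: incseq_SucI le_funI power_mono m_mono)
  also have "\<dots> \<le> 2500 * (\<integral>\<^sup>+t. (g t)\<^sup>2 \<partial>angle_measure)" by (intro SUP_least bound)
  finally show "(\<integral>\<^sup>+\<theta>. V \<theta> \<partial>angle_measure) \<le> 2500 * (\<integral>\<^sup>+t. (g t)\<^sup>2 \<partial>angle_measure)" .
  show "(poisson_average g i \<theta>)\<^sup>2 \<le> V \<theta>" for i \<theta>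
  proof -
    have "(poisson_average g i \<theta>)\<^sup>2 \<le> (m i \<theta>)\<^sup>2"
      unfolding m_def by (intro power_mono poisson_average_best_index) auto
    also have "\<dots> \<le> V \<theta>" unfolding V_def by (intro SUP_upper) auto
    finally show ?thesis .
  qed
qed

section \<open>Maximal functions over Stolz angles\<close>

text \<open>
  In the Stolz angle the distance of \<open>z\<close> to \<open>cis \<theta>\<close> is comparable with \<open>1 - cmod z\<close>, and so \<open>z\<close>
  may be replaced by the radial point at the dyadic height closest above that of \<open>z\<close>.
\<close>

lemma poisson_stolz_le:
  assumes z: "z \<in> stolz \<alpha> (cis \<theta>)"
  obtains i where "\<And>t. poisson z t \<le> 2 * (3 + \<alpha>)\<^sup>2 * poisson (radial_point i \<theta>) t"
proof -
  define \<delta> where "\<delta> = 1 - cmod z"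
  have \<delta>: "0 < \<delta>" "\<delta> \<le> 1" and near: "cmod (z - cis \<theta>) < \<alpha> * \<delta>"
    using z by (auto simp: stolz_def \<delta>_def)
  have "\<exists>i. (1/2) ^ Suc i < \<delta>"
  proof -
    obtain n where "(1/2) ^ n < \<delta>" using real_arch_pow_inv[of \<delta> "1/2"] \<delta> by auto
    moreover have "(1/2::real) ^ Suc n \<le> (1/2) ^ n" by simp
    ultimately show ?thesis by (meson le_less_trans)
  qed
  \<comment> \<open>The index with \<open>(1/2) ^ Suc i < 1 - cmod z \<le> (1/2) ^ i\<close>.\<close>
  define i where "i = (LEAST i. (1/2) ^ Suc i < \<delta>)"
  have i1: "(1/2) ^ Suc i < \<delta>" unfolding i_def using \<open>\<exists>i. (1/2) ^ Suc i < \<delta>\<close> by (rule LeastI_ex)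
  have i2: "\<delta> \<le> (1/2) ^ i"
  proof (cases i)
    case (Suc k)
    have "\<not> (1/2) ^ Suc k < \<delta>" using not_less_Least[of k "\<lambda>i. (1/2) ^ Suc i < \<delta>"] Suc i_def by auto
    thus ?thesis using Suc by simp
  qed (use \<delta> in simp)
  let ?w = "radial_point i \<theta>"
  have ri: "1 - dyadic_radius i = (1/2) ^ i" by (simp add: dyadic_radius_def)
  have "poisson z t \<le> 2 * (3 + \<alpha>)\<^sup>2 * poisson ?w t" for t
  proof (rule poisson_le)
    have "1 - (cmod z)\<^sup>2 = \<delta> * (2 - \<delta>)" by (simp add: \<delta>_def power2_eq_square algebra_simps)
    also have "\<dots> \<le> \<delta> * 2" using \<delta> by (intro mult_left_mono) auto
    also have "\<dots> \<le> 2 * (1 - dyadic_radius i)" using i2 ri by simp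
    also have "(1 - dyadic_radius i) * 1 \<le> (1 - dyadic_radius i) * (1 + dyadic_radius i)"
      using dyadic_radius_bounds[of i] by (intro mult_left_mono) auto
    hence "2 * (1 - dyadic_radius i) \<le> 2 * (1 - (cmod ?w)\<^sup>2)" by (simp add: power2_eq_square algebra_simps)
    finally show "1 - (cmod z)\<^sup>2 \<le> 2 * (1 - (cmod ?w)\<^sup>2)" .
    have "cis \<theta> - ?w = of_real (1 - dyadic_radius i) * cis \<theta>" by (simp add: radial_point_def algebra_simps)
    hence "cmod (cis \<theta> - ?w) = \<bar>1 - dyadic_radius i\<bar>"
      by (simp only: norm_mult norm_of_real norm_cis mult_1_right)
    hence "cmod (cis \<theta> - ?w) = (1/2) ^ i" using ri by simp
    moreover have "cmod (cis t - ?w) \<le> cmod (cis t - z) + cmod (z - cis \<theta>) + cmod (cis \<theta> - ?w)"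
      using norm_triangle_ineq[of "cis t - z" "z - cis \<theta>"]
        norm_triangle_ineq[of "cis t - cis \<theta>" "cis \<theta> - ?w"] by simp
    moreover have "\<delta> \<le> cmod (cis t - z)"
      using norm_triangle_ineq2[of "cis t" z] by (simp add: \<delta>_def)
    moreover have "\<alpha> > 0"
      using near \<delta> by (metis norm_ge_zero le_less_trans zero_less_mult_pos2)
    hence "(2 + \<alpha>) * \<delta> \<le> (2 + \<alpha>) * cmod (cis t - z)"
      using \<open>\<delta> \<le> cmod (cis t - z)\<close> by (intro mult_left_mono) auto
    ultimately show "cmod (cis t - ?w) \<le> (3 + \<alpha>) * cmod (cis t - z)"
      using near i1 by (simp add: algebra_simps)
  qed (use z dyadic_radius_bounds[of i] in \<open>auto simp: stolz_def\<close>)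
  thus thesis by (rule that)
qed

text \<open>
  The square of the factor in \<open>poisson_stolz_le\<close>.
\<close>

definition stolz_const :: "real \<Rightarrow> real" where
  "stolz_const \<alpha> = (2 * (3 + \<alpha>)\<^sup>2)\<^sup>2"

text \<open>
  At this stage \<open>u\<close> is not known to have boundary values. The maximal inequality is therefore
  applied to dilates of \<open>u\<close>, and Fatou's lemma is used when the dilation factor tends to \<open>1\<close>.
\<close>

lemma H2_maximal:
  fixes u :: "complex \<Rightarrow> complex"
  assumes hol: "u holomorphic_on ball 0 1"
    and bound: "\<And>r. 0 < r \<Longrightarrow> r < 1 \<Longrightarrow>
                  mean_square u r \<le> B"
  obtains V where "V \<in> borel_measurable angle_measure" "(\<integral>\<^sup>+\<theta>. V \<theta> \<partial>angle_measure) \<le> 2500 * B"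
    "\<And>\<alpha> \<theta> z. \<alpha> > 1 \<Longrightarrow> z \<in> stolz \<alpha> (cis \<theta>) \<Longrightarrow>
       ennreal ((cmod (u z))\<^sup>2 / stolz_const \<alpha>) \<le> V \<theta>"
proof -
  define \<rho> where "\<rho> j = dyadic_radius (Suc j)" for j
  have \<rho>: "0 < \<rho> j" "\<rho> j < 1" for j using dyadic_radius_bounds by (auto simp: \<rho>_def)
  have \<rho>_lim: "\<rho> \<longlonglongrightarrow> 1" unfolding \<rho>_def[abs_def] by (rule LIMSEQ_Suc[OF dyadic_radius_tendsto])
  have small: "of_real (\<rho> j) * z \<in> ball 0 1" if "cmod z \<le> 1" for j z
  proof -
    have "\<rho> j * cmod z \<le> \<rho> j * 1" using that \<rho>[of j] by (intro mult_left_mono) auto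
    also have "\<dots> < 1" using \<rho>[of j] by simp
    finally show ?thesis using \<rho>[of j] by (simp add: norm_mult)
  qed
  define v where "v j z = u (of_real (\<rho> j) * z)" for j z
  have contu: "continuous_on (ball 0 1) u" using hol by (rule holomorphic_on_imp_continuous_on)
  have v_cont: "continuous_on (cball 0 1) (v j)" for j
    unfolding v_def[abs_def] using small by (intro continuous_on_compose2[OF contu] continuous_intros) auto
  have v_hol: "v j holomorphic_on ball 0 1" for j
    unfolding v_def[abs_def]
    using holomorphic_on_compose_gen[of "\<lambda>z. of_real (\<rho> j) * z" "ball 0 1" u "ball 0 1"] hol small
    by (auto simp: o_def image_subset_iff intro!: holomorphic_intros)
  define g where "g j t = ennreal (cmod (v j (cis t)))" for j t
  have g_meas: "g j \<in> borel_measurable angle_measure" for j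
  proof -
    have "(\<lambda>t. v j (cis t)) \<in> borel_measurable angle_measure"
      by (intro borel_measurable_angle_measureI continuous_on_compose2[OF v_cont] continuous_intros) auto
    thus ?thesis unfolding g_def[abs_def] by measurable
  qed
  have "\<exists>V. V \<in> borel_measurable angle_measure \<and> (\<integral>\<^sup>+\<theta>. V \<theta> \<partial>angle_measure) \<le> 2500 * (\<integral>\<^sup>+t. (g j t)\<^sup>2 \<partial>angle_measure) \<and>
            (\<forall>i \<theta>. (poisson_average (g j) i \<theta>)\<^sup>2 \<le> V \<theta>)" for j
    by (rule poisson_maximal_inequality[OF g_meas[of j]]) blast
  then obtain W where W [measurable]: "\<And>j. W j \<in> borel_measurable angle_measure"
    and W_int: "\<And>j. (\<integral>\<^sup>+\<theta>. W j \<theta> \<partial>angle_measure) \<le> 2500 * (\<integral>\<^sup>+t. (g j t)\<^sup>2 \<partial>angle_measure)"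
    and W_max: "\<And>j i \<theta>. (poisson_average (g j) i \<theta>)\<^sup>2 \<le> W j \<theta>"
    by metis
  have "(\<integral>\<^sup>+t. (g j t)\<^sup>2 \<partial>angle_measure) \<le> B" for j
    using bound[OF \<rho>[of j]] by (simp add: g_def v_def ennreal_power)
  hence W_B: "(\<integral>\<^sup>+\<theta>. W j \<theta> \<partial>angle_measure) \<le> 2500 * B" for j
    by (rule order_trans[OF W_int mult_left_mono]) simp
  define V where "V \<theta> = liminf (\<lambda>j. W j \<theta>)" for \<theta>
  show thesis
  proof
    show "V \<in> borel_measurable angle_measure" unfolding V_def[abs_def] by measurable
    have "(\<integral>\<^sup>+\<theta>. V \<theta> \<partial>angle_measure) \<le> liminf (\<lambda>j. \<integral>\<^sup>+\<theta>. W j \<theta> \<partial>angle_measure)"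
      unfolding V_def by (rule nn_integral_liminf) measurable
    also have "\<dots> \<le> liminf (\<lambda>j::nat. 2500 * B)" by (intro Liminf_mono always_eventually allI W_B)
    finally show "(\<integral>\<^sup>+\<theta>. V \<theta> \<partial>angle_measure) \<le> 2500 * B" by (simp add: Liminf_const)
  next
    fix \<alpha> \<theta> :: real and z :: complex
    assume "\<alpha> > 1" and z: "z \<in> stolz \<alpha> (cis \<theta>)"
    from z have z1: "cmod z < 1" by (simp add: stolz_def)
    have pos: "stolz_const \<alpha> > 0" using \<open>\<alpha> > 1\<close> by (simp add: stolz_const_def)
    obtain i where i: "\<And>t. poisson z t \<le> 2 * (3 + \<alpha>)\<^sup>2 * poisson (radial_point i \<theta>) t"
      using poisson_stolz_le[OF z] by blast
    have le: "ennreal ((cmod (v j z))\<^sup>2 / stolz_const \<alpha>) \<le> W j \<theta>" for j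
    proof -
      have "ennreal (cmod (v j z)) \<le> (\<integral>\<^sup>+t. ennreal (poisson z t) * g j t \<partial>angle_measure)"
        unfolding g_def by (rule poisson_bound[OF v_cont v_hol z1])
      also have "\<dots> \<le> (\<integral>\<^sup>+t. ennreal (2 * (3 + \<alpha>)\<^sup>2) * (ennreal (poisson (radial_point i \<theta>) t) * g j t) \<partial>angle_measure)"
        using i poisson_nonneg[of "radial_point i \<theta>"] dyadic_radius_bounds[of i]
        by (intro nn_integral_mono) (simp add: mult.assoc[symmetric] ennreal_mult[symmetric] mult_right_mono ennreal_leI)
      also have "\<dots> = ennreal (2 * (3 + \<alpha>)\<^sup>2) * poisson_average (g j) i \<theta>"
      proof -
        have [measurable]: "poisson (radial_point i \<theta>) \<in> borel_measurable angle_measure"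
          using dyadic_radius_bounds by (intro borel_measurable_angle_measureI continuous_on_poisson) auto
        show ?thesis unfolding poisson_average_def using g_meas by (intro nn_integral_cmult) measurable
      qed
      finally have "(ennreal (cmod (v j z)))\<^sup>2 \<le> (ennreal (2 * (3 + \<alpha>)\<^sup>2) * poisson_average (g j) i \<theta>)\<^sup>2"
        by (rule power_mono) simp
      also have "\<dots> \<le> ennreal (stolz_const \<alpha>) * W j \<theta>"
        unfolding power_mult_distrib stolz_const_def
        using W_max by (intro mult_mono) (auto simp: ennreal_power)
      finally have *: "ennreal ((cmod (v j z))\<^sup>2) \<le> ennreal (stolz_const \<alpha>) * W j \<theta>"
        by (simp add: ennreal_power)
      have "ennreal ((cmod (v j z))\<^sup>2 / stolz_const \<alpha>) = ennreal (1 / stolz_const \<alpha>) * ennreal ((cmod (v j z))\<^sup>2)"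
        using pos by (simp add: ennreal_mult[symmetric])
      also have "\<dots> \<le> ennreal (1 / stolz_const \<alpha>) * (ennreal (stolz_const \<alpha>) * W j \<theta>)"
        by (intro mult_left_mono *) simp
      also have "\<dots> = W j \<theta>"
        using pos by (simp add: mult.assoc[symmetric] ennreal_mult[symmetric])
      finally show ?thesis .
    qed
    have "(\<lambda>j. v j z) \<longlonglongrightarrow> u (of_real 1 * z)"
      unfolding v_def
    proof (rule continuous_on_tendsto_compose[OF contu])
      show "(\<lambda>j. of_real (\<rho> j) * z) \<longlonglongrightarrow> of_real 1 * z" by (intro tendsto_intros \<rho>_lim)
    qed (use small z1 in \<open>auto\<close>)
    hence "(\<lambda>j. ennreal ((cmod (v j z))\<^sup>2 / stolz_const \<alpha>)) \<longlonglongrightarrow> ennreal ((cmod (u z))\<^sup>2 / stolz_const \<alpha>)"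
      using pos by (intro tendsto_ennrealI tendsto_intros) auto
    hence "ennreal ((cmod (u z))\<^sup>2 / stolz_const \<alpha>) = liminf (\<lambda>j. ennreal ((cmod (v j z))\<^sup>2 / stolz_const \<alpha>))"
      by (metis lim_imp_Liminf sequentially_bot)
    also have "\<dots> \<le> V \<theta>" unfolding V_def by (intro Liminf_mono always_eventually allI le)
    finally show "ennreal ((cmod (u z))\<^sup>2 / stolz_const \<alpha>) \<le> V \<theta>" .
  qed
qed

section \<open>Nontangential limits of square-summable power series\<close>

lemma circle_mean_square_limit:
  fixes a :: "nat \<Rightarrow> complex"
  assumes u: "\<And>z. z \<in> ball 0 R \<Longrightarrow> (\<lambda>n. a n * z ^ n) sums u z"
    and r: "0 < r" "r < R"
  shows "(\<lambda>N. ennreal (2 * pi * (\<Sum>n<N. (cmod (a n) * r ^ n)\<^sup>2))) \<longlonglongrightarrow>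
         mean_square u r"
proof -
  \<comment> \<open>Convergence at a larger radius gives absolute convergence at \<open>r\<close>.\<close>
  define s where "s = (r + R) / 2"
  have s: "r < s" "s < R" using r by (auto simp: s_def)
  have "summable (\<lambda>n. a n * complex_of_real s ^ n)"
    using u[of "of_real s"] s r by (auto simp: sums_iff)
  hence "summable (\<lambda>n. cmod (a n * complex_of_real r ^ n))"
    by (rule powser_insidea) (use s r in auto)
  from parseval[OF this]
  have "(\<lambda>N. ennreal (2 * pi * (\<Sum>n<N. (cmod (a n) * r ^ n)\<^sup>2))) \<longlonglongrightarrow>
    (\<integral>\<^sup>+\<theta>. ennreal ((cmod (\<Sum>n. a n * of_real r ^ n * cis (real n * \<theta>)))\<^sup>2) \<partial>angle_measure)"
    using r by (simp add: norm_mult norm_power)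
  moreover have "(\<Sum>n. a n * of_real r ^ n * cis (real n * \<theta>)) = u (of_real r * cis \<theta>)" for \<theta>
    using u[of "of_real r * cis \<theta>"] r
    by (simp add: sums_iff norm_mult power_mult_distrib mult.assoc Complex.DeMoivre)
  ultimately show ?thesis by simp
qed

lemma holomorphic_sums_powers:
  assumes "u holomorphic_on ball 0 R" "z \<in> ball 0 R"
  shows "(\<lambda>n. (deriv ^^ n) u 0 / fact n * z ^ n) sums u z"
  using holomorphic_power_series[OF assms] by simp

text \<open>
  By Parseval the mean square is a power series in the radius with nonnegative coefficients.
\<close>

lemma circle_mean_square_mono:
  assumes hol: "u holomorphic_on ball 0 R" and r: "0 < r" "r \<le> s" "s < R"
  shows "mean_square u r \<le>
         mean_square u s"
proof (rule LIMSEQ_le)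
  show "(\<lambda>N. ennreal (2 * pi * (\<Sum>n<N. (cmod ((deriv ^^ n) u 0 / fact n) * r ^ n)\<^sup>2))) \<longlonglongrightarrow>
         mean_square u r"
    by (rule circle_mean_square_limit) (use holomorphic_sums_powers[OF hol] r in auto)
  show "(\<lambda>N. ennreal (2 * pi * (\<Sum>n<N. (cmod ((deriv ^^ n) u 0 / fact n) * s ^ n)\<^sup>2))) \<longlonglongrightarrow>
         mean_square u s"
    by (rule circle_mean_square_limit) (use holomorphic_sums_powers[OF hol] r in auto)
  show "\<exists>N. \<forall>n\<ge>N. ennreal (2 * pi * (\<Sum>n<n. (cmod ((deriv ^^ n) u 0 / fact n) * r ^ n)\<^sup>2)) \<le>
                   ennreal (2 * pi * (\<Sum>n<n. (cmod ((deriv ^^ n) u 0 / fact n) * s ^ n)\<^sup>2))"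
    using r by (intro exI[of _ 0] allI impI ennreal_leI mult_left_mono sum_mono power_mono) auto
qed

text \<open>
  Bounded mean squares make the Taylor coefficients square summable, and by Parseval again the
  mean squares of \<open>u - P N\<close> are at most \<open>2\<pi>\<close> times the tail of that series, on every circle.
\<close>

lemma H2_taylor_tails:
  assumes hol: "u holomorphic_on ball 0 1"
    and bound: "\<And>r. 0 < r \<Longrightarrow> r < 1 \<Longrightarrow>
                  mean_square u r \<le> ennreal b"
    and "b \<ge> 0"
  obtains P e where "\<And>N. P N holomorphic_on UNIV" "e \<longlonglongrightarrow> 0"
    "\<And>N r. 0 < r \<Longrightarrow> r < 1 \<Longrightarrow>
       (\<integral>\<^sup>+\<theta>. ennreal ((cmod (u (of_real r * cis \<theta>) - P N (of_real r * cis \<theta>)))\<^sup>2) \<partial>angle_measure) \<le> ennreal (e N)"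
proof
  define a where "a n = (deriv ^^ n) u 0 / fact n" for n
  define P where "P N z = (\<Sum>n<N. a n * z ^ n)" for N z
  have u: "(\<lambda>n. a n * z ^ n) sums u z" if "z \<in> ball 0 1" for z
    unfolding a_def by (rule holomorphic_sums_powers[OF hol that])
  have "2 * pi * (\<Sum>n<N. (cmod (a n) * r ^ n)\<^sup>2) \<le> b" if "0 < r" "r < 1" for N r
  proof -
    have "ennreal (2 * pi * (\<Sum>n<N. (cmod (a n) * r ^ n)\<^sup>2)) \<le>
          mean_square u r"
      by (rule incseq_le[OF _ circle_mean_square_limit[OF u that]])
         (auto intro!: incseq_SucI ennreal_leI mult_left_mono)
    also have "\<dots> \<le> ennreal b" by (rule bound[OF that])
    finally show ?thesis using \<open>b \<ge> 0\<close> by simp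
  qed
  hence partial: "2 * pi * (\<Sum>n<N. (cmod (a n) * dyadic_radius (Suc i) ^ n)\<^sup>2) \<le> b" for N i
    using dyadic_radius_bounds[of "Suc i"] by simp
  have "2 * pi * (\<Sum>n<N. (cmod (a n) * 1 ^ n)\<^sup>2) \<le> b" for N
  proof (rule LIMSEQ_le_const2)
    show "(\<lambda>i. 2 * pi * (\<Sum>n<N. (cmod (a n) * dyadic_radius (Suc i) ^ n)\<^sup>2)) \<longlonglongrightarrow> 2 * pi * (\<Sum>n<N. (cmod (a n) * 1 ^ n)\<^sup>2)"
      by (intro tendsto_intros LIMSEQ_Suc[OF dyadic_radius_tendsto])
  qed (use partial in auto)
  hence sum_le: "(\<Sum>n<N. (cmod (a n))\<^sup>2) \<le> b / (2 * pi)" for N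
    by (simp add: field_simps)
  have summ: "summable (\<lambda>n. (cmod (a n))\<^sup>2)"
  proof (rule bounded_imp_summable)
    show "(\<Sum>k\<le>n. (cmod (a k))\<^sup>2) \<le> b / (2 * pi)" for n
      using sum_le[of "Suc n"] unfolding lessThan_Suc_atMost .
  qed simp
  define e where "e N = 2 * pi * ((\<Sum>n. (cmod (a n))\<^sup>2) - (\<Sum>n<N. (cmod (a n))\<^sup>2))" for N
  have "e \<longlonglongrightarrow> 2 * pi * ((\<Sum>n. (cmod (a n))\<^sup>2) - (\<Sum>n. (cmod (a n))\<^sup>2))"
    unfolding e_def[abs_def] by (intro tendsto_intros summable_LIMSEQ summ)
  thus "e \<longlonglongrightarrow> 0" by simp
  show "P N holomorphic_on UNIV" for N unfolding P_def[abs_def] by (intro holomorphic_intros)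
  fix N and r :: real assume r: "0 < r" "r < 1"
  define c where "c n = (if n < N then 0 else a n)" for n
  have v: "(\<lambda>n. c n * z ^ n) sums (u z - P N z)" if "z \<in> ball 0 1" for z
  proof -
    have "(\<lambda>n. if n \<in> {..<N} then a n * z ^ n else 0) sums (\<Sum>n<N. a n * z ^ n)"
      by (rule sums_If_finite_set) simp
    from sums_diff[OF u[OF that] this] show ?thesis
      unfolding P_def by (rule back_subst[of "\<lambda>f. f sums _"]) (auto simp: c_def)
  qed
  have "2 * pi * (\<Sum>n<M. (cmod (c n) * r ^ n)\<^sup>2) \<le> e N" for M
  proof -
    have "(\<Sum>n<M. (cmod (c n) * r ^ n)\<^sup>2) \<le> (\<Sum>n<M. (if n < N then 0 else (cmod (a n))\<^sup>2))"
    proof (intro sum_mono)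
      fix n
      have "(cmod (a n) * r ^ n)\<^sup>2 \<le> (cmod (a n) * 1)\<^sup>2"
        using r by (intro power_mono mult_left_mono) (auto simp: power_le_one)
      thus "(cmod (c n) * r ^ n)\<^sup>2 \<le> (if n < N then 0 else (cmod (a n))\<^sup>2)" by (auto simp: c_def)
    qed
    also have "\<dots> \<le> (\<Sum>n<max M N. (if n < N then 0 else (cmod (a n))\<^sup>2))"
      by (intro sum_mono2) auto
    also have "\<dots> = (\<Sum>n\<in>{N..<max M N}. (cmod (a n))\<^sup>2)"
      by (intro sum.mono_neutral_cong_right) auto
    also have "\<dots> = (\<Sum>n<max M N. (cmod (a n))\<^sup>2) - (\<Sum>n<N. (cmod (a n))\<^sup>2)"
      by (subst sum_diff[symmetric]) (auto intro!: sum.cong)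
    also have "(\<Sum>n<max M N. (cmod (a n))\<^sup>2) \<le> (\<Sum>n. (cmod (a n))\<^sup>2)"
      by (intro sum_le_suminf summ) auto
    finally show ?thesis unfolding e_def by (intro mult_left_mono) auto
  qed
  thus "(\<integral>\<^sup>+\<theta>. ennreal ((cmod (u (of_real r * cis \<theta>) - P N (of_real r * cis \<theta>)))\<^sup>2) \<partial>angle_measure) \<le> ennreal (e N)"
    by (intro LIMSEQ_le_const2[OF circle_mean_square_limit[OF v r]]) (auto intro!: ennreal_leI)
qed

lemma radial_point_in_stolz: "\<alpha> > 1 \<Longrightarrow> radial_point i \<theta> \<in> stolz \<alpha> (cis \<theta>)"
proof -
  assume "\<alpha> > 1"
  have "cmod (radial_point i \<theta> - cis \<theta>) = \<bar>dyadic_radius i - 1\<bar>"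
  proof -
    have "radial_point i \<theta> - cis \<theta> = of_real (dyadic_radius i - 1) * cis \<theta>"
      by (simp add: radial_point_def algebra_simps)
    thus ?thesis by (simp only: norm_mult norm_of_real norm_cis mult_1_right)
  qed
  moreover have "1 * (1 - dyadic_radius i) < \<alpha> * (1 - dyadic_radius i)"
    using \<open>\<alpha> > 1\<close> dyadic_radius_bounds[of i] by (intro mult_strict_right_mono) auto
  ultimately show ?thesis using dyadic_radius_bounds[of i] by (simp add: stolz_def)
qed

lemma radial_point_tendsto: "(\<lambda>i. radial_point i \<theta>) \<longlonglongrightarrow> cis \<theta>"
proof -
  have "(\<lambda>i. of_real (dyadic_radius i) * cis \<theta>) \<longlonglongrightarrow> of_real 1 * cis \<theta>"
    by (intro tendsto_intros dyadic_radius_tendsto)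
  thus ?thesis by (simp add: radial_point_def)
qed

text \<open>
  Every Stolz angle contains the radial points, and so the limits for different apertures
  coincide.
\<close>

lemma stolz_limitI:
  fixes u :: "complex \<Rightarrow> complex"
  assumes osc: "\<And>\<alpha> \<epsilon>. \<alpha> > 1 \<Longrightarrow> \<epsilon> > 0 \<Longrightarrow> \<exists>\<delta>>0. \<forall>z\<in>stolz \<alpha> (cis \<theta>). \<forall>w\<in>stolz \<alpha> (cis \<theta>).
              dist z (cis \<theta>) < \<delta> \<longrightarrow> dist w (cis \<theta>) < \<delta> \<longrightarrow> cmod (u z - u w) < \<epsilon>"
  shows "\<exists>l. \<forall>\<alpha>>1. (u \<longlongrightarrow> l) (at (cis \<theta>) within stolz \<alpha> (cis \<theta>))"
proof -
  have near: "\<exists>M. \<forall>i\<ge>M. dist (radial_point i \<theta>) (cis \<theta>) < \<delta>" if "\<delta> > 0" for \<delta>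
    using radial_point_tendsto[of \<theta>] that unfolding LIMSEQ_def by blast
  have "Cauchy (\<lambda>i. u (radial_point i \<theta>))"
  proof (rule metric_CauchyI)
    fix \<epsilon> :: real assume "\<epsilon> > 0"
    from osc[of 2, OF _ this] obtain \<delta> where "\<delta> > 0" and
      \<delta>: "\<And>z w. z \<in> stolz 2 (cis \<theta>) \<Longrightarrow> w \<in> stolz 2 (cis \<theta>) \<Longrightarrow> dist z (cis \<theta>) < \<delta> \<Longrightarrow>
            dist w (cis \<theta>) < \<delta> \<Longrightarrow> cmod (u z - u w) < \<epsilon>" by auto
    from near[OF \<open>\<delta> > 0\<close>] obtain M where "\<forall>i\<ge>M. dist (radial_point i \<theta>) (cis \<theta>) < \<delta>" by blast
    thus "\<exists>M. \<forall>m\<ge>M. \<forall>n\<ge>M. dist (u (radial_point m \<theta>)) (u (radial_point n \<theta>)) < \<epsilon>"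
      unfolding dist_norm[of "u _"] by (intro exI[of _ M]) (auto intro!: \<delta> radial_point_in_stolz)
  qed
  then obtain l where l: "(\<lambda>i. u (radial_point i \<theta>)) \<longlonglongrightarrow> l"
    using Cauchy_convergent convergent_def by blast
  have "(u \<longlongrightarrow> l) (at (cis \<theta>) within stolz \<alpha> (cis \<theta>))" if "\<alpha> > 1" for \<alpha>
  proof (rule tendstoI)
    fix \<epsilon> :: real assume "\<epsilon> > 0"
    with osc[OF that, of "\<epsilon> / 2"] obtain \<delta> where "\<delta> > 0" and
      \<delta>: "\<And>z w. z \<in> stolz \<alpha> (cis \<theta>) \<Longrightarrow> w \<in> stolz \<alpha> (cis \<theta>) \<Longrightarrow> dist z (cis \<theta>) < \<delta> \<Longrightarrow>
            dist w (cis \<theta>) < \<delta> \<Longrightarrow> cmod (u z - u w) < \<epsilon> / 2" by auto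
    from near[OF \<open>\<delta> > 0\<close>] obtain M where M: "\<forall>i\<ge>M. dist (radial_point i \<theta>) (cis \<theta>) < \<delta>" by blast
    have "dist (u z) l < \<epsilon>" if z: "z \<in> stolz \<alpha> (cis \<theta>)" "dist z (cis \<theta>) < \<delta>" for z
    proof -
      have "dist (u z) l \<le> \<epsilon> / 2"
      proof (rule LIMSEQ_le_const2)
        show "(\<lambda>i. dist (u z) (u (radial_point i \<theta>))) \<longlonglongrightarrow> dist (u z) l"
          by (intro tendsto_intros l)
        show "\<exists>N. \<forall>i\<ge>N. dist (u z) (u (radial_point i \<theta>)) \<le> \<epsilon> / 2"
        proof (intro exI[of _ M] allI impI)
          fix i assume "i \<ge> M"
          thus "dist (u z) (u (radial_point i \<theta>)) \<le> \<epsilon> / 2"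
            using \<delta>[OF z(1) radial_point_in_stolz[OF \<open>\<alpha> > 1\<close>] z(2), of i] M by (simp add: dist_norm)
        qed
      qed
      thus ?thesis using \<open>\<epsilon> > 0\<close> by simp
    qed
    thus "\<forall>\<^sub>F z in at (cis \<theta>) within stolz \<alpha> (cis \<theta>). dist (u z) l < \<epsilon>"
      using \<open>\<delta> > 0\<close> by (auto simp: eventually_at)
  qed
  thus ?thesis by blast
qed

text \<open>
  Let \<open>V N\<close> be the maximal function of the Taylor tail \<open>u - P N\<close>. Its integral tends to \<open>0\<close>, so
  by Fatou's lemma \<open>liminf V N = 0\<close> almost everywhere. At such an angle, \<open>u\<close> is approximated uniformly
  on each Stolz angle by polynomials, hence satisfies the Cauchy criterion there.
\<close>

lemma H2_nontangential_limit:
  fixes u :: "complex \<Rightarrow> complex"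
  assumes hol: "u holomorphic_on ball 0 1"
    and bound: "\<And>r. 0 < r \<Longrightarrow> r < 1 \<Longrightarrow>
                  mean_square u r \<le> ennreal b"
  shows "AE \<theta> in angle_measure. \<exists>l. \<forall>\<alpha>>1. (u \<longlongrightarrow> l) (at (cis \<theta>) within stolz \<alpha> (cis \<theta>))"
proof -
  have bound': "mean_square u r \<le> ennreal (max b 0)"
    if "0 < r" "r < 1" for r
    using bound[OF that] by (rule order_trans) (intro ennreal_leI, simp)
  obtain P e where P: "\<And>N. P N holomorphic_on UNIV" and e: "e \<longlonglongrightarrow> 0" and
    tail: "\<And>N r. 0 < r \<Longrightarrow> r < 1 \<Longrightarrow>
       (\<integral>\<^sup>+\<theta>. ennreal ((cmod (u (of_real r * cis \<theta>) - P N (of_real r * cis \<theta>)))\<^sup>2) \<partial>angle_measure) \<le> ennreal (e N)"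
    by (rule H2_taylor_tails[OF hol bound' max.cobounded2]; (assumption | (rule that; assumption)))
  have "\<exists>V. V \<in> borel_measurable angle_measure \<and> (\<integral>\<^sup>+\<theta>. V \<theta> \<partial>angle_measure) \<le> 2500 * ennreal (e N) \<and>
    (\<forall>\<alpha> \<theta> z. \<alpha> > 1 \<longrightarrow> z \<in> stolz \<alpha> (cis \<theta>) \<longrightarrow>
       ennreal ((cmod (u z - P N z))\<^sup>2 / stolz_const \<alpha>) \<le> V \<theta>)" for N
  proof -
    have "(\<lambda>z. u z - P N z) holomorphic_on ball 0 1"
      by (intro holomorphic_intros hol holomorphic_on_subset[OF P]) auto
    thus ?thesis
    proof (rule H2_maximal[OF _ tail])
      fix V assume V: "V \<in> borel_measurable angle_measure" "(\<integral>\<^sup>+\<theta>. V \<theta> \<partial>angle_measure) \<le> 2500 * ennreal (e N)"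
        "\<And>\<alpha> \<theta> z. \<alpha> > 1 \<Longrightarrow> z \<in> stolz \<alpha> (cis \<theta>) \<Longrightarrow>
           ennreal ((cmod (u z - P N z))\<^sup>2 / stolz_const \<alpha>) \<le> V \<theta>"
      show ?thesis by (intro exI[of _ V] conjI allI impI V)
    qed
  qed
  then obtain V where V [measurable]: "\<And>N. V N \<in> borel_measurable angle_measure"
    and V_int: "\<And>N. (\<integral>\<^sup>+\<theta>. V N \<theta> \<partial>angle_measure) \<le> 2500 * ennreal (e N)"
    and V_max: "\<And>N \<alpha> \<theta> z. \<alpha> > 1 \<Longrightarrow> z \<in> stolz \<alpha> (cis \<theta>) \<Longrightarrow>
       ennreal ((cmod (u z - P N z))\<^sup>2 / stolz_const \<alpha>) \<le> V N \<theta>"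
    by metis
  have "(\<lambda>N. 2500 * ennreal (e N)) \<longlonglongrightarrow> 2500 * ennreal 0"
    by (intro ennreal_tendsto_cmult tendsto_ennrealI e) simp
  hence lim0: "liminf (\<lambda>N. 2500 * ennreal (e N)) = 0"
    using lim_imp_Liminf[OF sequentially_bot] by fastforce
  have "(\<integral>\<^sup>+\<theta>. liminf (\<lambda>N. V N \<theta>) \<partial>angle_measure) \<le> liminf (\<lambda>N. \<integral>\<^sup>+\<theta>. V N \<theta> \<partial>angle_measure)"
    by (rule nn_integral_liminf) measurable
  also have "\<dots> \<le> liminf (\<lambda>N. 2500 * ennreal (e N))"
    by (intro Liminf_mono always_eventually allI V_int)
  finally have "(\<integral>\<^sup>+\<theta>. liminf (\<lambda>N. V N \<theta>) \<partial>angle_measure) = 0" using lim0 by simp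
  hence "AE \<theta> in angle_measure. liminf (\<lambda>N. V N \<theta>) = 0"
    by (subst (asm) nn_integral_0_iff_AE) measurable
  thus ?thesis
  proof eventually_elim
    fix \<theta> assume 0: "liminf (\<lambda>N. V N \<theta>) = 0"
    show "\<exists>l. \<forall>\<alpha>>1. (u \<longlongrightarrow> l) (at (cis \<theta>) within stolz \<alpha> (cis \<theta>))"
    proof (rule stolz_limitI)
      fix \<alpha> \<epsilon> :: real assume "\<alpha> > 1" "\<epsilon> > 0"
      have pos: "stolz_const \<alpha> > 0" using \<open>\<alpha> > 1\<close> by (simp add: stolz_const_def)
      have "\<exists>N. V N \<theta> < ennreal ((\<epsilon>/3)\<^sup>2 / stolz_const \<alpha>)"
      proof (rule ccontr)
        assume "\<not> ?thesis"
        hence "ennreal ((\<epsilon>/3)\<^sup>2 / stolz_const \<alpha>) \<le> liminf (\<lambda>N. V N \<theta>)"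
          by (intro Liminf_bounded) (auto simp: not_less)
        moreover have "(\<epsilon>/3)\<^sup>2 / stolz_const \<alpha> > 0" using pos \<open>\<epsilon> > 0\<close> by simp
        ultimately show False using 0 by (simp add: ennreal_eq_0_iff)
      qed
      then obtain N where N: "V N \<theta> < ennreal ((\<epsilon>/3)\<^sup>2 / stolz_const \<alpha>)" by blast
      have tail_small: "cmod (u z - P N z) < \<epsilon> / 3" if "z \<in> stolz \<alpha> (cis \<theta>)" for z
      proof -
        have "ennreal ((cmod (u z - P N z))\<^sup>2 / stolz_const \<alpha>) < ennreal ((\<epsilon>/3)\<^sup>2 / stolz_const \<alpha>)"
          using V_max[OF \<open>\<alpha> > 1\<close> that, of N] N by (rule le_less_trans)
        hence "(cmod (u z - P N z))\<^sup>2 < (\<epsilon>/3)\<^sup>2"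
          using pos by (simp add: ennreal_less_iff divide_strict_right_mono divide_less_cancel)
        thus ?thesis using \<open>\<epsilon> > 0\<close> by (intro power2_less_imp_less[of _ "\<epsilon>/3"]) auto
      qed
      have "isCont (P N) (cis \<theta>)"
        using holomorphic_on_imp_continuous_on[OF P[of N]] by (simp add: continuous_on_eq_continuous_at)
      then obtain \<delta> where "\<delta> > 0" and \<delta>: "\<And>z. dist z (cis \<theta>) < \<delta> \<Longrightarrow> dist (P N z) (P N (cis \<theta>)) < \<epsilon> / 6"
        using \<open>\<epsilon> > 0\<close> unfolding continuous_at_eps_delta by (meson divide_pos_pos zero_less_numeral)
      have "cmod (u z - u w) < \<epsilon>"
        if "z \<in> stolz \<alpha> (cis \<theta>)" "w \<in> stolz \<alpha> (cis \<theta>)" "dist z (cis \<theta>) < \<delta>" "dist w (cis \<theta>) < \<delta>" for z w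
      proof -
        have "dist (P N z) (P N w) < \<epsilon> / 3"
          using \<delta>[OF that(3)] \<delta>[OF that(4)] dist_triangle2[of "P N z" "P N w" "P N (cis \<theta>)"] by simp
        moreover have "cmod (u z - u w) \<le> cmod (u z - P N z) + cmod (P N z - P N w) + cmod (u w - P N w)"
          using norm_triangle_ineq4[of "(u z - P N z) + (P N z - P N w)" "u w - P N w"]
            norm_triangle_ineq[of "u z - P N z" "P N z - P N w"] by (simp add: algebra_simps)
        ultimately show ?thesis
          using tail_small[OF that(1)] tail_small[OF that(2)] by (simp add: dist_norm)
      qed
      thus "\<exists>\<delta>>0. \<forall>z\<in>stolz \<alpha> (cis \<theta>). \<forall>w\<in>stolz \<alpha> (cis \<theta>).
              dist z (cis \<theta>) < \<delta> \<longrightarrow> dist w (cis \<theta>) < \<delta> \<longrightarrow> cmod (u z - u w) < \<epsilon>"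
        using \<open>\<delta> > 0\<close> by blast
    qed
  qed
qed

section \<open>Finite Blaschke products\<close>

lemma blaschke_factor_norm:
  fixes a w :: complex
  shows "(cmod (1 - cnj a * w))\<^sup>2 - (cmod (w - a))\<^sup>2 = (1 - (cmod a)\<^sup>2) * (1 - (cmod w)\<^sup>2)"
  unfolding cmod_power2 by (simp add: power2_eq_square algebra_simps)

lemma one_minus_cnj_mult_nonzero:
  fixes a w :: complex
  assumes "cmod a < 1" "cmod w \<le> 1"
  shows "1 - cnj a * w \<noteq> 0"
proof
  assume "1 - cnj a * w = 0"
  hence "cmod a * cmod w = 1" by (metis complex_mod_cnj norm_mult norm_one right_minus_eq)
  moreover have "cmod a * cmod w \<le> cmod a * 1" using assms by (intro mult_left_mono) auto
  ultimately show False using assms by simp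
qed

text \<open>
  Induction on the number of distinct zeros in the disc: a zero \<open>a\<close> of order \<open>n\<close> is removed
  by dividing by \<open>((z - a) / (1 - cnj a * z)) ^ n\<close>, which has modulus \<open>1\<close> on the unit circle.
\<close>

lemma finite_blaschke_factorization:
  fixes F :: "complex \<Rightarrow> complex"
  assumes R: "R > 1" and hol: "F holomorphic_on ball 0 R"
    and sphere: "\<And>z. cmod z = 1 \<Longrightarrow> F z \<noteq> 0"
  shows "\<exists>B G. B holomorphic_on ball 0 1 \<and> (\<forall>z\<in>ball 0 1. cmod (B z) \<le> 1) \<and>
           G holomorphic_on ball 0 R \<and> (\<forall>z\<in>cball 0 1. G z \<noteq> 0) \<and>
           (\<forall>z\<in>ball 0 1. F z = B z * G z) \<and> (\<forall>z\<in>sphere 0 1. cmod (F z) = cmod (G z))"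
proof -
  have fin: "finite {z \<in> ball 0 1. F z = 0}" if "F holomorphic_on ball 0 R" "\<And>z. cmod z = 1 \<Longrightarrow> F z \<noteq> 0" for F
  proof (cases "F constant_on ball 0 R")
    case True
    then obtain c where "\<And>z. z \<in> ball 0 R \<Longrightarrow> F z = c" by (auto simp: constant_on_def)
    moreover from this[of 1] have "c \<noteq> 0" using that(2)[of 1] R by auto
    ultimately have "{z \<in> ball 0 1. F z = 0} = {}" using R by auto
    thus ?thesis by (simp only: finite.emptyI)
  next
    case False
    have "finite {z \<in> cball 0 1. F z = 0}"
      by (rule holomorphic_compact_finite_zeros[OF that(1)]) (use R False in auto)
    thus ?thesis by (rule rev_finite_subset) auto
  qed
  show ?thesis using hol sphere
  proof (induction "card {z \<in> ball 0 1. F z = 0}" arbitrary: F rule: less_induct)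
    case less
    show ?case
    proof (cases "{z \<in> ball 0 1. F z = 0} = {}")
      case True
      have "\<forall>z\<in>cball 0 1. F z \<noteq> 0"
      proof
        fix z :: complex assume "z \<in> cball 0 1"
        thus "F z \<noteq> 0" using True less.prems(2)[of z] by (cases "cmod z = 1") auto
      qed
      thus ?thesis using less.prems by (intro exI[of _ "\<lambda>_. 1"] exI[of _ F]) auto
    next
      case False
      then obtain a where a: "cmod a < 1" "F a = 0" by auto
      have aR: "a \<in> ball 0 R" using a R by auto
      have "\<not> F constant_on ball 0 R"
      proof
        assume "F constant_on ball 0 R"
        hence "F 1 = F a" using aR R by (auto simp: constant_on_def)
        thus False using a less.prems(2)[of 1] by simp
      qed
      then obtain g r n where n: "0 < n" and r: "0 < r" "ball a r \<subseteq> ball 0 R"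
        and g: "g holomorphic_on ball a r"
        and Fg: "\<And>w. w \<in> ball a r \<Longrightarrow> F w = (w - a) ^ n * g w"
        and gnz: "\<And>w. w \<in> ball a r \<Longrightarrow> g w \<noteq> 0"
        using holomorphic_factor_zero_nonconstant[of F "ball 0 R" a] less.prems(1) a aR
        by (metis open_ball connected_ball)
      \<comment> \<open>The quotient \<open>F w / (w - a) ^ n\<close> with its removable singularity filled in.\<close>
      define Q where "Q w = (if w = a then g a else F w / (w - a) ^ n)" for w
      have "Q holomorphic_on ball a r"
        by (rule holomorphic_transform[OF g]) (auto simp: Q_def Fg)
      moreover have "Q holomorphic_on (ball 0 R - {a})"
      proof (rule holomorphic_transform)
        show "(\<lambda>w. F w / (w - a) ^ n) holomorphic_on ball 0 R - {a}"
          by (intro holomorphic_intros holomorphic_on_subset[OF less.prems(1)]) auto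
      qed (auto simp: Q_def)
      ultimately have "Q holomorphic_on (ball a r \<union> (ball 0 R - {a}))"
        by (intro holomorphic_on_Un) auto
      moreover have "ball a r \<union> (ball 0 R - {a}) = ball 0 R" using r by auto
      ultimately have Q_hol: "Q holomorphic_on ball 0 R" by simp
      have Q: "F w = (w - a) ^ n * Q w" for w using a n by (simp add: Q_def)
      have Qa: "Q a \<noteq> 0" using gnz[of a] r by (simp add: Q_def)
      define G where "G w = Q w * (1 - cnj a * w) ^ n" for w
      define b where "b w = ((w - a) / (1 - cnj a * w)) ^ n" for w
      have G_hol: "G holomorphic_on ball 0 R"
        unfolding G_def[abs_def] by (intro holomorphic_intros Q_hol)
      have Fb: "F w = b w * G w" if "cmod w \<le> 1" for w
        using one_minus_cnj_mult_nonzero[OF a(1) that] by (simp add: Q G_def b_def power_divide)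
      have b_sphere: "cmod (b w) = 1" if "cmod w = 1" for w
      proof -
        have "(cmod (1 - cnj a * w))\<^sup>2 = (cmod (w - a))\<^sup>2"
          using blaschke_factor_norm[of a w] that by simp
        hence "cmod (1 - cnj a * w) = cmod (w - a)" by simp
        moreover have "cmod (1 - cnj a * w) \<noteq> 0"
          using one_minus_cnj_mult_nonzero[OF a(1), of w] that by simp
        ultimately show ?thesis by (simp add: b_def norm_power norm_divide)
      qed
      have b_ball: "cmod (b w) \<le> 1" if "cmod w < 1" for w
      proof -
        have "0 \<le> (1 - (cmod a)\<^sup>2) * (1 - (cmod w)\<^sup>2)"
          using a that by (intro mult_nonneg_nonneg) (auto simp: power_le_one)
        hence "(cmod (w - a))\<^sup>2 \<le> (cmod (1 - cnj a * w))\<^sup>2" using blaschke_factor_norm[of a w] by linarith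
        hence "cmod (w - a) \<le> cmod (1 - cnj a * w)" by (rule power2_le_imp_le) simp
        moreover have "cmod (1 - cnj a * w) > 0"
          using one_minus_cnj_mult_nonzero[OF a(1), of w] that by simp
        ultimately show ?thesis by (simp add: b_def norm_power norm_divide power_le_one)
      qed
      have G_sphere: "cmod (F w) = cmod (G w)" if "cmod w = 1" for w
        using Fb[of w] b_sphere[OF that] that by (simp add: norm_mult)
      have zeros: "{z \<in> ball 0 1. G z = 0} \<subseteq> {z \<in> ball 0 1. F z = 0} - {a}"
      proof safe
        fix z :: complex assume z: "z \<in> ball 0 1" "G z = 0"
        show "F z = 0" using Fb[of z] z by simp
      next
        assume "G a = 0"
        thus False using Qa one_minus_cnj_mult_nonzero[OF a(1), of a] a by (simp add: G_def)
      qed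
      have "card {z \<in> ball 0 1. G z = 0} < card {z \<in> ball 0 1. F z = 0}"
      proof (rule psubset_card_mono[OF fin[OF less.prems]])
        show "{z \<in> ball 0 1. G z = 0} \<subset> {z \<in> ball 0 1. F z = 0}"
          using zeros a by (auto simp: psubset_eq)
      qed
      moreover have "G z \<noteq> 0" if "cmod z = 1" for z
        using G_sphere[OF that] less.prems(2)[OF that] by auto
      ultimately obtain B H where BH: "B holomorphic_on ball 0 1" "\<forall>z\<in>ball 0 1. cmod (B z) \<le> 1"
        "H holomorphic_on ball 0 R" "\<forall>z\<in>cball 0 1. H z \<noteq> 0"
        "\<forall>z\<in>ball 0 1. G z = B z * H z" "\<forall>z\<in>sphere 0 1. cmod (G z) = cmod (H z)"
        using less.hyps[OF _ G_hol] by blast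
      have "(\<lambda>z. b z * B z) holomorphic_on ball 0 1"
        unfolding b_def using one_minus_cnj_mult_nonzero[OF a(1)]
        by (intro holomorphic_intros BH) auto
      moreover have "\<forall>z\<in>ball 0 1. cmod (b z * B z) \<le> 1"
        using b_ball BH(2) by (auto simp: norm_mult intro!: mult_le_one)
      ultimately show ?thesis using BH Fb G_sphere
        by (intro exI[of _ "\<lambda>z. b z * B z"] exI[of _ H]) auto
    qed
  qed
qed

text \<open>
  The zero-free factor has no zeros on a slightly larger disc either, and so it has a
  logarithm there.
\<close>

lemma blaschke_exp_factorization:
  fixes F :: "complex \<Rightarrow> complex"
  assumes R: "R > 1" and hol: "F holomorphic_on ball 0 R"
    and sphere: "\<And>z. cmod z = 1 \<Longrightarrow> F z \<noteq> 0"
  shows "\<exists>B L S. B holomorphic_on ball 0 1 \<and> (\<forall>z\<in>ball 0 1. cmod (B z) \<le> 1) \<and>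
           S > 1 \<and> L holomorphic_on ball 0 S \<and> (\<forall>z\<in>ball 0 1. F z = B z * exp (L z)) \<and>
           (\<forall>z\<in>sphere 0 1. cmod (F z) = cmod (exp (L z)))"
proof -
  obtain B G where BG: "B holomorphic_on ball 0 1" "\<forall>z\<in>ball 0 1. cmod (B z) \<le> 1"
    "G holomorphic_on ball 0 R" "\<forall>z\<in>cball 0 1. G z \<noteq> 0"
    "\<forall>z\<in>ball 0 1. F z = B z * G z" "\<forall>z\<in>sphere 0 1. cmod (F z) = cmod (G z)"
    using finite_blaschke_factorization[OF assms] by blast
  define U where "U = ball 0 R \<inter> G -` (- {0})"
  have "open U" unfolding U_def
    by (intro continuous_open_preimage holomorphic_on_imp_continuous_on BG) auto
  moreover have "cball 0 1 \<subseteq> U" using BG(4) R by (auto simp: U_def)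
  ultimately obtain \<epsilon> where \<epsilon>: "\<epsilon> > 0" "(\<Union>x\<in>cball 0 1. ball x \<epsilon>) \<subseteq> U"
    using compact_subset_open_imp_ball_epsilon_subset[of "cball 0 1" U] by auto
  have sub: "ball 0 (1 + \<epsilon>) \<subseteq> U"
  proof
    fix z :: complex assume z: "z \<in> ball 0 (1 + \<epsilon>)"
    show "z \<in> U"
    proof (cases "cmod z \<le> 1")
      case True
      thus ?thesis using \<open>cball 0 1 \<subseteq> U\<close> by auto
    next
      case False
      have "z - sgn z = of_real (1 - 1 / cmod z) * z"
        using False by (simp add: sgn_div_norm scaleR_conv_of_real algebra_simps divide_inverse)
      hence "dist (sgn z) z = \<bar>1 - 1 / cmod z\<bar> * cmod z"
        by (metis dist_commute dist_norm norm_mult norm_of_real)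
      also have "\<dots> = cmod z - 1" using False by (auto simp: abs_if field_simps)
      finally have "z \<in> ball (sgn z) \<epsilon>" using z by simp
      moreover have "sgn z \<in> cball 0 1" by (simp add: norm_sgn)
      ultimately show ?thesis using \<epsilon>(2) by blast
    qed
  qed
  have "G holomorphic_on ball 0 (1 + \<epsilon>)"
    by (rule holomorphic_on_subset[OF BG(3)]) (use sub in \<open>auto simp: U_def\<close>)
  then obtain L where L: "L holomorphic_on ball 0 (1 + \<epsilon>)" "\<And>z. z \<in> ball 0 (1 + \<epsilon>) \<Longrightarrow> G z = exp (L z)"
  proof (rule contractible_imp_holomorphic_log)
    show "contractible (ball 0 (1 + \<epsilon>) :: complex set)" by (rule convex_imp_contractible[OF convex_ball])
    show "G z \<noteq> 0" if "z \<in> ball 0 (1 + \<epsilon>)" for z using that sub by (auto simp: U_def)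
  qed (rule that; assumption)
  show ?thesis
    using BG L \<epsilon>(1) by (intro exI[of _ B] exI[of _ L] exI[of _ "1 + \<epsilon>"]) auto
qed

section \<open>Limits of dilates\<close>

text \<open>
  The zeros of \<open>f\<close> are countable, while every interval of radii is uncountable.
\<close>

lemma zero_free_radii:
  fixes f :: "complex \<Rightarrow> complex"
  assumes hol: "f holomorphic_on ball 0 1" and nz: "z0 \<in> ball 0 1" "f z0 \<noteq> 0"
  obtains \<rho> :: "nat \<Rightarrow> real" where "\<And>j. 0 < \<rho> j" "\<And>j. \<rho> j < 1" "\<rho> \<longlonglongrightarrow> 1"
    "\<And>j z. cmod z = \<rho> j \<Longrightarrow> f z \<noteq> 0"
proof -
  let ?Z = "{z \<in> ball 0 1. f z = 0}"
  have "countable ?Z"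
  proof (cases "f constant_on ball 0 1")
    case True
    hence "?Z = {}" using nz by (auto simp: constant_on_def)
    thus ?thesis by (simp only: countable_empty)
  next
    case False
    obtain C :: "nat \<Rightarrow> complex set" where "\<And>n. compact (C n)" "\<Union>(range C) = ball 0 1"
      by (rule open_Union_compact_subsets[of "ball 0 1 :: complex set"]) auto
    hence "fsigma (ball 0 1 :: complex set)"
      unfolding fsigma_Union_compact by (intro exI[of _ C]) auto
    thus ?thesis using False by (intro holomorphic_countable_zeros hol) auto
  qed
  hence *: "countable (cmod ` ?Z)" by simp
  \<comment> \<open>Uncountably many radii lie above each dyadic radius, so some of them avoid the zeros.\<close>
  have "\<exists>x. dyadic_radius j < x \<and> x < 1 \<and> x \<notin> cmod ` ?Z" for j
  proof (rule ccontr)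
    assume "\<not> ?thesis"
    hence "{dyadic_radius j<..<1} \<subseteq> cmod ` ?Z" by auto
    with * have "countable {dyadic_radius j<..<1}" by (rule countable_subset[rotated])
    thus False using dyadic_radius_bounds(2)[of j] uncountable_open_interval[of "dyadic_radius j" 1] by blast
  qed
  then obtain \<rho> where \<rho>: "\<And>j. dyadic_radius j < \<rho> j" "\<And>j. \<rho> j < 1" "\<And>j. \<rho> j \<notin> cmod ` ?Z" by metis
  show thesis
  proof
    show "0 < \<rho> j" for j using \<rho>(1)[of j] dyadic_radius_bounds[of j] by simp
    show "\<rho> \<longlonglongrightarrow> 1"
      by (rule tendsto_sandwich[OF _ _ dyadic_radius_tendsto tendsto_const]) (auto intro!: always_eventually less_imp_le \<rho>)
    show "f z \<noteq> 0" if "cmod z = \<rho> j" for j z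
    proof
      assume "f z = 0"
      hence "z \<in> ?Z" using that \<rho>(2)[of j] by simp
      hence "cmod z \<in> cmod ` ?Z" by (rule imageI)
      thus False using \<rho>(3)[of j] that by simp
    qed
  qed (rule \<rho>)
qed

text \<open>
  A monotone radial majorant is locally bounded, as required by Montel's theorem.
\<close>

lemma montel_disc:
  fixes F :: "nat \<Rightarrow> complex \<Rightarrow> complex"
  assumes hol: "\<And>j. F j holomorphic_on ball 0 1"
    and bound: "\<And>j z. cmod z < 1 \<Longrightarrow> cmod (F j z) \<le> M (cmod z)"
    and M: "\<And>r s. 0 \<le> r \<Longrightarrow> r \<le> s \<Longrightarrow> s < 1 \<Longrightarrow> M r \<le> M s"
  obtains g s where "g holomorphic_on ball 0 1" "strict_mono (s :: nat \<Rightarrow> nat)"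
    "\<And>z. z \<in> ball 0 1 \<Longrightarrow> (\<lambda>n. F (s n) z) \<longlonglongrightarrow> g z"
proof (rule Montel[of "ball 0 1" "range F" F])
  fix K :: "complex set" assume K: "compact K" "K \<subseteq> ball 0 1"
  show "\<exists>B. \<forall>h\<in>range F. \<forall>z\<in>K. cmod (h z) \<le> B"
  proof (cases "K = {}")
    case False
    obtain x where x: "x \<in> K" "\<forall>y\<in>K. cmod y \<le> cmod x"
      using continuous_attains_sup[OF K(1) False, of cmod] by (auto intro!: continuous_intros)
    have "cmod (F j z) \<le> M (cmod x)" if "z \<in> K" for j z
      using bound[of z j] M[of "cmod z" "cmod x"] x that K(2) by fastforce
    thus ?thesis by blast
  qed simp
qed (use hol that in auto)

lemma circle_fatou:
  fixes u :: "nat \<Rightarrow> complex \<Rightarrow> complex"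
  assumes hol: "\<And>j. u j holomorphic_on ball 0 1"
    and lim: "\<And>z. z \<in> ball 0 1 \<Longrightarrow> (\<lambda>j. u j z) \<longlonglongrightarrow> v z"
    and r: "0 < r" "r < 1"
    and bound: "\<And>j. mean_square (u j) r \<le> B"
  shows "mean_square v r \<le> B"
proof -
  have inside: "of_real r * cis \<theta> \<in> ball 0 1" for \<theta> using r by (simp add: norm_mult)
  have [measurable]: "(\<lambda>\<theta>. u j (of_real r * cis \<theta>)) \<in> borel_measurable angle_measure" for j
    by (intro borel_measurable_angle_measureI continuous_on_compose2[OF holomorphic_on_imp_continuous_on[OF hol]]
         continuous_intros) (use inside in auto)
  have "ennreal ((cmod (v (of_real r * cis \<theta>)))\<^sup>2) = liminf (\<lambda>j. ennreal ((cmod (u j (of_real r * cis \<theta>)))\<^sup>2))" for \<theta>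
    by (rule lim_imp_Liminf[OF sequentially_bot, symmetric]) (intro tendsto_ennrealI tendsto_intros lim inside)
  hence "mean_square v r =
         (\<integral>\<^sup>+\<theta>. liminf (\<lambda>j. ennreal ((cmod (u j (of_real r * cis \<theta>)))\<^sup>2)) \<partial>angle_measure)" by simp
  also have "\<dots> \<le> liminf (\<lambda>j. \<integral>\<^sup>+\<theta>. ennreal ((cmod (u j (of_real r * cis \<theta>)))\<^sup>2) \<partial>angle_measure)"
    by (rule nn_integral_liminf) measurable
  also have "\<dots> \<le> liminf (\<lambda>j::nat. B)" by (intro Liminf_mono always_eventually allI bound)
  finally show ?thesis by (simp add: Liminf_const)
qed

text \<open>
  The Poisson kernel is at most \<open>1 / (2\<pi> (1 - cmod z)\<^sup>2)\<close>; with \<open>x \<le> 1 + x\<^sup>2\<close> a bound on the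
  mean square then bounds the values.
\<close>

lemma interior_bound:
  fixes u :: "complex \<Rightarrow> complex"
  assumes R: "R > 1" and hol: "u holomorphic_on ball 0 R"
    and bound: "(\<integral>\<^sup>+\<theta>. ennreal ((cmod (u (cis \<theta>)))\<^sup>2) \<partial>angle_measure) \<le> ennreal b" and b: "b \<ge> 0"
    and z: "cmod z < 1"
  shows "cmod (u z) \<le> (2 * pi + b) / (2 * pi * (1 - cmod z)\<^sup>2)"
proof -
  have cont: "continuous_on (cball 0 1) u"
    by (rule continuous_on_subset[OF holomorphic_on_imp_continuous_on[OF hol]]) (use R in auto)
  have [measurable]: "(\<lambda>\<theta>. u (cis \<theta>)) \<in> borel_measurable angle_measure"
    by (intro borel_measurable_angle_measureI continuous_on_compose2[OF cont] continuous_intros) auto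
  let ?C = "1 / (2 * pi * (1 - cmod z)\<^sup>2)"
  have "poisson z t \<le> ?C" for t
    unfolding poisson_def
  proof (rule frac_le)
    have "1 - cmod z \<le> cmod (cis t - z)" using norm_triangle_ineq2[of "cis t" z] by simp
    thus "2 * pi * (1 - cmod z)\<^sup>2 \<le> 2 * pi * (cmod (cis t - z))\<^sup>2"
      using z by (intro mult_left_mono power_mono) auto
  qed (use z in auto)
  hence le: "poisson z t * cmod (u (cis t)) \<le> ?C * (1 + (cmod (u (cis t)))\<^sup>2)" for t
  proof (rule mult_mono)
    have "0 \<le> (cmod (u (cis t)) - 1/2)\<^sup>2 + 3/4" by simp
    thus "cmod (u (cis t)) \<le> 1 + (cmod (u (cis t)))\<^sup>2" by (simp add: power2_eq_square algebra_simps)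
  qed auto
  have "ennreal (cmod (u z)) \<le> (\<integral>\<^sup>+t. ennreal (poisson z t) * ennreal (cmod (u (cis t))) \<partial>angle_measure)"
    by (rule poisson_bound[OF cont _ z]) (rule holomorphic_on_subset[OF hol], use R in auto)
  also have "\<dots> \<le> (\<integral>\<^sup>+t. ennreal ?C * (1 + ennreal ((cmod (u (cis t)))\<^sup>2)) \<partial>angle_measure)"
  proof (rule nn_integral_mono)
    fix t
    have "ennreal (poisson z t) * ennreal (cmod (u (cis t))) = ennreal (poisson z t * cmod (u (cis t)))"
      using poisson_nonneg[OF z] by (simp add: ennreal_mult)
    also have "\<dots> \<le> ennreal (?C * (1 + (cmod (u (cis t)))\<^sup>2))" by (intro ennreal_leI le)
    also have "\<dots> = ennreal ?C * (1 + ennreal ((cmod (u (cis t)))\<^sup>2))"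
      by (subst ennreal_mult) auto
    finally show "ennreal (poisson z t) * ennreal (cmod (u (cis t))) \<le> ennreal ?C * (1 + ennreal ((cmod (u (cis t)))\<^sup>2))" .
  qed
  also have "\<dots> = ennreal ?C * (ennreal (2 * pi) + (\<integral>\<^sup>+t. ennreal ((cmod (u (cis t)))\<^sup>2) \<partial>angle_measure))"
    using emeasure_angle_measure by (simp add: nn_integral_cmult nn_integral_add)
  also have "\<dots> \<le> ennreal ?C * (ennreal (2 * pi) + ennreal b)"
    by (intro mult_left_mono add_left_mono bound) auto
  also have "\<dots> = ennreal (?C * (2 * pi + b))"
    using b by (subst ennreal_mult) auto
  finally show ?thesis using b by simp
qed

section \<open>Factorisation in Hardy spaces\<close>

lemma two_powers_bound:
  fixes x :: real
  assumes "x \<ge> 0" "0 < s" "s \<le> p"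
  shows "x powr s \<le> 1 + x powr p"
proof (cases "x \<le> 1")
  case True
  have "x powr s \<le> 1 powr s" using True assms by (intro powr_mono2) auto
  moreover have "x powr p \<ge> 0" by simp
  ultimately show ?thesis by (simp only: powr_one_eq_one)
next
  case False
  have "x powr s \<le> x powr p" using False assms by (intro powr_mono) auto
  thus ?thesis by simp
qed

lemma norm_exp_scaled:
  fixes L :: complex
  shows "(cmod (exp (of_real c * L)))\<^sup>2 = cmod (exp L) powr (2 * c)"
proof -
  have "(cmod (exp (of_real c * L)))\<^sup>2 = exp (c * Re L) ^ 2" by simp
  also have "\<dots> = exp (2 * (c * Re L))" by (simp add: exp_double)
  also have "\<dots> = cmod (exp L) powr (2 * c)" by (simp add: powr_def mult_ac)
  finally show ?thesis .
qed

text \<open>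
  The data of a factorisation \<open>F = B h\<^sup>m\<close> with a majorant \<open>k\<close> of \<open>\<bar>F\<bar>\<close> to the power \<open>p/2\<close>.
  The explicit bounds on \<open>h\<close> and \<open>k\<close> involve only \<open>b\<close>, and so families of such data are normal.
\<close>

definition factorizes :: "real \<Rightarrow> real \<Rightarrow> nat \<Rightarrow> (complex \<Rightarrow> complex) \<Rightarrow>
    (complex \<Rightarrow> complex) \<times> (complex \<Rightarrow> complex) \<times> (complex \<Rightarrow> complex) \<Rightarrow> bool" where
  "factorizes p b m F = (\<lambda>(B, h, k).
     B holomorphic_on ball 0 1 \<and> h holomorphic_on ball 0 1 \<and> k holomorphic_on ball 0 1 \<and>
     (\<forall>z\<in>ball 0 1. cmod (B z) \<le> 1 \<and> F z = B z * h z ^ m \<and> cmod (F z) powr p \<le> (cmod (k z))\<^sup>2 \<and>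
        cmod (h z) \<le> (2 * pi + (2 * pi + b)) / (2 * pi * (1 - cmod z)\<^sup>2) \<and>
        cmod (k z) \<le> (2 * pi + b) / (2 * pi * (1 - cmod z)\<^sup>2)) \<and>
     (\<forall>r. 0 < r \<longrightarrow> r < 1 \<longrightarrow>
        mean_square h r \<le> ennreal (2 * pi + b) \<and>
        mean_square k r \<le> ennreal b))"

text \<open>
  With \<open>F = B exp L\<close> take \<open>h = exp (L/m)\<close> and \<open>k = exp (pL/2)\<close>. On the unit circle
  \<open>\<bar>k\<bar>\<^sup>2 = \<bar>F\<bar>\<close> to the power \<open>p\<close>, and \<open>\<bar>h\<bar>\<^sup>2 = \<bar>F\<bar>\<close> to the power \<open>2/m \<le> p\<close>. Inside, the mean
  squares are smaller.
\<close>

lemma Hardy_factorization_zero_free_radii: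
  fixes f :: "complex \<Rightarrow> complex" and p b \<rho> :: real and m :: nat
  assumes hol: "f holomorphic_on ball 0 1" and "p > 0" and "b \<ge> 0" and "m > 0" and m: "2 \<le> real m * p"
    and \<rho>: "0 < \<rho>" "\<rho> < 1" and zf: "\<And>z. cmod z = \<rho> \<Longrightarrow> f z \<noteq> 0"
    and bound: "mean_power p f \<rho> \<le> ennreal b"
  shows "\<exists>G. factorizes p b m (\<lambda>z. f (of_real \<rho> * z)) G"
proof -
  define F where "F z = f (of_real \<rho> * z)" for z
  have inside: "of_real \<rho> * z \<in> ball 0 1" if "z \<in> ball 0 (1 / \<rho>)" for z :: complex
    using that \<rho> by (simp add: norm_mult field_simps)
  have "F holomorphic_on ball 0 (1 / \<rho>)"
    unfolding F_def[abs_def]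
    using holomorphic_on_compose_gen[of "\<lambda>z. of_real \<rho> * z" "ball 0 (1 / \<rho>)" f "ball 0 1"] hol inside
    by (auto simp: o_def image_subset_iff intro!: holomorphic_intros)
  moreover have "F z \<noteq> 0" if "cmod z = 1" for z
    unfolding F_def using zf[of "of_real \<rho> * z"] that \<rho> by (simp add: norm_mult)
  moreover have "1 / \<rho> > 1" using \<rho> by simp
  ultimately obtain B L S where B: "B holomorphic_on ball 0 1" "\<And>z. z \<in> ball 0 1 \<Longrightarrow> cmod (B z) \<le> 1"
    and S: "S > 1" and L: "L holomorphic_on ball 0 S"
    and FB: "\<And>z. z \<in> ball 0 1 \<Longrightarrow> F z = B z * exp (L z)"
    and FL: "\<And>z. z \<in> sphere 0 1 \<Longrightarrow> cmod (F z) = cmod (exp (L z))"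
    using blaschke_exp_factorization[of "1 / \<rho>" F] by blast
  define h where "h z = exp (of_real (1 / m) * L z)" for z
  define k where "k z = exp (of_real (p / 2) * L z)" for z
  have h_hol: "h holomorphic_on ball 0 S" and k_hol: "k holomorphic_on ball 0 S"
    unfolding h_def[abs_def] k_def[abs_def] by (intro holomorphic_intros L)+
  have sub: "ball 0 1 \<subseteq> ball (0::complex) S" using S by auto
  have k2: "(cmod (k z))\<^sup>2 = cmod (exp (L z)) powr p" for z
    unfolding k_def norm_exp_scaled by simp
  have h2: "(cmod (h z))\<^sup>2 = cmod (exp (L z)) powr (2 / m)" for z
    unfolding h_def norm_exp_scaled by simp
  have hm: "h z ^ m = exp (L z)" for z
    unfolding h_def using \<open>m > 0\<close> by (simp flip: exp_of_nat_mult)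
  have k_circle: "(\<integral>\<^sup>+\<theta>. ennreal ((cmod (k (cis \<theta>)))\<^sup>2) \<partial>angle_measure) \<le> ennreal b"
    unfolding k2 using bound FL by (simp add: F_def)
  have [measurable]: "(\<lambda>\<theta>. f (of_real \<rho> * cis \<theta>)) \<in> borel_measurable angle_measure"
    by (intro borel_measurable_angle_measureI continuous_on_compose2[OF holomorphic_on_imp_continuous_on[OF hol]]
         continuous_intros) (use \<rho> in \<open>auto simp: norm_mult\<close>)
  have "(\<integral>\<^sup>+\<theta>. ennreal ((cmod (h (cis \<theta>)))\<^sup>2) \<partial>angle_measure) \<le>
        (\<integral>\<^sup>+\<theta>. 1 + ennreal (cmod (f (of_real \<rho> * cis \<theta>)) powr p) \<partial>angle_measure)"
  proof (rule nn_integral_mono)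
    fix \<theta>
    have "cmod (F (cis \<theta>)) powr (2 / m) \<le> 1 + cmod (F (cis \<theta>)) powr p"
      using m \<open>m > 0\<close> by (intro two_powers_bound) (auto simp: field_simps)
    hence "ennreal ((cmod (h (cis \<theta>)))\<^sup>2) \<le> ennreal (1 + cmod (F (cis \<theta>)) powr p)"
      using FL[of "cis \<theta>"] unfolding h2 by (intro ennreal_leI) simp
    thus "ennreal ((cmod (h (cis \<theta>)))\<^sup>2) \<le> 1 + ennreal (cmod (f (of_real \<rho> * cis \<theta>)) powr p)"
      by (simp add: F_def)
  qed
  also have "\<dots> = ennreal (2 * pi) + mean_power p f \<rho>"
    using emeasure_angle_measure by (simp add: nn_integral_add)
  also have "\<dots> \<le> ennreal (2 * pi) + ennreal b" by (intro add_left_mono bound)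
  also have "\<dots> = ennreal (2 * pi + b)" using \<open>b \<ge> 0\<close> by simp
  finally have h_circle: "(\<integral>\<^sup>+\<theta>. ennreal ((cmod (h (cis \<theta>)))\<^sup>2) \<partial>angle_measure) \<le> ennreal (2 * pi + b)" .
  have mono: "mean_square u r \<le>
              (\<integral>\<^sup>+\<theta>. ennreal ((cmod (u (cis \<theta>)))\<^sup>2) \<partial>angle_measure)"
    if "u holomorphic_on ball 0 S" "0 < r" "r < 1" for u and r :: real
    using circle_mean_square_mono[OF that(1,2), of 1] that S by simp
  have "cmod (F z) powr p \<le> (cmod (k z))\<^sup>2" if "z \<in> ball 0 1" for z
  proof -
    have "cmod (F z) \<le> 1 * cmod (exp (L z))"
      unfolding FB[OF that] norm_mult by (intro mult_right_mono B that) auto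
    thus ?thesis unfolding k2 using \<open>p > 0\<close> by (intro powr_mono2) auto
  qed
  moreover have "cmod (h z) \<le> (2 * pi + (2 * pi + b)) / (2 * pi * (1 - cmod z)\<^sup>2)" if "z \<in> ball 0 1" for z
    using interior_bound[OF S h_hol h_circle, of z] that \<open>b \<ge> 0\<close> by simp
  moreover have "cmod (k z) \<le> (2 * pi + b) / (2 * pi * (1 - cmod z)\<^sup>2)" if "z \<in> ball 0 1" for z
    using interior_bound[OF S k_hol k_circle \<open>b \<ge> 0\<close>, of z] that by simp
  ultimately show ?thesis
    using B FB hm holomorphic_on_subset[OF h_hol sub] holomorphic_on_subset[OF k_hol sub]
      order_trans[OF mono[OF h_hol] h_circle] order_trans[OF mono[OF k_hol] k_circle]
    unfolding F_def factorizes_def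
    by (intro exI[of _ "(B, h, k)"]) auto
qed

text \<open>
  Normal families instead of infinite Blaschke products: the factors of the dilates of \<open>f\<close> have
  locally uniform limits along a subsequence, and the factorisation survives in the limit. The
  exponent \<open>m\<close> is an integer in order that no branch of a power of \<open>h\<close> has to be chosen, neither in
  the disc nor at the boundary, where \<open>h\<close> may vanish.
\<close>

lemma Hardy_factorization:
  fixes f :: "complex \<Rightarrow> complex" and p b :: real and m :: nat
  assumes hol: "f holomorphic_on ball 0 1" and "p > 0" and "b \<ge> 0" and "m > 0" and m: "2 \<le> real m * p"
    and bound: "\<And>r. 0 < r \<Longrightarrow> r < 1 \<Longrightarrow>
                  mean_power p f r \<le> ennreal b"
  obtains B h k where "B holomorphic_on ball 0 1" "h holomorphic_on ball 0 1" "k holomorphic_on ball 0 1"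
    "\<And>z. z \<in> ball 0 1 \<Longrightarrow> cmod (B z) \<le> 1" "\<And>z. z \<in> ball 0 1 \<Longrightarrow> f z = B z * h z ^ m"
    "\<And>z. z \<in> ball 0 1 \<Longrightarrow> cmod (f z) powr p \<le> (cmod (k z))\<^sup>2"
    "\<And>r. 0 < r \<Longrightarrow> r < 1 \<Longrightarrow> mean_square h r \<le> ennreal (2 * pi + b)"
    "\<And>r. 0 < r \<Longrightarrow> r < 1 \<Longrightarrow> mean_square k r \<le> ennreal b"
proof (cases "\<forall>z\<in>ball 0 1. f z = 0")
  case True
  thus thesis using \<open>m > 0\<close> \<open>b \<ge> 0\<close> by (intro that[of "\<lambda>_. 0" "\<lambda>_. 0" "\<lambda>_. 0"]) auto
next
  case False
  then obtain z0 where "z0 \<in> ball 0 1" "f z0 \<noteq> 0" by blast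
  then obtain \<rho> where \<rho>: "\<And>j. 0 < \<rho> j" "\<And>j. \<rho> j < 1" "\<rho> \<longlonglongrightarrow> 1"
    and zf: "\<And>j z. cmod z = \<rho> j \<Longrightarrow> f z \<noteq> 0"
    using zero_free_radii[OF hol] by blast
  have "\<forall>j. \<exists>G. factorizes p b m (\<lambda>z. f (of_real (\<rho> j) * z)) G"
    by (intro allI Hardy_factorization_zero_free_radii[OF hol \<open>p > 0\<close> \<open>b \<ge> 0\<close> \<open>m > 0\<close> m \<rho>(1,2) zf bound[OF \<rho>(1,2)]])
  then obtain G where G: "\<And>j. factorizes p b m (\<lambda>z. f (of_real (\<rho> j) * z)) (G j)" by metis
  define B where "B j = fst (G j)" for j
  define h where "h j = fst (snd (G j))" for j
  define k where "k j = snd (snd (G j))" for j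
  have "\<forall>j. factorizes p b m (\<lambda>z. f (of_real (\<rho> j) * z)) (B j, h j, k j)"
    using G by (simp add: B_def h_def k_def)
  note * = this[unfolded factorizes_def prod.case]
  have hols: "B j holomorphic_on ball 0 1" "h j holomorphic_on ball 0 1" "k j holomorphic_on ball 0 1" for j
    using * by auto
  have growth: "C / (2 * pi * (1 - r)\<^sup>2) \<le> C / (2 * pi * (1 - s)\<^sup>2)"
    if "0 \<le> C" "0 \<le> r" "r \<le> s" "s < 1" for C r s :: real
    using that by (intro divide_left_mono mult_left_mono power_mono mult_pos_pos) auto
  obtain B' s1 where B': "B' holomorphic_on ball 0 1" and s1: "strict_mono (s1 :: nat \<Rightarrow> nat)"
    and limB: "\<And>z. z \<in> ball 0 1 \<Longrightarrow> (\<lambda>n. B (s1 n) z) \<longlonglongrightarrow> B' z"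
    by (rule montel_disc[of B "\<lambda>_. 1"]) (use * in auto)
  obtain h' s2 where h': "h' holomorphic_on ball 0 1" and s2: "strict_mono (s2 :: nat \<Rightarrow> nat)"
    and limh: "\<And>z. z \<in> ball 0 1 \<Longrightarrow> (\<lambda>n. h (s1 (s2 n)) z) \<longlonglongrightarrow> h' z"
    by (rule montel_disc[of "\<lambda>j. h (s1 j)" "\<lambda>r. (2 * pi + (2 * pi + b)) / (2 * pi * (1 - r)\<^sup>2)"])
       (use * \<open>b \<ge> 0\<close> in \<open>auto intro!: growth\<close>)
  obtain k' s3 where k': "k' holomorphic_on ball 0 1" and s3: "strict_mono (s3 :: nat \<Rightarrow> nat)"
    and limk: "\<And>z. z \<in> ball 0 1 \<Longrightarrow> (\<lambda>n. k (s1 (s2 (s3 n))) z) \<longlonglongrightarrow> k' z"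
    by (rule montel_disc[of "\<lambda>j. k (s1 (s2 j))" "\<lambda>r. (2 * pi + b) / (2 * pi * (1 - r)\<^sup>2)"])
       (use * \<open>b \<ge> 0\<close> in \<open>auto intro!: growth\<close>)
  define s where "s n = s1 (s2 (s3 n))" for n
  have "strict_mono s" unfolding s_def[abs_def] using s1 s2 s3 by (simp add: strict_mono_def)
  have limB: "(\<lambda>n. B (s n) z) \<longlonglongrightarrow> B' z" if "z \<in> ball 0 1" for z
    using LIMSEQ_subseq_LIMSEQ[OF limB[OF that], of "\<lambda>n. s2 (s3 n)"] s2 s3
    by (simp add: o_def s_def strict_mono_def)
  have limh: "(\<lambda>n. h (s n) z) \<longlonglongrightarrow> h' z" if "z \<in> ball 0 1" for z
    using LIMSEQ_subseq_LIMSEQ[OF limh[OF that] s3] by (simp add: o_def s_def)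
  have limk: "(\<lambda>n. k (s n) z) \<longlonglongrightarrow> k' z" if "z \<in> ball 0 1" for z
    using limk[OF that] by (simp add: s_def)
  have limf: "(\<lambda>n. f (of_real (\<rho> (s n)) * z)) \<longlonglongrightarrow> f z" if "z \<in> ball 0 1" for z
  proof -
    have "isCont f z"
      using holomorphic_on_imp_continuous_on[OF hol] that by (simp add: continuous_on_eq_continuous_at)
    moreover have "(\<lambda>n. of_real (\<rho> (s n)) * z) \<longlonglongrightarrow> of_real 1 * z"
      using LIMSEQ_subseq_LIMSEQ[OF \<rho>(3) \<open>strict_mono s\<close>] by (intro tendsto_intros) (simp add: o_def)
    ultimately show ?thesis by (intro isCont_tendsto_compose[of z f]) auto
  qed
  show thesis
  proof (rule that[OF B' h' k'])
    fix z :: complex assume z: "z \<in> ball 0 1"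
    show "cmod (B' z) \<le> 1"
      by (rule LIMSEQ_le_const2[OF tendsto_norm[OF limB[OF z]]]) (use * z in auto)
    have "(\<lambda>n. B (s n) z * h (s n) z ^ m) \<longlonglongrightarrow> B' z * h' z ^ m"
      by (intro tendsto_intros limB limh z)
    moreover have "(\<lambda>n. B (s n) z * h (s n) z ^ m) \<longlonglongrightarrow> f z"
      using limf[OF z] * z by simp
    ultimately show "f z = B' z * h' z ^ m" by (metis LIMSEQ_unique)
    show "cmod (f z) powr p \<le> (cmod (k' z))\<^sup>2"
    proof (cases "f z = 0")
      case False
      show ?thesis
      proof (rule LIMSEQ_le)
        show "(\<lambda>n. cmod (f (of_real (\<rho> (s n)) * z)) powr p) \<longlonglongrightarrow> cmod (f z) powr p"
          using False by (intro tendsto_intros limf z) auto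
        show "(\<lambda>n. (cmod (k (s n) z))\<^sup>2) \<longlonglongrightarrow> (cmod (k' z))\<^sup>2"
          by (intro tendsto_intros limk z)
        have "cmod (f (of_real (\<rho> (s n)) * z)) powr p \<le> (cmod (k (s n) z))\<^sup>2" for n
          using * z by blast
        thus "\<exists>N. \<forall>n\<ge>N. cmod (f (of_real (\<rho> (s n)) * z)) powr p \<le> (cmod (k (s n) z))\<^sup>2"
          by blast
      qed
    qed simp
  next
    fix r :: real assume r: "0 < r" "r < 1"
    show "mean_square h' r \<le> ennreal (2 * pi + b)"
      by (rule circle_fatou[OF hols(2) limh r]) (use * r in auto)
    show "mean_square k' r \<le> ennreal b"
      by (rule circle_fatou[OF hols(3) limk r]) (use * r in auto)
  qed
qed

text \<open>
  Limits of \<open>f = B h\<^sup>m\<close> come from those of \<open>B\<close> and \<open>h\<close>, both of which have bounded mean squares;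
  the integrable majorant comes from the maximal function of \<open>k\<close>.
\<close>

lemma Hardy_boundary_behaviour:
  fixes f :: "complex \<Rightarrow> complex" and p b :: real
  assumes hol: "f holomorphic_on ball 0 1" and "p > 0"
    and bound: "\<And>r. 0 < r \<Longrightarrow> r < 1 \<Longrightarrow>
                  mean_power p f r \<le> ennreal b"
  shows "AE \<theta> in angle_measure. \<exists>l. \<forall>\<alpha>>1. (f \<longlongrightarrow> l) (at (cis \<theta>) within stolz \<alpha> (cis \<theta>))"
    and "\<exists>V. V \<in> borel_measurable angle_measure \<and> (\<integral>\<^sup>+\<theta>. V \<theta> \<partial>angle_measure) < \<infinity> \<and>
           (\<forall>r \<theta>. 0 \<le> r \<longrightarrow> r < 1 \<longrightarrow> ennreal (cmod (f (of_real r * cis \<theta>)) powr p) \<le> V \<theta>)"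
proof -
  have bound': "mean_power p f r \<le> ennreal (max b 0)"
    if "0 < r" "r < 1" for r
    using bound[OF that] by (rule order_trans) (intro ennreal_leI, simp)
  \<comment> \<open>With \<open>2/m < p\<close>, the power of \<open>\<bar>f\<bar>\<close> with exponent \<open>2/m\<close> has bounded means as well.\<close>
  obtain m :: nat where m: "2 / p < real m" using reals_Archimedean2 by blast
  have "2 / p > 0" using \<open>p > 0\<close> by simp
  hence "m > 0" using m by (metis of_nat_0_less_iff less_trans)
  have "2 \<le> real m * p" using m \<open>p > 0\<close> by (simp add: field_simps)
  from Hardy_factorization[OF hol \<open>p > 0\<close> max.cobounded2 \<open>m > 0\<close> this bound']
  obtain B h k where hols: "B holomorphic_on ball 0 1" "h holomorphic_on ball 0 1" "k holomorphic_on ball 0 1"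
    and B: "\<And>z. z \<in> ball 0 1 \<Longrightarrow> cmod (B z) \<le> 1" and f: "\<And>z. z \<in> ball 0 1 \<Longrightarrow> f z = B z * h z ^ m"
    and fk: "\<And>z. z \<in> ball 0 1 \<Longrightarrow> cmod (f z) powr p \<le> (cmod (k z))\<^sup>2"
    and h: "\<And>r. 0 < r \<Longrightarrow> r < 1 \<Longrightarrow> mean_square h r \<le> ennreal (2 * pi + max b 0)"
    and k: "\<And>r. 0 < r \<Longrightarrow> r < 1 \<Longrightarrow> mean_square k r \<le> ennreal (max b 0)"
    by blast
  have "mean_square B r \<le> ennreal (2 * pi)"
    if "0 < r" "r < 1" for r :: real
  proof -
    have "mean_square B r \<le> (\<integral>\<^sup>+\<theta>. 1 \<partial>angle_measure)"
      using B that by (intro nn_integral_mono) (auto simp: norm_mult power_le_one)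
    thus ?thesis using emeasure_angle_measure by simp
  qed
  hence "AE \<theta> in angle_measure. \<exists>l. \<forall>\<alpha>>1. (B \<longlongrightarrow> l) (at (cis \<theta>) within stolz \<alpha> (cis \<theta>))"
    by (rule H2_nontangential_limit[OF hols(1)])
  moreover have "AE \<theta> in angle_measure. \<exists>l. \<forall>\<alpha>>1. (h \<longlongrightarrow> l) (at (cis \<theta>) within stolz \<alpha> (cis \<theta>))"
    by (rule H2_nontangential_limit[OF hols(2)]) (rule h)
  ultimately show "AE \<theta> in angle_measure. \<exists>l. \<forall>\<alpha>>1. (f \<longlongrightarrow> l) (at (cis \<theta>) within stolz \<alpha> (cis \<theta>))"
  proof eventually_elim
    fix \<theta>
    assume "\<exists>l. \<forall>\<alpha>>1. (h \<longlongrightarrow> l) (at (cis \<theta>) within stolz \<alpha> (cis \<theta>))"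
      and "\<exists>l. \<forall>\<alpha>>1. (B \<longlongrightarrow> l) (at (cis \<theta>) within stolz \<alpha> (cis \<theta>))"
    then obtain l1 l2 where
      l: "\<And>\<alpha>. \<alpha> > 1 \<Longrightarrow> (h \<longlongrightarrow> l1) (at (cis \<theta>) within stolz \<alpha> (cis \<theta>))"
      "\<And>\<alpha>. \<alpha> > 1 \<Longrightarrow> (B \<longlongrightarrow> l2) (at (cis \<theta>) within stolz \<alpha> (cis \<theta>))" by blast
    have "(f \<longlongrightarrow> l2 * l1 ^ m) (at (cis \<theta>) within stolz \<alpha> (cis \<theta>))" if "\<alpha> > 1" for \<alpha>
    proof (rule Lim_transform_eventually)
      show "((\<lambda>z. B z * h z ^ m) \<longlongrightarrow> l2 * l1 ^ m) (at (cis \<theta>) within stolz \<alpha> (cis \<theta>))"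
        by (intro tendsto_intros l that)
      show "\<forall>\<^sub>F z in at (cis \<theta>) within stolz \<alpha> (cis \<theta>). B z * h z ^ m = f z"
        by (auto simp: eventually_at_filter stolz_def f intro!: always_eventually)
    qed
    thus "\<exists>l. \<forall>\<alpha>>1. (f \<longlongrightarrow> l) (at (cis \<theta>) within stolz \<alpha> (cis \<theta>))" by blast
  qed
  obtain W where W: "W \<in> borel_measurable angle_measure" "(\<integral>\<^sup>+\<theta>. W \<theta> \<partial>angle_measure) \<le> 2500 * ennreal (max b 0)"
    "\<And>\<alpha> \<theta> z. \<alpha> > 1 \<Longrightarrow> z \<in> stolz \<alpha> (cis \<theta>) \<Longrightarrow> ennreal ((cmod (k z))\<^sup>2 / stolz_const \<alpha>) \<le> W \<theta>"
    using H2_maximal[OF hols(3) k] by metis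
  define c where "c = stolz_const 2"
  have "c > 0" by (simp add: c_def stolz_const_def)
  show "\<exists>V. V \<in> borel_measurable angle_measure \<and> (\<integral>\<^sup>+\<theta>. V \<theta> \<partial>angle_measure) < \<infinity> \<and>
           (\<forall>r \<theta>. 0 \<le> r \<longrightarrow> r < 1 \<longrightarrow> ennreal (cmod (f (of_real r * cis \<theta>)) powr p) \<le> V \<theta>)"
  proof (intro exI[of _ "\<lambda>\<theta>. ennreal c * W \<theta>"] conjI allI impI)
    show "(\<lambda>\<theta>. ennreal c * W \<theta>) \<in> borel_measurable angle_measure" using W(1) by measurable
    have "(\<integral>\<^sup>+\<theta>. ennreal c * W \<theta> \<partial>angle_measure) = ennreal c * (\<integral>\<^sup>+\<theta>. W \<theta> \<partial>angle_measure)"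
      by (rule nn_integral_cmult[OF W(1)])
    also have "\<dots> \<le> ennreal c * (2500 * ennreal (max b 0))" by (intro mult_left_mono W(2)) simp
    also have "\<dots> < \<infinity>" by (simp add: ennreal_mult_less_top)
    finally show "(\<integral>\<^sup>+\<theta>. ennreal c * W \<theta> \<partial>angle_measure) < \<infinity>" .
  next
    fix r \<theta> :: real assume r: "0 \<le> r" "r < 1"
    let ?z = "of_real r * cis \<theta>"
    have z: "?z \<in> ball 0 1" using r by (simp add: norm_mult)
    have "?z - cis \<theta> = of_real (r - 1) * cis \<theta>" by (simp add: algebra_simps)
    hence "cmod (?z - cis \<theta>) = \<bar>r - 1\<bar>" by (simp only: norm_mult norm_of_real norm_cis mult_1_right)
    hence "?z \<in> stolz 2 (cis \<theta>)" using r z by (simp add: stolz_def norm_mult)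
    hence *: "ennreal ((cmod (k ?z))\<^sup>2 / c) \<le> W \<theta>" using W(3)[of 2] by (simp add: c_def)
    have "ennreal (cmod (f ?z) powr p) \<le> ennreal ((cmod (k ?z))\<^sup>2)"
      by (intro ennreal_leI fk z)
    also have "\<dots> = ennreal c * ennreal ((cmod (k ?z))\<^sup>2 / c)"
      using \<open>c > 0\<close> by (simp add: ennreal_mult[symmetric])
    also have "\<dots> \<le> ennreal c * W \<theta>" by (intro mult_left_mono *) simp
    finally show "ennreal (cmod (f ?z) powr p) \<le> ennreal c * W \<theta>" .
  qed
qed

section \<open>Functions with bounded means\<close>

lemma powr_add_le:
  fixes x y p :: real
  assumes "x \<ge> 0" "y \<ge> 0" "p > 0"
  shows "(x + y) powr p \<le> 2 powr p * (x powr p + y powr p)"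
proof -
  have "(x + y) powr p \<le> (2 * max x y) powr p"
    using assms by (intro powr_mono2) auto
  also have "\<dots> = 2 powr p * max x y powr p" using assms by (simp add: powr_mult)
  also have "max x y powr p \<le> x powr p + y powr p" by (auto simp: max_def)
  finally show ?thesis by simp
qed

text \<open>
  Membership in \<open>H\<^sup>p\<close> without holomorphy; continuity ensures that the means are means of
  measurable functions.
\<close>

definition has_bounded_means :: "real \<Rightarrow> (complex \<Rightarrow> complex) \<Rightarrow> bool" where
  "has_bounded_means p u \<longleftrightarrow> continuous_on unit_disc u \<and>
     (\<exists>b::real. \<forall>r. 0 < r \<longrightarrow> r < 1 \<longrightarrow>
        mean_power p u r \<le> ennreal b)"

lemma measurable_on_circle:
  fixes u :: "complex \<Rightarrow> complex"
  assumes "continuous_on unit_disc u" "0 \<le> r" "r < 1"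
  shows "(\<lambda>\<theta>. u (of_real r * cis \<theta>)) \<in> borel_measurable angle_measure"
  by (intro borel_measurable_angle_measureI continuous_on_compose2[OF assms(1)] continuous_intros)
     (use assms in \<open>auto simp: norm_mult\<close>)

lemma has_bounded_means_dominated:
  assumes u: "has_bounded_means p u" and "p > 0" and v: "continuous_on unit_disc v"
    and le: "\<And>z. z \<in> unit_disc \<Longrightarrow> cmod (v z) \<le> C * cmod (u z)"
  shows "has_bounded_means p v"
proof -
  obtain b where b: "\<And>r. 0 < r \<Longrightarrow> r < 1 \<Longrightarrow>
      mean_power p u r \<le> ennreal b"
    using u unfolding has_bounded_means_def by blast
  define D where "D = max C 0"
  have "mean_power p v r \<le> ennreal (D powr p * b)"
    if r: "0 < r" "r < 1" for r
  proof -
    have [measurable]: "(\<lambda>\<theta>. u (of_real r * cis \<theta>)) \<in> borel_measurable angle_measure"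
      using u r by (intro measurable_on_circle) (auto simp: has_bounded_means_def)
    have "mean_power p v r \<le>
          (\<integral>\<^sup>+\<theta>. ennreal (D powr p) * ennreal (cmod (u (of_real r * cis \<theta>)) powr p) \<partial>angle_measure)"
    proof (rule nn_integral_mono)
      fix \<theta>
      let ?z = "of_real r * cis \<theta>"
      have "cmod (v ?z) \<le> C * cmod (u ?z)" using r by (intro le) (simp add: norm_mult)
      also have "\<dots> \<le> D * cmod (u ?z)" by (intro mult_right_mono) (auto simp: D_def)
      finally have "cmod (v ?z) powr p \<le> (D * cmod (u ?z)) powr p"
        using \<open>p > 0\<close> by (intro powr_mono2) auto
      also have "\<dots> = D powr p * cmod (u ?z) powr p" by (rule powr_mult)
      finally show "ennreal (cmod (v ?z) powr p) \<le> ennreal (D powr p) * ennreal (cmod (u ?z) powr p)"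
        by (simp add: ennreal_mult[symmetric] ennreal_leI)
    qed
    also have "\<dots> = ennreal (D powr p) * mean_power p u r"
      by (rule nn_integral_cmult) measurable
    also have "\<dots> \<le> ennreal (D powr p) * ennreal b" by (intro mult_left_mono b r) simp
    finally show ?thesis by (simp add: ennreal_mult')
  qed
  thus ?thesis unfolding has_bounded_means_def using v by blast
qed

lemma has_bounded_means_add:
  assumes u: "has_bounded_means p u" and v: "has_bounded_means p v" and "p > 0"
  shows "has_bounded_means p (\<lambda>z. u z + v z)"
proof -
  obtain b c where b: "\<And>r. 0 < r \<Longrightarrow> r < 1 \<Longrightarrow>
      mean_power p u r \<le> ennreal b"
    and c: "\<And>r. 0 < r \<Longrightarrow> r < 1 \<Longrightarrow>
      mean_power p v r \<le> ennreal c"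
    using u v unfolding has_bounded_means_def by blast
  have "(\<integral>\<^sup>+\<theta>. ennreal (cmod (u (of_real r * cis \<theta>) + v (of_real r * cis \<theta>)) powr p) \<partial>angle_measure)
          \<le> ennreal (2 powr p * (max b 0 + max c 0))"
    if r: "0 < r" "r < 1" for r
  proof -
    have [measurable]: "(\<lambda>\<theta>. u (of_real r * cis \<theta>)) \<in> borel_measurable angle_measure"
      "(\<lambda>\<theta>. v (of_real r * cis \<theta>)) \<in> borel_measurable angle_measure"
      using u v r by (intro measurable_on_circle, auto simp: has_bounded_means_def)+
    have "(\<integral>\<^sup>+\<theta>. ennreal (cmod (u (of_real r * cis \<theta>) + v (of_real r * cis \<theta>)) powr p) \<partial>angle_measure) \<le>
      (\<integral>\<^sup>+\<theta>. ennreal (2 powr p) * (ennreal (cmod (u (of_real r * cis \<theta>)) powr p) +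
                               ennreal (cmod (v (of_real r * cis \<theta>)) powr p)) \<partial>angle_measure)"
    proof (rule nn_integral_mono)
      fix \<theta>
      let ?z = "of_real r * cis \<theta>"
      have "cmod (u ?z + v ?z) powr p \<le> (cmod (u ?z) + cmod (v ?z)) powr p"
        using \<open>p > 0\<close> by (intro powr_mono2 norm_triangle_ineq) auto
      also have "\<dots> \<le> 2 powr p * (cmod (u ?z) powr p + cmod (v ?z) powr p)"
        using \<open>p > 0\<close> by (intro powr_add_le) auto
      finally have "ennreal (cmod (u ?z + v ?z) powr p) \<le>
        ennreal (2 powr p * (cmod (u ?z) powr p + cmod (v ?z) powr p))" by (rule ennreal_leI)
      thus "ennreal (cmod (u ?z + v ?z) powr p) \<le>
        ennreal (2 powr p) * (ennreal (cmod (u ?z) powr p) + ennreal (cmod (v ?z) powr p))"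
        by (simp add: ennreal_mult)
    qed
    also have "\<dots> = ennreal (2 powr p) * (mean_power p u r +
                 mean_power p v r)"
      by (simp add: nn_integral_cmult nn_integral_add)
    also have "\<dots> \<le> ennreal (2 powr p) * (ennreal (max b 0) + ennreal (max c 0))"
      by (intro mult_left_mono add_mono order_trans[OF b] order_trans[OF c] r ennreal_leI) auto
    finally show ?thesis by (simp add: ennreal_mult)
  qed
  moreover have "continuous_on unit_disc (\<lambda>z. u z + v z)"
    using u v by (intro continuous_intros) (auto simp: has_bounded_means_def)
  ultimately show ?thesis unfolding has_bounded_means_def by blast
qed

lemma has_bounded_means_zero: "has_bounded_means p (\<lambda>_. 0)"
  unfolding has_bounded_means_def by (auto intro!: exI[of _ 0])

lemma has_bounded_means_sum:
  assumes "finite I" "\<And>i. i \<in> I \<Longrightarrow> has_bounded_means p (u i)" "p > 0"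
  shows "has_bounded_means p (\<lambda>z. \<Sum>i\<in>I. u i z)"
  using assms by (induction I rule: finite_induct) (auto intro: has_bounded_means_zero has_bounded_means_add)

section \<open>Boundary values\<close>

definition has_stolz_limit :: "(complex \<Rightarrow> 'b::topological_space) \<Rightarrow> complex \<Rightarrow> 'b \<Rightarrow> bool" where
  "has_stolz_limit u \<zeta> l \<longleftrightarrow> (\<forall>\<alpha>>1. (u \<longlongrightarrow> l) (at \<zeta> within stolz \<alpha> \<zeta>))"

text \<open>
  The properties of \<open>H\<^sup>p\<close> functions that are inherited by the polyanalytic combinations:
  nontangential limits, and one integrable majorant for all circles.
\<close>

definition has_boundary_values :: "real \<Rightarrow> (complex \<Rightarrow> complex) \<Rightarrow> bool" where
  "has_boundary_values p u \<longleftrightarrow> continuous_on unit_disc u \<and>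
     (AE \<theta> in angle_measure. \<exists>l. has_stolz_limit u (cis \<theta>) l) \<and>
     (\<exists>V. V \<in> borel_measurable angle_measure \<and> (\<integral>\<^sup>+\<theta>. V \<theta> \<partial>angle_measure) < \<infinity> \<and>
        (\<forall>r \<theta>. 0 \<le> r \<longrightarrow> r < 1 \<longrightarrow> ennreal (cmod (u (of_real r * cis \<theta>)) powr p) \<le> V \<theta>))"

lemma has_boundary_values_holomorphic:
  assumes "u holomorphic_on unit_disc" "p > 0" "has_bounded_means p u"
  shows "has_boundary_values p u"
proof -
  obtain b where b: "\<And>r. 0 < r \<Longrightarrow> r < 1 \<Longrightarrow>
      mean_power p u r \<le> ennreal b"
    using assms(3) unfolding has_bounded_means_def by blast
  show ?thesis unfolding has_boundary_values_def has_stolz_limit_def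
    using Hardy_boundary_behaviour[OF assms(1,2) b] assms(3)[unfolded has_bounded_means_def] by blast
qed

lemma has_boundary_values_add:
  assumes u: "has_boundary_values p u" and v: "has_boundary_values p v" and "p > 0"
  shows "has_boundary_values p (\<lambda>z. u z + v z)"
  unfolding has_boundary_values_def
proof (intro conjI)
  show "continuous_on unit_disc (\<lambda>z. u z + v z)"
    using u v by (intro continuous_intros) (auto simp: has_boundary_values_def)
  have "AE \<theta> in angle_measure. \<exists>l. has_stolz_limit u (cis \<theta>) l" "AE \<theta> in angle_measure. \<exists>l. has_stolz_limit v (cis \<theta>) l"
    using u v by (auto simp: has_boundary_values_def)
  thus "AE \<theta> in angle_measure. \<exists>l. has_stolz_limit (\<lambda>z. u z + v z) (cis \<theta>) l"
  proof eventually_elim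
    fix \<theta>
    assume "\<exists>l. has_stolz_limit u (cis \<theta>) l" "\<exists>l. has_stolz_limit v (cis \<theta>) l"
    then obtain l l' where "has_stolz_limit u (cis \<theta>) l" "has_stolz_limit v (cis \<theta>) l'" by blast
    hence "has_stolz_limit (\<lambda>z. u z + v z) (cis \<theta>) (l + l')"
      by (simp add: has_stolz_limit_def tendsto_add)
    thus "\<exists>l. has_stolz_limit (\<lambda>z. u z + v z) (cis \<theta>) l" by blast
  qed
  obtain V where V: "V \<in> borel_measurable angle_measure" "(\<integral>\<^sup>+\<theta>. V \<theta> \<partial>angle_measure) < \<infinity>"
    "\<And>r \<theta>. 0 \<le> r \<Longrightarrow> r < 1 \<Longrightarrow> ennreal (cmod (u (of_real r * cis \<theta>)) powr p) \<le> V \<theta>"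
    using u unfolding has_boundary_values_def by blast
  obtain W where W: "W \<in> borel_measurable angle_measure" "(\<integral>\<^sup>+\<theta>. W \<theta> \<partial>angle_measure) < \<infinity>"
    "\<And>r \<theta>. 0 \<le> r \<Longrightarrow> r < 1 \<Longrightarrow> ennreal (cmod (v (of_real r * cis \<theta>)) powr p) \<le> W \<theta>"
    using v unfolding has_boundary_values_def by blast
  note [measurable] = V(1) W(1)
  show "\<exists>V. V \<in> borel_measurable angle_measure \<and> (\<integral>\<^sup>+\<theta>. V \<theta> \<partial>angle_measure) < \<infinity> \<and>
        (\<forall>r \<theta>. 0 \<le> r \<longrightarrow> r < 1 \<longrightarrow>
          ennreal (cmod (u (of_real r * cis \<theta>) + v (of_real r * cis \<theta>)) powr p) \<le> V \<theta>)"
  proof (intro exI[of _ "\<lambda>\<theta>. ennreal (2 powr p) * (V \<theta> + W \<theta>)"] conjI allI impI)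
    show "(\<integral>\<^sup>+\<theta>. ennreal (2 powr p) * (V \<theta> + W \<theta>) \<partial>angle_measure) < \<infinity>"
      using V W by (simp add: nn_integral_cmult nn_integral_add ennreal_mult_less_top)
  next
    fix r \<theta> :: real assume r: "0 \<le> r" "r < 1"
    let ?z = "of_real r * cis \<theta>"
    have "cmod (u ?z + v ?z) powr p \<le> (cmod (u ?z) + cmod (v ?z)) powr p"
      using \<open>p > 0\<close> by (intro powr_mono2 norm_triangle_ineq) auto
    also have "\<dots> \<le> 2 powr p * (cmod (u ?z) powr p + cmod (v ?z) powr p)"
      using \<open>p > 0\<close> by (intro powr_add_le) auto
    finally have "ennreal (cmod (u ?z + v ?z) powr p) \<le>
      ennreal (2 powr p * (cmod (u ?z) powr p + cmod (v ?z) powr p))" by (rule ennreal_leI)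
    also have "\<dots> = ennreal (2 powr p) * (ennreal (cmod (u ?z) powr p) + ennreal (cmod (v ?z) powr p))"
      by (simp add: ennreal_mult)
    also have "\<dots> \<le> ennreal (2 powr p) * (V \<theta> + W \<theta>)"
      using r by (intro mult_left_mono add_mono V W) auto
    finally show "ennreal (cmod (u ?z + v ?z) powr p) \<le> ennreal (2 powr p) * (V \<theta> + W \<theta>)" .
  qed measurable
qed

lemma has_boundary_values_transform:
  assumes u: "has_boundary_values p u" and "p > 0" and cont: "continuous_on unit_disc v"
    and le: "\<And>z. z \<in> unit_disc \<Longrightarrow> cmod (v z) \<le> cmod (u z)"
    and lim: "\<And>\<theta> l. has_stolz_limit u (cis \<theta>) l \<Longrightarrow> \<exists>l. has_stolz_limit v (cis \<theta>) l"
  shows "has_boundary_values p v"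
  unfolding has_boundary_values_def
proof (intro conjI cont)
  have "AE \<theta> in angle_measure. \<exists>l. has_stolz_limit u (cis \<theta>) l" using u by (auto simp: has_boundary_values_def)
  thus "AE \<theta> in angle_measure. \<exists>l. has_stolz_limit v (cis \<theta>) l" by eventually_elim (auto dest: lim)
  obtain V where V: "V \<in> borel_measurable angle_measure" "(\<integral>\<^sup>+\<theta>. V \<theta> \<partial>angle_measure) < \<infinity>"
    "\<And>r \<theta>. 0 \<le> r \<Longrightarrow> r < 1 \<Longrightarrow> ennreal (cmod (u (of_real r * cis \<theta>)) powr p) \<le> V \<theta>"
    using u unfolding has_boundary_values_def by blast
  have "ennreal (cmod (v (of_real r * cis \<theta>)) powr p) \<le> V \<theta>" if r: "0 \<le> r" "r < 1" for r \<theta>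
  proof -
    have "cmod (v (of_real r * cis \<theta>)) powr p \<le> cmod (u (of_real r * cis \<theta>)) powr p"
      using r \<open>p > 0\<close> by (intro powr_mono2 le) (auto simp: norm_mult)
    thus ?thesis using V(3)[OF r, of \<theta>] by (meson ennreal_leI order_trans)
  qed
  thus "\<exists>V. V \<in> borel_measurable angle_measure \<and> (\<integral>\<^sup>+\<theta>. V \<theta> \<partial>angle_measure) < \<infinity> \<and>
        (\<forall>r \<theta>. 0 \<le> r \<longrightarrow> r < 1 \<longrightarrow> ennreal (cmod (v (of_real r * cis \<theta>)) powr p) \<le> V \<theta>)"
    using V(1,2) by blast
qed

lemma has_boundary_values_mult_power_cnj:
  assumes u: "has_boundary_values p u" and "p > 0"
  shows "has_boundary_values p (\<lambda>z. cnj z ^ k * u z)"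
proof (rule has_boundary_values_transform[OF u \<open>p > 0\<close>])
  show "continuous_on unit_disc (\<lambda>z. cnj z ^ k * u z)"
    using u by (intro continuous_intros) (auto simp: has_boundary_values_def)
  show "cmod (cnj z ^ k * u z) \<le> cmod (u z)" if "z \<in> unit_disc" for z
    using that by (simp add: norm_mult norm_power power_le_one mult_left_le_one_le)
  show "\<exists>l. has_stolz_limit (\<lambda>z. cnj z ^ k * u z) (cis \<theta>) l" if "has_stolz_limit u (cis \<theta>) l" for \<theta> l
    using that unfolding has_stolz_limit_def
    by (intro exI[of _ "cnj (cis \<theta>) ^ k * l"]) (auto intro!: tendsto_intros)
qed

lemma has_boundary_values_cnj:
  assumes u: "has_boundary_values p u" and "p > 0"
  shows "has_boundary_values p (\<lambda>z. cnj (u z))"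
proof (rule has_boundary_values_transform[OF u \<open>p > 0\<close>])
  show "continuous_on unit_disc (\<lambda>z. cnj (u z))"
    using u by (intro continuous_intros) (auto simp: has_boundary_values_def)
  show "\<exists>l. has_stolz_limit (\<lambda>z. cnj (u z)) (cis \<theta>) l" if "has_stolz_limit u (cis \<theta>) l" for \<theta> l
    using that unfolding has_stolz_limit_def
    by (intro exI[of _ "cnj l"]) (auto intro!: tendsto_intros)
qed simp

lemma has_boundary_values_zero: "has_boundary_values p (\<lambda>_. 0)"
  unfolding has_boundary_values_def has_stolz_limit_def
  by (auto intro!: exI[of _ 0] exI[of _ "\<lambda>_. 0"])

lemma has_boundary_values_sum:
  assumes "finite I" "\<And>i. i \<in> I \<Longrightarrow> has_boundary_values p (u i)" "p > 0"
  shows "has_boundary_values p (\<lambda>z. \<Sum>i\<in>I. u i z)"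
  using assms by (induction I rule: finite_induct) (auto intro: has_boundary_values_zero has_boundary_values_add)

lemma has_stolz_limit_radial:
  assumes "has_stolz_limit u (cis \<theta>) l" and S: "\<And>n. 0 \<le> S n" "\<And>n. S n < (1::real)" "S \<longlonglongrightarrow> 1"
  shows "(\<lambda>n. u (of_real (S n) * cis \<theta>)) \<longlonglongrightarrow> l"
proof -
  have "(u \<longlongrightarrow> l) (at (cis \<theta>) within stolz 2 (cis \<theta>))"
    using assms(1) by (simp add: has_stolz_limit_def)
  moreover have "filterlim (\<lambda>n. of_real (S n) * cis \<theta>) (at (cis \<theta>) within stolz 2 (cis \<theta>)) sequentially"
    unfolding filterlim_at
  proof (intro conjI always_eventually allI)
    have "(\<lambda>n. of_real (S n) * cis \<theta>) \<longlonglongrightarrow> of_real 1 * cis \<theta>" by (intro tendsto_intros S)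
    thus "(\<lambda>n. of_real (S n) * cis \<theta>) \<longlonglongrightarrow> cis \<theta>" by simp
    fix n
    have eq: "of_real (S n) * cis \<theta> - cis \<theta> = of_real (S n - 1) * cis \<theta>" by (simp add: algebra_simps)
    hence "cmod (of_real (S n) * cis \<theta> - cis \<theta>) = \<bar>S n - 1\<bar>" by (simp only: norm_mult norm_of_real norm_cis mult_1_right)
    thus "of_real (S n) * cis \<theta> \<in> stolz 2 (cis \<theta>)" "of_real (S n) * cis \<theta> \<noteq> cis \<theta>"
      using S(1)[of n] S(2)[of n] by (auto simp: stolz_def norm_mult)
  qed
  ultimately show ?thesis by (rule filterlim_compose)
qed

text \<open>
  A limit along a fixed sequence of radii, so that measurability is evident.
\<close>

definition boundary_value :: "(complex \<Rightarrow> complex) \<Rightarrow> complex \<Rightarrow> complex" where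
  "boundary_value u \<zeta> = lim (\<lambda>n. u (of_real (dyadic_radius n) * \<zeta>))"

lemma boundary_value_eq: "has_stolz_limit u (cis \<theta>) l \<Longrightarrow> boundary_value u (cis \<theta>) = l"
  unfolding boundary_value_def
  by (intro limI has_stolz_limit_radial) (auto simp: dyadic_radius_bounds dyadic_radius_tendsto)

lemma measurable_boundary_value:
  assumes "has_boundary_values p u"
  shows "(\<lambda>\<theta>. boundary_value u (cis \<theta>)) \<in> borel_measurable angle_measure"
  unfolding boundary_value_def
  by (intro borel_measurable_lim_metric measurable_on_circle)
     (use assms dyadic_radius_bounds in \<open>auto simp: has_boundary_values_def\<close>)

lemma boundary_value_nontangential:
  assumes "has_boundary_values p u"
  shows "AE \<theta> in angle_measure. has_stolz_limit u (cis \<theta>) (boundary_value u (cis \<theta>))"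
proof -
  have "AE \<theta> in angle_measure. \<exists>l. has_stolz_limit u (cis \<theta>) l" using assms by (auto simp: has_boundary_values_def)
  thus ?thesis by eventually_elim (auto simp: boundary_value_eq)
qed

lemma boundary_value_dominated:
  assumes "has_boundary_values p u" and "p > 0"
  obtains V where "V \<in> borel_measurable angle_measure" "(\<integral>\<^sup>+\<theta>. V \<theta> \<partial>angle_measure) < \<infinity>"
    "\<And>r \<theta>. 0 \<le> r \<Longrightarrow> r < 1 \<Longrightarrow> ennreal (cmod (u (of_real r * cis \<theta>)) powr p) \<le> V \<theta>"
    "AE \<theta> in angle_measure. ennreal (cmod (boundary_value u (cis \<theta>)) powr p) \<le> V \<theta>"
proof -
  obtain V where V: "V \<in> borel_measurable angle_measure" "(\<integral>\<^sup>+\<theta>. V \<theta> \<partial>angle_measure) < \<infinity>"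
    "\<And>r \<theta>. 0 \<le> r \<Longrightarrow> r < 1 \<Longrightarrow> ennreal (cmod (u (of_real r * cis \<theta>)) powr p) \<le> V \<theta>"
    using assms(1) unfolding has_boundary_values_def by blast
  have "AE \<theta> in angle_measure. ennreal (cmod (boundary_value u (cis \<theta>)) powr p) \<le> V \<theta>"
    using boundary_value_nontangential[OF assms(1)]
  proof eventually_elim
    fix \<theta> assume *: "has_stolz_limit u (cis \<theta>) (boundary_value u (cis \<theta>))"
    show "ennreal (cmod (boundary_value u (cis \<theta>)) powr p) \<le> V \<theta>"
    proof (cases "boundary_value u (cis \<theta>) = 0")
      case False
      have "(\<lambda>n. ennreal (cmod (u (of_real (dyadic_radius n) * cis \<theta>)) powr p)) \<longlonglongrightarrow>
            ennreal (cmod (boundary_value u (cis \<theta>)) powr p)"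
        by (intro tendsto_ennrealI tendsto_intros has_stolz_limit_radial[OF *])
           (use False dyadic_radius_bounds in \<open>auto simp: dyadic_radius_tendsto\<close>)
      thus ?thesis by (rule LIMSEQ_le_const2) (use V(3) dyadic_radius_bounds in auto)
    qed simp
  qed
  with V show thesis by (rule that)
qed

lemma boundary_value_in_Lp:
  assumes "has_boundary_values p u" and "p > 0"
  shows "(\<integral>\<^sup>+\<theta>. ennreal (cmod (boundary_value u (cis \<theta>)) powr p) \<partial>angle_measure) < \<infinity>"
proof (rule boundary_value_dominated[OF assms])
  fix V assume V: "(\<integral>\<^sup>+\<theta>. V \<theta> \<partial>angle_measure) < \<infinity>"
    "AE \<theta> in angle_measure. ennreal (cmod (boundary_value u (cis \<theta>)) powr p) \<le> V \<theta>"
  show ?thesis using nn_integral_mono_AE[OF V(2)] V(1) by (rule le_less_trans)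
qed

text \<open>
  Dominated convergence. The majorant bounds both the function on every circle and, in the
  limit, its boundary values.
\<close>

lemma boundary_value_mean_convergence:
  assumes u: "has_boundary_values p u" and "p > 0"
  shows "((\<lambda>r. \<integral>\<^sup>+\<theta>. ennreal (cmod (boundary_value u (cis \<theta>) - u (of_real r * cis \<theta>)) powr p) \<partial>angle_measure)
           \<longlongrightarrow> 0) (at_left 1)"
proof (rule tendsto_at_left_sequentially[of 0])
  fix S :: "nat \<Rightarrow> real"
  assume S: "\<And>n. S n < 1" "\<And>n. 0 < S n" "S \<longlonglongrightarrow> 1"
  obtain V where V[measurable]: "V \<in> borel_measurable angle_measure" and Vint: "(\<integral>\<^sup>+\<theta>. V \<theta> \<partial>angle_measure) < \<infinity>"
    and Vu: "\<And>r \<theta>. 0 \<le> r \<Longrightarrow> r < 1 \<Longrightarrow> ennreal (cmod (u (of_real r * cis \<theta>)) powr p) \<le> V \<theta>"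
    and Vb: "AE \<theta> in angle_measure. ennreal (cmod (boundary_value u (cis \<theta>)) powr p) \<le> V \<theta>"
    by (rule boundary_value_dominated[OF assms]) (rule that; assumption)
  note [measurable] = measurable_boundary_value[OF u]
  have [measurable]: "(\<lambda>\<theta>. u (of_real (S n) * cis \<theta>)) \<in> borel_measurable angle_measure" for n
    using u S(1,2) by (intro measurable_on_circle) (auto simp: has_boundary_values_def less_imp_le)
  have "(\<lambda>n. \<integral>\<^sup>+\<theta>. ennreal (cmod (boundary_value u (cis \<theta>) - u (of_real (S n) * cis \<theta>)) powr p) \<partial>angle_measure)
          \<longlonglongrightarrow> (\<integral>\<^sup>+\<theta>. 0 \<partial>angle_measure)"
  proof (rule nn_integral_dominated_convergence[where w = "\<lambda>\<theta>. ennreal (2 powr p) * (V \<theta> + V \<theta>)"])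
    show "(\<integral>\<^sup>+\<theta>. ennreal (2 powr p) * (V \<theta> + V \<theta>) \<partial>angle_measure) < \<infinity>"
      using Vint by (simp add: nn_integral_cmult nn_integral_add ennreal_mult_less_top)
    fix n
    show "AE \<theta> in angle_measure. ennreal (cmod (boundary_value u (cis \<theta>) - u (of_real (S n) * cis \<theta>)) powr p)
            \<le> ennreal (2 powr p) * (V \<theta> + V \<theta>)"
      using Vb
    proof eventually_elim
      fix \<theta> assume *: "ennreal (cmod (boundary_value u (cis \<theta>)) powr p) \<le> V \<theta>"
      let ?g = "boundary_value u (cis \<theta>)" and ?u = "u (of_real (S n) * cis \<theta>)"
      have "cmod (?g - ?u) powr p \<le> (cmod ?g + cmod ?u) powr p"
        using \<open>p > 0\<close> by (intro powr_mono2 norm_triangle_ineq4) auto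
      also have "\<dots> \<le> 2 powr p * (cmod ?g powr p + cmod ?u powr p)"
        using \<open>p > 0\<close> by (intro powr_add_le) auto
      finally have "ennreal (cmod (?g - ?u) powr p) \<le> ennreal (2 powr p * (cmod ?g powr p + cmod ?u powr p))"
        by (rule ennreal_leI)
      also have "\<dots> = ennreal (2 powr p) * (ennreal (cmod ?g powr p) + ennreal (cmod ?u powr p))"
        by (simp add: ennreal_mult)
      also have "\<dots> \<le> ennreal (2 powr p) * (V \<theta> + V \<theta>)"
        using S(1,2) by (intro mult_left_mono add_mono * Vu) (auto simp: less_imp_le)
      finally show "ennreal (cmod (?g - ?u) powr p) \<le> ennreal (2 powr p) * (V \<theta> + V \<theta>)" .
    qed
  next
    show "AE \<theta> in angle_measure. (\<lambda>n. ennreal (cmod (boundary_value u (cis \<theta>) - u (of_real (S n) * cis \<theta>)) powr p)) \<longlonglongrightarrow> 0"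
      using boundary_value_nontangential[OF u]
    proof eventually_elim
      fix \<theta> assume *: "has_stolz_limit u (cis \<theta>) (boundary_value u (cis \<theta>))"
      have "(\<lambda>n. u (of_real (S n) * cis \<theta>)) \<longlonglongrightarrow> boundary_value u (cis \<theta>)"
        by (rule has_stolz_limit_radial[OF *]) (auto simp: S less_imp_le)
      hence "(\<lambda>n. cmod (boundary_value u (cis \<theta>) - u (of_real (S n) * cis \<theta>))) \<longlonglongrightarrow>
               cmod (boundary_value u (cis \<theta>) - boundary_value u (cis \<theta>))"
        by (intro tendsto_intros)
      hence "(\<lambda>n. cmod (boundary_value u (cis \<theta>) - u (of_real (S n) * cis \<theta>)) powr p) \<longlonglongrightarrow> 0"
        using \<open>p > 0\<close> by (intro tendsto_zero_powrI[where b = p]) auto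
      thus "(\<lambda>n. ennreal (cmod (boundary_value u (cis \<theta>) - u (of_real (S n) * cis \<theta>)) powr p)) \<longlonglongrightarrow> 0"
        using tendsto_ennrealI[of _ 0] by simp
    qed
  qed measurable
  thus "(\<lambda>n. \<integral>\<^sup>+\<theta>. ennreal (cmod (boundary_value u (cis \<theta>) - u (of_real (S n) * cis \<theta>)) powr p) \<partial>angle_measure) \<longlonglongrightarrow> 0"
    by simp
qed simp

lemma lebesgue_on_angle_measure:
  "(\<integral>\<^sup>+\<theta>. h \<theta> \<partial>lebesgue_on {0..2*pi}) = (\<integral>\<^sup>+\<theta>. h \<theta> \<partial>angle_measure)"
  by (simp add: angle_measure_def nn_integral_restrict_space nn_integral_completion)

lemma AE_lebesgue_on_angle_measure: "(AE \<theta> in lebesgue_on {0..2*pi}. P \<theta>) \<longleftrightarrow> (AE \<theta> in angle_measure. P \<theta>)"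
  unfolding angle_measure_def by (subst (1 2) AE_restrict_space_iff) (simp_all add: AE_completion_iff)

lemma measurable_lebesgue_on_angle_measure:
  assumes "g \<in> borel_measurable angle_measure"
  shows "g \<in> borel_measurable (lebesgue_on {0..2*pi})"
proof (rule measurableI)
  fix A :: "'a set" assume "A \<in> sets borel"
  from measurable_sets[OF assms this]
  obtain B where "B \<in> sets lborel" "g -` A \<inter> {0..2*pi} = {0..2*pi} \<inter> B"
    by (auto simp: angle_measure_def sets_restrict_space space_restrict_space)
  thus "g -` A \<inter> space (lebesgue_on {0..2*pi}) \<in> sets (lebesgue_on {0..2*pi})"
    by (auto simp: sets_restrict_space space_restrict_space intro: sets_completionI_sets)
qed simp

section \<open>Characters of the bicomplex numbers\<close>

text \<open>
  The homomorphisms that carry the bicomplex theory to the complex one. On the plus component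
  \<open>j\<close> acts as \<open>-\<i>\<close>; the complex conjugation in \<open>disc_character_cnj_plus_part\<close> corrects the sign, at the
  price of being only real linear.
\<close>

definition disc_character :: "(bicomplex \<Rightarrow> complex) \<Rightarrow> bool" where
  "disc_character A \<longleftrightarrow> bounded_linear A \<and> (\<forall>x y. A (x * y) = A x * A y) \<and> A 1 = 1 \<and> A jB = \<i> \<and>
     (\<forall>z. A (bihat (cnj z)) = cnj z) \<and> (\<forall>w. cmod (A w) \<le> 2 * norm w)"

lemma norm_bicomplex_ge:
  "cmod (plus_part w) \<le> 2 * norm w" "cmod (minus_part w) \<le> 2 * norm w"
proof -
  have "x \<le> 2 * sqrt ((x\<^sup>2 + y\<^sup>2) / 2)" if "x \<ge> 0" for x y :: real
  proof -
    have "x\<^sup>2 \<le> (2 * sqrt ((x\<^sup>2 + y\<^sup>2) / 2))\<^sup>2" by (simp add: power_mult_distrib)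
    thus ?thesis by (rule power2_le_imp_le) simp
  qed
  from this[of "cmod (plus_part w)" "cmod (minus_part w)"] this[of "cmod (minus_part w)" "cmod (plus_part w)"]
  show "cmod (plus_part w) \<le> 2 * norm w" "cmod (minus_part w) \<le> 2 * norm w"
    by (simp_all add: norm_bicomplex_def add.commute)
qed

lemma disc_character_minus_part: "disc_character minus_part"
proof -
  have "bounded_linear minus_part"
  proof (rule bounded_linear_intro[where K = 2])
    show "cmod (minus_part x) \<le> norm x * 2" for x using norm_bicomplex_ge(2)[of x] by simp
  qed (simp_all add: minus_part_def algebra_simps)
  thus ?thesis unfolding disc_character_def
    using norm_bicomplex_ge(2) by (auto simp: minus_part_def jB_def bihat_def algebra_simps complex_eq_iff)
qed

lemma disc_character_cnj_plus_part: "disc_character (\<lambda>w. cnj (plus_part w))"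
proof -
  have "bounded_linear (\<lambda>w. cnj (plus_part w))"
  proof (rule bounded_linear_intro[where K = 2])
    show "cmod (cnj (plus_part x)) \<le> norm x * 2" for x using norm_bicomplex_ge(1)[of x] by simp
  qed (simp_all add: plus_part_def algebra_simps)
  moreover have "cmod (cnj (plus_part w)) \<le> 2 * norm w" for w
    using norm_bicomplex_ge(1)[of w] by simp
  ultimately show ?thesis unfolding disc_character_def
    by (auto simp: plus_part_def jB_def bihat_def algebra_simps complex_eq_iff)
qed

lemma disc_character_linear:
  assumes "disc_character A"
  shows "A (x + y) = A x + A y" "A (x * y) = A x * A y" "A (c *\<^sub>R x) = c *\<^sub>R A x" "A (\<Sum>i\<in>I. g i) = (\<Sum>i\<in>I. A (g i))"
    "A (x ^ k) = A x ^ k" "A 0 = 0" "A jB = \<i>" "A (bihat (cnj z)) = cnj z"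
proof -
  interpret bounded_linear A using assms by (simp add: disc_character_def)
  show "A (x + y) = A x + A y" "A (c *\<^sub>R x) = c *\<^sub>R A x" "A (\<Sum>i\<in>I. g i) = (\<Sum>i\<in>I. A (g i))" "A 0 = 0"
    by (simp_all add: add scaleR sum)
  show "A (x * y) = A x * A y" "A jB = \<i>" "A (bihat (cnj z)) = cnj z" using assms by (auto simp: disc_character_def)
  show "A (x ^ k) = A x ^ k" using assms by (induction k) (auto simp: disc_character_def)
qed

lemma dzbar_eqI: "(u has_derivative D) (at z) \<Longrightarrow> dzbar u z = (D 1 + \<i> * D \<i>) / 2"
  using frechet_derivative_at[of u D z] by (simp add: dzbar_def)

text \<open>
  Real linearity suffices to commute with the derivative, and \<open>A jB = \<i>\<close> turns \<open>dbar\<close> into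
  \<open>dzbar\<close>.
\<close>

lemma disc_character_dbar:
  assumes A: "disc_character A" and g: "g differentiable (at z)"
  shows "A (dbar g z) = dzbar (\<lambda>z. A (g z)) z" "(\<lambda>z. A (g z)) differentiable (at z)"
proof -
  have D: "((\<lambda>z. A (g z)) has_derivative (\<lambda>h. A (frechet_derivative g (at z) h))) (at z)"
    by (rule bounded_linear.has_derivative)
       (use A g frechet_derivative_works in \<open>auto simp: disc_character_def\<close>)
  show "A (dbar g z) = dzbar (\<lambda>z. A (g z)) z"
    unfolding dzbar_eqI[OF D] dbar_def disc_character_linear(1-3,7)[OF A]
    by (simp add: scaleR_conv_of_real)
  show "(\<lambda>z. A (g z)) differentiable (at z)" using D by (auto simp: differentiable_def)
qed

text \<open>
  The Cauchy-Riemann equations: a real linear \<open>D\<close> with \<open>D \<i> = \<i> * D 1\<close> is multiplication by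
  \<open>D 1\<close>.
\<close>

lemma dzbar_zero_imp_complex_differentiable:
  assumes "u differentiable (at z)" "dzbar u z = 0"
  obtains c where "(u has_derivative (\<lambda>h. c * h)) (at z)"
proof -
  obtain D where D: "(u has_derivative D) (at z)" using assms(1) by (auto simp: differentiable_def)
  interpret D: bounded_linear D using D by (rule has_derivative_bounded_linear)
  have "D 1 + \<i> * D \<i> = 0" using assms(2) dzbar_eqI[OF D] by simp
  hence "\<i> * (D 1 + \<i> * D \<i>) = 0" by simp
  hence Di: "D \<i> = \<i> * D 1" by (simp add: algebra_simps)
  have "D h = D 1 * h" for h
  proof -
    have "h = Re h *\<^sub>R 1 + Im h *\<^sub>R \<i>" by (simp add: complex_eq_iff)
    hence "D h = D (Re h *\<^sub>R 1 + Im h *\<^sub>R \<i>)" by (rule arg_cong)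
    also have "\<dots> = Re h *\<^sub>R D 1 + Im h *\<^sub>R D \<i>" by (simp add: D.add D.scaleR)
    also have "\<dots> = D 1 * (of_real (Re h) + \<i> * of_real (Im h))"
      by (simp add: Di scaleR_conv_of_real algebra_simps)
    also have "\<dots> = D 1 * h" by (simp flip: complex_eq)
    finally show ?thesis .
  qed
  hence "D = (\<lambda>h. D 1 * h)" by blast
  thus thesis using that[of "D 1"] D by simp
qed

lemma Hol_component_derivative:
  assumes A: "disc_character A" and \<phi>: "\<phi> \<in> Hol" and z: "z \<in> unit_disc"
  obtains c where "((\<lambda>z. A (\<phi> z)) has_derivative (\<lambda>h. c * h)) (at z)"
proof -
  have d: "\<phi> differentiable (at z)" and 0: "dbar \<phi> z = 0"
    using \<phi> z by (auto simp: Hol_def real_diff_on_disc_def)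
  show thesis
    by (rule dzbar_zero_imp_complex_differentiable[OF disc_character_dbar(2)[OF A d]])
       (use disc_character_dbar(1)[OF A d] 0 disc_character_linear(6)[OF A] that in auto)
qed

lemma Hol_component_holomorphic:
  assumes A: "disc_character A" and \<phi>: "\<phi> \<in> Hol"
  shows "(\<lambda>z. A (\<phi> z)) holomorphic_on unit_disc"
  unfolding holomorphic_on_open[OF open_ball]
proof
  fix z :: complex assume "z \<in> unit_disc"
  from Hol_component_derivative[OF A \<phi> this] obtain c where "((\<lambda>z. A (\<phi> z)) has_derivative (\<lambda>h. c * h)) (at z)" .
  thus "\<exists>f'. ((\<lambda>z. A (\<phi> z)) has_field_derivative f') (at z)"
    unfolding has_field_derivative_def by (auto simp: mult_commute_abs)
qed

lemma dzbar_cong: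
  assumes "\<And>z. z \<in> unit_disc \<Longrightarrow> u z = v z" "z \<in> unit_disc" "u differentiable (at z)"
  shows "dzbar u z = dzbar v z"
proof -
  obtain D where D: "(u has_derivative D) (at z)" using assms(3) by (auto simp: differentiable_def)
  have "(v has_derivative D) (at z)"
    by (rule has_derivative_transform_within_open[OF D open_ball assms(2)]) (rule assms(1))
  thus ?thesis using dzbar_eqI[OF D] dzbar_eqI by metis
qed

text \<open>
  For \<open>dzbar\<close> the holomorphic factors \<open>\<psi> k\<close> are constants and \<open>cnj z\<close> is the variable.
\<close>

lemma dzbar_cnj_power_mult_sum:
  assumes \<psi>: "\<And>k. k \<in> I \<Longrightarrow> \<exists>d. (\<psi> k has_derivative (\<lambda>h. d * h)) (at z)"
  shows "dzbar (\<lambda>z. \<Sum>k\<in>I. c k * (cnj z ^ e k * \<psi> k z)) z =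
         (\<Sum>k\<in>I. c k * (of_nat (e k) * cnj z ^ (e k - 1) * \<psi> k z))"
proof -
  obtain d where d: "\<And>k. k \<in> I \<Longrightarrow> (\<psi> k has_derivative (\<lambda>h. d k * h)) (at z)" using \<psi> by metis
  have cnj: "(cnj has_derivative cnj) (at z)"
    by (rule bounded_linear_imp_has_derivative[OF bounded_linear_cnj])
  have "((\<lambda>z. \<Sum>k\<in>I. c k * (cnj z ^ e k * \<psi> k z)) has_derivative
    (\<lambda>h. \<Sum>k\<in>I. c k * (cnj z ^ e k * (d k * h) + (of_nat (e k) * cnj h * cnj z ^ (e k - 1)) * \<psi> k z))) (at z)"
    by (intro has_derivative_sum has_derivative_mult_right has_derivative_mult has_derivative_power[OF cnj] d)
  from dzbar_eqI[OF this] show ?thesis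
    by (simp add: sum_distrib_left sum.distrib[symmetric] sum_divide_distrib)
       (intro sum.cong refl, simp add: algebra_simps)
qed

section \<open>Coefficients of polyanalytic Hardy functions\<close>

text \<open>
  Repeated differentiation of \<open>\<Sum>k<n. cnj z ^ k * A (\<phi> k z)\<close> as a polynomial in \<open>cnj z\<close>. The
  factor \<open>fact k / fact (k - m)\<close> is the falling factorial of \<open>k\<close> of length \<open>m\<close>.
\<close>

lemma poly_Hardy_derivative_components:
  assumes A: "disc_character A" and f: "f \<in> poly_Hardy n p"
    and \<phi>: "\<And>k. k < n \<Longrightarrow> \<phi> k \<in> Hol"
    and rep: "\<And>z. z \<in> unit_disc \<Longrightarrow> f z = (\<Sum>k<n. bihat (cnj z) ^ k * \<phi> k z)"
    and "m < n" "z \<in> unit_disc"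
  shows "A ((dbar ^^ m) f z) =
         (\<Sum>k\<in>{m..<n}. (fact k / fact (k - m)) * (cnj z ^ (k - m) * A (\<phi> k z)))"
  using \<open>m < n\<close> \<open>z \<in> unit_disc\<close>
proof (induction m arbitrary: z)
  case 0
  thus ?case using rep[of z] by (simp add: disc_character_linear[OF A] lessThan_atLeast0)
next
  case (Suc m)
  let ?F = "\<lambda>z. \<Sum>k\<in>{m..<n}. (fact k / fact (k - m)) * (cnj z ^ (k - m) * A (\<phi> k z))"
  have "real_diff_on_disc ((dbar ^^ m) f)"
    using f Suc.prems by (auto simp: poly_Hardy_def)
  hence diff: "(dbar ^^ m) f differentiable (at z)"
    using Suc.prems by (simp add: real_diff_on_disc_def)
  have "A ((dbar ^^ Suc m) f z) = dzbar (\<lambda>z. A ((dbar ^^ m) f z)) z"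
    using disc_character_dbar(1)[OF A diff] by simp
  also have "\<dots> = dzbar ?F z"
    by (rule dzbar_cong[OF _ Suc.prems(2) disc_character_dbar(2)[OF A diff]])
       (use Suc.IH Suc.prems in auto)
  also have "\<dots> = (\<Sum>k\<in>{m..<n}. (fact k / fact (k - m)) *
                     (of_nat (k - m) * cnj z ^ (k - m - 1) * A (\<phi> k z)))"
    by (rule dzbar_cnj_power_mult_sum) (use Hol_component_derivative[OF A \<phi> Suc.prems(2)] in \<open>metis atLeastLessThan_iff\<close>)
  also have "\<dots> = (\<Sum>k\<in>{Suc m..<n}. (fact k / fact (k - m)) *
                     (of_nat (k - m) * cnj z ^ (k - m - 1) * A (\<phi> k z)))"
    using Suc.prems by (subst sum.atLeast_Suc_lessThan) auto
  also have "\<dots> = (\<Sum>k\<in>{Suc m..<n}. (fact k / fact (k - Suc m)) * (cnj z ^ (k - Suc m) * A (\<phi> k z)))"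
  proof (intro sum.cong refl)
    fix k assume k: "k \<in> {Suc m..<n}"
    define j where "j = k - Suc m"
    have "k - m = Suc j" "k - m - 1 = j" "k - Suc m = j" using k by (auto simp: j_def)
    thus "(fact k / fact (k - m)) * (of_nat (k - m) * cnj z ^ (k - m - 1) * A (\<phi> k z)) =
          (fact k / fact (k - Suc m)) * (cnj z ^ (k - Suc m) * A (\<phi> k z))"
      by (simp add: divide_simps del: of_nat_Suc)
  qed
  finally show ?case .
qed

lemma poly_Hardy_bounded_means:
  assumes A: "disc_character A" and f: "f \<in> poly_Hardy n p" and "m < n" and "p > 0"
  shows "has_bounded_means p (\<lambda>z. A ((dbar ^^ m) f z))"
proof -
  let ?g = "(dbar ^^ m) f"
  have diff: "?g differentiable (at z)" if "z \<in> unit_disc" for z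
    using f \<open>m < n\<close> that by (auto simp: poly_Hardy_def real_diff_on_disc_def)
  have cont: "continuous_on unit_disc (\<lambda>z. A (?g z))"
    using differentiable_imp_continuous_within[OF disc_character_dbar(2)[OF A diff]]
    by (auto simp: continuous_on_eq_continuous_at)
  have contg: "continuous_on unit_disc ?g"
    using differentiable_imp_continuous_within[OF diff] by (auto simp: continuous_on_eq_continuous_at)
  have "Hp_norm p ?g \<le> (\<Sum>k<n. Hp_norm p ((dbar ^^ k) f))"
    using \<open>m < n\<close> by (intro member_le_sum) auto
  also have "\<dots> < \<infinity>" using f by (simp add: poly_Hardy_def)
  finally obtain c where c: "Hp_norm p ?g = ennreal c" "c \<ge> 0" by (cases "Hp_norm p ?g") auto
  have mean: "circle_mean p ?g r \<le> ennreal (c powr p)" if "0 < r" "r < 1" for r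
  proof -
    have le: "ennroot p (circle_mean p ?g r) \<le> ennreal c"
      unfolding c(1)[symmetric] Hp_norm_def by (rule SUP_upper) (use that in auto)
    hence "circle_mean p ?g r \<noteq> \<infinity>" by (auto simp: ennroot_def top_unique)
    then obtain x where x: "circle_mean p ?g r = ennreal x" "x \<ge> 0" by (cases "circle_mean p ?g r") auto
    hence "x powr (1 / p) \<le> c" using le c by (simp add: ennroot_def)
    hence "(x powr (1 / p)) powr p \<le> c powr p" using \<open>p > 0\<close> by (intro powr_mono2) auto
    hence "x \<le> c powr p" using x \<open>p > 0\<close> by (simp add: powr_powr)
    thus ?thesis using x by (simp add: ennreal_leI)
  qed
  have "(\<integral>\<^sup>+\<theta>. ennreal (cmod (A (?g (of_real r * cis \<theta>))) powr p) \<partial>angle_measure) \<le> ennreal (2 powr p * c powr p)"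
    if r: "0 < r" "r < 1" for r
  proof -
    have [measurable]: "(\<lambda>\<theta>. norm (?g (of_real r * cis \<theta>))) \<in> borel_measurable angle_measure"
      by (intro borel_measurable_angle_measureI continuous_on_norm continuous_on_compose2[OF contg] continuous_intros)
         (use r in \<open>auto simp: norm_mult\<close>)
    have "(\<integral>\<^sup>+\<theta>. ennreal (cmod (A (?g (of_real r * cis \<theta>))) powr p) \<partial>angle_measure) \<le>
          (\<integral>\<^sup>+\<theta>. ennreal (2 powr p) * ennreal (norm (?g (of_real r * cis \<theta>)) powr p) \<partial>angle_measure)"
    proof (rule nn_integral_mono)
      fix \<theta>
      let ?w = "?g (of_real r * cis \<theta>)"
      have "cmod (A ?w) powr p \<le> (2 * norm ?w) powr p"
        using A \<open>p > 0\<close> by (intro powr_mono2) (auto simp: disc_character_def)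
      also have "\<dots> = 2 powr p * norm ?w powr p" by (rule powr_mult)
      finally show "ennreal (cmod (A ?w) powr p) \<le> ennreal (2 powr p) * ennreal (norm ?w powr p)"
        by (simp add: ennreal_mult[symmetric] ennreal_leI)
    qed
    also have "\<dots> = ennreal (2 powr p) * circle_mean p ?g r"
      unfolding circle_mean_def lebesgue_on_angle_measure by (rule nn_integral_cmult) measurable
    also have "\<dots> \<le> ennreal (2 powr p) * ennreal (c powr p)" by (intro mult_left_mono mean r) simp
    finally show ?thesis by (simp add: ennreal_mult)
  qed
  thus ?thesis unfolding has_bounded_means_def using cont by blast
qed

text \<open>
  Downward induction on \<open>m\<close>: the \<open>m\<close>-th derivative is \<open>fact m * A (\<phi> m z)\<close> plus terms with the
  later coefficients, and the powers of \<open>cnj z\<close> are bounded by \<open>1\<close>.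
\<close>

lemma poly_Hardy_coefficients_bounded_means:
  assumes A: "disc_character A" and f: "f \<in> poly_Hardy n p" and "p > 0"
    and \<phi>: "\<And>k. k < n \<Longrightarrow> \<phi> k \<in> Hol"
    and rep: "\<And>z. z \<in> unit_disc \<Longrightarrow> f z = (\<Sum>k<n. bihat (cnj z) ^ k * \<phi> k z)"
    and "m < n"
  shows "has_bounded_means p (\<lambda>z. A (\<phi> m z))"
  using \<open>m < n\<close>
proof (induction "n - m" arbitrary: m rule: less_induct)
  case less
  have cont: "continuous_on unit_disc (\<lambda>z. A (\<phi> k z))" if "k < n" for k
    by (rule holomorphic_on_imp_continuous_on[OF Hol_component_holomorphic[OF A \<phi>[OF that]]])
  let ?t = "\<lambda>k z. - (fact k / fact (k - m)) * (cnj z ^ (k - m) * A (\<phi> k z))"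
  have t: "has_bounded_means p (?t k)" if k: "k \<in> {Suc m..<n}" for k
  proof (rule has_bounded_means_dominated[OF less.hyps[of k] \<open>p > 0\<close>])
    show "continuous_on unit_disc (?t k)"
      using k by (intro continuous_intros cont) auto
    fix z assume z: "z \<in> unit_disc"
    have "cmod (cnj z ^ (k - m)) \<le> 1" using z by (simp add: norm_power power_le_one)
    hence "cmod (fact k / fact (k - m) :: complex) * (cmod (cnj z ^ (k - m)) * cmod (A (\<phi> k z))) \<le>
      cmod (fact k / fact (k - m) :: complex) * (1 * cmod (A (\<phi> k z)))"
      by (intro mult_left_mono mult_right_mono) auto
    thus "cmod (?t k z) \<le> cmod (fact k / fact (k - m) :: complex) * cmod (A (\<phi> k z))"
      by (simp only: norm_mult norm_minus_cancel mult_1)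
  qed (use k less.prems in auto)
  have "has_bounded_means p (\<lambda>z. A ((dbar ^^ m) f z) + (\<Sum>k\<in>{Suc m..<n}. ?t k z))"
    by (intro has_bounded_means_add has_bounded_means_sum t poly_Hardy_bounded_means[OF A f] less.prems \<open>p > 0\<close>) auto
  thus ?case
  proof (rule has_bounded_means_dominated[OF _ \<open>p > 0\<close> cont[OF less.prems], where C = 1])
    fix z assume z: "z \<in> unit_disc"
    have "A ((dbar ^^ m) f z) =
      (\<Sum>k\<in>{m..<n}. (fact k / fact (k - m)) * (cnj z ^ (k - m) * A (\<phi> k z)))"
      by (rule poly_Hardy_derivative_components[OF A f \<phi> rep less.prems z])
    hence "A ((dbar ^^ m) f z) + (\<Sum>k\<in>{Suc m..<n}. ?t k z) = fact m * A (\<phi> m z)"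
      using less.prems by (simp add: sum.atLeast_Suc_lessThan sum_negf)
    hence "cmod (A ((dbar ^^ m) f z) + (\<Sum>k\<in>{Suc m..<n}. ?t k z)) = fact m * cmod (A (\<phi> m z))"
      by (simp add: norm_mult)
    moreover have "1 * cmod (A (\<phi> m z)) \<le> fact m * cmod (A (\<phi> m z))"
      by (intro mult_right_mono) (auto simp: fact_ge_1)
    ultimately show "cmod (A (\<phi> m z)) \<le> 1 * cmod (A ((dbar ^^ m) f z) + (\<Sum>k\<in>{Suc m..<n}. ?t k z))"
      by simp
  qed
qed

lemma poly_Hardy_component_boundary_values:
  assumes A: "disc_character A" and f: "f \<in> poly_Hardy n p" and "p > 0"
    and \<phi>: "\<And>k. k < n \<Longrightarrow> \<phi> k \<in> Hol"
    and rep: "\<And>z. z \<in> unit_disc \<Longrightarrow> f z = (\<Sum>k<n. bihat (cnj z) ^ k * \<phi> k z)"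
  shows "has_boundary_values p (\<lambda>z. A (f z))"
proof -
  have "has_boundary_values p (\<lambda>z. \<Sum>k<n. cnj z ^ k * A (\<phi> k z))"
    by (intro has_boundary_values_sum has_boundary_values_mult_power_cnj has_boundary_values_holomorphic
          Hol_component_holomorphic[OF A] poly_Hardy_coefficients_bounded_means[OF A f _ \<phi> rep] \<phi> \<open>p > 0\<close>) auto
  thus ?thesis
  proof (rule has_boundary_values_transform[OF _ \<open>p > 0\<close>])
    have eq: "A (f z) = (\<Sum>k<n. cnj z ^ k * A (\<phi> k z))" if "z \<in> unit_disc" for z
      using rep[OF that] by (simp add: disc_character_linear[OF A])
    show "cmod (A (f z)) \<le> cmod (\<Sum>k<n. cnj z ^ k * A (\<phi> k z))" if "z \<in> unit_disc" for z
      using eq[OF that] by simp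
    show "\<exists>l. has_stolz_limit (\<lambda>z. A (f z)) (cis \<theta>) l"
      if "has_stolz_limit (\<lambda>z. \<Sum>k<n. cnj z ^ k * A (\<phi> k z)) (cis \<theta>) l" for \<theta> l
    proof (intro exI[of _ l], unfold has_stolz_limit_def, intro allI impI)
      fix \<alpha> :: real assume "\<alpha> > 1"
      show "((\<lambda>z. A (f z)) \<longlongrightarrow> l) (at (cis \<theta>) within stolz \<alpha> (cis \<theta>))"
      proof (rule Lim_transform_eventually)
        show "((\<lambda>z. \<Sum>k<n. cnj z ^ k * A (\<phi> k z)) \<longlongrightarrow> l) (at (cis \<theta>) within stolz \<alpha> (cis \<theta>))"
          using that \<open>\<alpha> > 1\<close> by (simp add: has_stolz_limit_def)
        show "\<forall>\<^sub>F z in at (cis \<theta>) within stolz \<alpha> (cis \<theta>). (\<Sum>k<n. cnj z ^ k * A (\<phi> k z)) = A (f z)"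
          using eq by (auto simp: eventually_at_filter stolz_def intro!: always_eventually)
      qed
    qed
    have "continuous_on unit_disc (\<lambda>z. \<Sum>k<n. cnj z ^ k * A (\<phi> k z))"
      using holomorphic_on_imp_continuous_on[OF Hol_component_holomorphic[OF A \<phi>]] by (intro continuous_intros) auto
    thus "continuous_on unit_disc (\<lambda>z. A (f z))"
      by (rule continuous_on_cong[THEN iffD1, rotated -1]) (auto simp: eq)
  qed
qed

section \<open>Recombining the components\<close>

definition of_components :: "complex \<times> complex \<Rightarrow> bicomplex" where
  "of_components = (\<lambda>(a, b). p_plus * of_complex a + p_minus * of_complex b)"

lemma components_of_components [simp]:
  "plus_part (of_components (a, b)) = a" "minus_part (of_components (a, b)) = b"
  using idempotent_representation[of "of_components (a, b)" a b] by (auto simp: of_components_def)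

lemma bounded_linear_of_components: "bounded_linear of_components"
proof (rule bounded_linear_intro[where K = 1])
  show "of_components (x + y) = of_components x + of_components y" for x y
    by (cases x; cases y) (auto simp: of_components_def of_complex_def bicomplex_eq_iff algebra_simps)
  show "of_components (r *\<^sub>R x) = r *\<^sub>R of_components x" for r x
    by (cases x) (auto simp: of_components_def of_complex_def bicomplex_eq_iff algebra_simps)
  show "norm (of_components x) \<le> norm x * 1" for x
    by (cases x) (auto simp: norm_bicomplex_def norm_Pair)
qed

lemma of_components_parts: "w = of_components (plus_part w, minus_part w)"
  unfolding of_components_def using idempotent_representation by auto

text \<open>
  The norm is a quadratic mean of the moduli of the components, hence at most their maximum.
\<close>

lemma norm_powr_le_components:
  assumes "p > 0"
  shows "norm w powr p \<le> cmod (plus_part w) powr p + cmod (minus_part w) powr p"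
proof -
  let ?m = "max (cmod (plus_part w)) (cmod (minus_part w))"
  have "(cmod (plus_part w))\<^sup>2 \<le> ?m\<^sup>2" "(cmod (minus_part w))\<^sup>2 \<le> ?m\<^sup>2" by (intro power_mono, auto)+
  hence "norm w \<le> sqrt (?m\<^sup>2)"
    unfolding norm_bicomplex_def by (intro real_sqrt_le_mono) simp
  hence "norm w powr p \<le> ?m powr p" using \<open>p > 0\<close> by (intro powr_mono2) (auto simp: le_max_iff_disj)
  thus ?thesis by (rule order_trans) (auto simp: max_def)
qed

theorem theorem5p6:
  fixes n :: nat and p :: real and q :: "nat \<Rightarrow> real"
    and w :: "nat \<Rightarrow> complex \<Rightarrow> complex"
    and f :: "complex \<Rightarrow> bicomplex"
    and \<phi> :: "nat \<Rightarrow> complex \<Rightarrow> bicomplex"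
  assumes "n \<ge> 1" and "p > 0"
    and "\<And>k. k < n \<Longrightarrow>
           q k > 2 \<or>
           1 < q k \<and> q k \<le> 2 \<and> ereal p < (if q k = 2 then \<infinity> else ereal (q k / (2 - q k)))"
    and "\<And>k. k < n \<Longrightarrow> w k \<in> Lp (q k) (lebesgue_on unit_disc)"
    and "f \<in> poly_Hardy n p"
    and "\<And>k. k < n \<Longrightarrow> \<phi> k \<in> Hol"
    and "\<And>z. z \<in> unit_disc \<Longrightarrow> f z = (\<Sum>k<n. bihat (cnj z) ^ k * \<phi> k z)"
    and "\<And>k. k < n \<Longrightarrow> (\<lambda>z. plus_part (\<phi> k z)) \<in> Hp_inhom p (w k)"
  shows "\<exists>f\<^sub>n\<^sub>t. nontangential_limit f f\<^sub>n\<^sub>t \<and> f\<^sub>n\<^sub>t \<in> Lp_circle p \<and>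
           ((\<lambda>r. \<integral>\<^sup>+ \<theta>. ennreal (norm (f\<^sub>n\<^sub>t (cis \<theta>) - f (of_real r * cis \<theta>)) powr p)
                   \<partial>lebesgue_on {0..2*pi}) \<longlongrightarrow> 0) (at_left 1)"
proof -
  define P where "P z = plus_part (f z)" for z
  define Q where "Q z = minus_part (f z)" for z
  have "has_boundary_values p (\<lambda>z. cnj (cnj (plus_part (f z))))"
    by (intro has_boundary_values_cnj \<open>p > 0\<close>
          poly_Hardy_component_boundary_values[OF disc_character_cnj_plus_part assms(5,2,6,7)])
  hence P: "has_boundary_values p P" by (simp add: P_def[abs_def])
  have Q: "has_boundary_values p Q"
    unfolding Q_def[abs_def]
    by (rule poly_Hardy_component_boundary_values[OF disc_character_minus_part assms(5,2,6,7)])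
  define g where "g \<zeta> = of_components (boundary_value P \<zeta>, boundary_value Q \<zeta>)" for \<zeta>
  have f_eq: "f z = of_components (P z, Q z)" for z
    unfolding P_def Q_def by (rule of_components_parts)
  have "nontangential_limit f g"
    unfolding nontangential_limit_def AE_lebesgue_on_angle_measure
    using boundary_value_nontangential[OF P] boundary_value_nontangential[OF Q]
  proof eventually_elim
    fix \<theta>
    assume lim: "has_stolz_limit P (cis \<theta>) (boundary_value P (cis \<theta>))"
      "has_stolz_limit Q (cis \<theta>) (boundary_value Q (cis \<theta>))"
    show "\<forall>\<alpha>>1. (f \<longlongrightarrow> g (cis \<theta>)) (at (cis \<theta>) within stolz \<alpha> (cis \<theta>))"
      unfolding f_eq[abs_def] g_def
      using lim by (auto simp: has_stolz_limit_def
        intro!: bounded_linear.tendsto[OF bounded_linear_of_components] tendsto_Pair)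
  qed
  moreover have "g \<in> Lp_circle p"
  proof -
    have [measurable]: "(\<lambda>\<theta>. boundary_value P (cis \<theta>)) \<in> borel_measurable angle_measure"
      "(\<lambda>\<theta>. boundary_value Q (cis \<theta>)) \<in> borel_measurable angle_measure"
      by (rule measurable_boundary_value[OF P] measurable_boundary_value[OF Q])+
    have pair: "(\<lambda>\<theta>. (boundary_value P (cis \<theta>), boundary_value Q (cis \<theta>))) \<in> borel_measurable angle_measure"
      by (rule borel_measurable_Pair) measurable
    have "of_components \<in> borel_measurable borel"
      by (intro borel_measurable_continuous_onI linear_continuous_on bounded_linear_of_components)
    from measurable_compose[OF pair this]
    have g_meas: "(\<lambda>\<theta>. g (cis \<theta>)) \<in> borel_measurable angle_measure" by (simp add: g_def)
    have norm_meas: "(\<lambda>\<theta>. norm (g (cis \<theta>)) powr p) \<in> borel_measurable angle_measure"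
    proof -
      have "norm \<in> borel_measurable (borel :: bicomplex measure)"
        by (intro borel_measurable_continuous_onI continuous_intros)
      from measurable_compose[OF g_meas this] show ?thesis by measurable
    qed
    have "(\<integral>\<^sup>+\<theta>. ennreal (norm (g (cis \<theta>)) powr p) \<partial>angle_measure) \<le>
          (\<integral>\<^sup>+\<theta>. ennreal (cmod (boundary_value P (cis \<theta>)) powr p) +
               ennreal (cmod (boundary_value Q (cis \<theta>)) powr p) \<partial>angle_measure)"
    proof (rule nn_integral_mono)
      fix \<theta>
      show "ennreal (norm (g (cis \<theta>)) powr p) \<le> ennreal (cmod (boundary_value P (cis \<theta>)) powr p) +
               ennreal (cmod (boundary_value Q (cis \<theta>)) powr p)"
        using norm_powr_le_components[OF \<open>p > 0\<close>, of "g (cis \<theta>)"]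
        by (simp add: g_def ennreal_plus[symmetric] ennreal_leI del: ennreal_plus)
    qed
    also have "\<dots> = (\<integral>\<^sup>+\<theta>. ennreal (cmod (boundary_value P (cis \<theta>)) powr p) \<partial>angle_measure) +
               (\<integral>\<^sup>+\<theta>. ennreal (cmod (boundary_value Q (cis \<theta>)) powr p) \<partial>angle_measure)"
      by (rule nn_integral_add) measurable
    also have "\<dots> < \<infinity>"
      using boundary_value_in_Lp[OF P \<open>p > 0\<close>] boundary_value_in_Lp[OF Q \<open>p > 0\<close>] by simp
    finally have "integrable (lebesgue_on {0..2*pi}) (\<lambda>\<theta>. norm (g (cis \<theta>)) powr p)"
      by (intro integrableI_nonneg measurable_lebesgue_on_angle_measure norm_meas) (auto simp: lebesgue_on_angle_measure)
    thus ?thesis unfolding Lp_circle_def Lp_def using measurable_lebesgue_on_angle_measure[OF g_meas] by simp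
  qed
  moreover have "((\<lambda>r. \<integral>\<^sup>+ \<theta>. ennreal (norm (g (cis \<theta>) - f (of_real r * cis \<theta>)) powr p)
                   \<partial>lebesgue_on {0..2*pi}) \<longlongrightarrow> 0) (at_left 1)"
    unfolding lebesgue_on_angle_measure
  proof (rule tendsto_sandwich[OF _ _ tendsto_const])
    let ?I = "\<lambda>u r. \<integral>\<^sup>+\<theta>. ennreal (cmod (boundary_value u (cis \<theta>) - u (of_real r * cis \<theta>)) powr p) \<partial>angle_measure"
    show "((\<lambda>r. ?I P r + ?I Q r) \<longlongrightarrow> 0) (at_left 1)"
      using tendsto_add[OF boundary_value_mean_convergence[OF P \<open>p > 0\<close>] boundary_value_mean_convergence[OF Q \<open>p > 0\<close>]]
      by simp
    have "\<forall>\<^sub>F r in at_left 1. 0 < r \<and> r < (1::real)"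
      using eventually_at_left_real[of 0 1] by simp
    thus "\<forall>\<^sub>F r in at_left 1. (\<integral>\<^sup>+ \<theta>. ennreal (norm (g (cis \<theta>) - f (of_real r * cis \<theta>)) powr p) \<partial>angle_measure)
            \<le> ?I P r + ?I Q r"
    proof eventually_elim
      fix r :: real assume r: "0 < r \<and> r < 1"
      have [measurable]: "(\<lambda>\<theta>. boundary_value P (cis \<theta>)) \<in> borel_measurable angle_measure"
        "(\<lambda>\<theta>. boundary_value Q (cis \<theta>)) \<in> borel_measurable angle_measure"
        by (rule measurable_boundary_value[OF P] measurable_boundary_value[OF Q])+
      have [measurable]: "(\<lambda>\<theta>. P (of_real r * cis \<theta>)) \<in> borel_measurable angle_measure"
        "(\<lambda>\<theta>. Q (of_real r * cis \<theta>)) \<in> borel_measurable angle_measure"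
        using P Q r by (intro measurable_on_circle, auto simp: has_boundary_values_def)+
      have "(\<integral>\<^sup>+ \<theta>. ennreal (norm (g (cis \<theta>) - f (of_real r * cis \<theta>)) powr p) \<partial>angle_measure) \<le>
        (\<integral>\<^sup>+\<theta>. ennreal (cmod (boundary_value P (cis \<theta>) - P (of_real r * cis \<theta>)) powr p) +
             ennreal (cmod (boundary_value Q (cis \<theta>) - Q (of_real r * cis \<theta>)) powr p) \<partial>angle_measure)"
      proof (rule nn_integral_mono)
        fix \<theta>
        have "g (cis \<theta>) - f (of_real r * cis \<theta>) = of_components
          (boundary_value P (cis \<theta>) - P (of_real r * cis \<theta>), boundary_value Q (cis \<theta>) - Q (of_real r * cis \<theta>))"
          unfolding g_def f_eq
          by (simp flip: linear_diff[OF bounded_linear.linear[OF bounded_linear_of_components]])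
        thus "ennreal (norm (g (cis \<theta>) - f (of_real r * cis \<theta>)) powr p) \<le>
          ennreal (cmod (boundary_value P (cis \<theta>) - P (of_real r * cis \<theta>)) powr p) +
             ennreal (cmod (boundary_value Q (cis \<theta>) - Q (of_real r * cis \<theta>)) powr p)"
          using norm_powr_le_components[OF \<open>p > 0\<close>, of "g (cis \<theta>) - f (of_real r * cis \<theta>)"]
          by (simp add: ennreal_plus[symmetric] ennreal_leI del: ennreal_plus)
      qed
      also have "\<dots> = ?I P r + ?I Q r" by (rule nn_integral_add) measurable
      finally show "(\<integral>\<^sup>+ \<theta>. ennreal (norm (g (cis \<theta>) - f (of_real r * cis \<theta>)) powr p) \<partial>angle_measure)
            \<le> ?I P r + ?I Q r" .
    qed
  qed auto
  ultimately show ?thesis by blast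
qed

end
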